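(* Let $d\ge 1$ be an integer and let $K\in\mathbb{R}^{d\times d}$ be an invertible covariance matrix (hence symmetric positive definite). Let $G\sim\mathcal{N}_d(0,K)$, and let $F$ be a random vector in $\mathbb{R}^d$ which is conditionally Gaussian with respect to a $\sigma$-field $\mathcal{F}$, with conditional covariance matrix $A\in\mathbb{R}^{d\times d}$. Assume that $\mathbb{E}[\|A\|_{HS}^8]<\infty$. Then $$d_{TV}(F,G)\le a_1\|\mathbb{E}[A]-K\|_{HS}+b_1\,\mathbb{E}[\|A-K\|_{HS}^8]^{1/4},$$ $$W_2(F,G)\le a_2\|\mathbb{E}[A]-K\|_{HS}+b_2\,\mathbb{E}[\|A-K\|_{HS}^8]^{1/4},$$ where $$a_1=\Big(\frac{\sqrt3}{24\sqrt2}S_d\Big)^{1/2}\|K^{-1}\|_{HS},\qquad a_2=\|K\|_{op}^{1/2}\Big(\frac{\sqrt3}{6\sqrt2}S_d\Big)^{1/2}\|K^{-1}\|_{HS},$$ $$b_1=\Big[\frac{\sqrt2}{2\sqrt3\,\lambda(K)^4}S_d\|K^{-1}\|_{HS}^2(\lambda(K)^2+4\|K\|_{HS}^2)+\frac{\sqrt{70}\,d^2}{2\lambda(K)^4}\Big(\frac12M_K+\frac{(\sqrt2+1)d}{4}\Big)+\frac{c_0d^2}{2\lambda(K)^4}\Big]^{1/2}+\frac{8}{\lambda(K)^2},$$ $$b_2=\|K\|_{op}^{1/2}\Big[\frac{2\sqrt2}{\sqrt3\,\lambda(K)^4}S_d\|K^{-1}\|_{HS}^2(\lambda(K)^2+4\|K\|_{HS}^2)+\frac{2\sqrt{70}\,d^2}{\lambda(K)^4}\Big(\frac12M_K+\frac{(\sqrt2+1)d}{4}\Big)+\frac{2c_0d^2}{\lambda(K)^4}\Big]^{1/2}+\frac{2}{\lambda(K)^2},$$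 with $S_d=2\sqrt6+3\sqrt2+2+\sqrt d$, $c_0=3+\frac{\sqrt3}{8}+5\sqrt{10}+\frac{4\sqrt{30}}{3}+\frac{\sqrt{15}}{3}+\frac{10\sqrt5}{3}$, and $$M_K=\max\Big\{\Big|\log\frac{2^d\det K}{(2\|K\|_{op}+\lambda(K))^d}\Big|,\ \log\frac{2^d\det K}{\lambda(K)^d}\Big\}.$$ In particular, $\max\{d_{TV}(F,G),W_2(F,G)\}\le C_3\|\mathbb{E}[A]-K\|_{HS}+C_4\,\mathbb{E}[\|A-K\|_{HS}^8]^{1/4}$ with $C_3=\max\{a_1,a_2\}$ and $C_4=\max\{b_1,b_2\}$, which depend only on $d$ and $K$.
   Context: All random elements live on a probability space $(\Omega,\mathcal{A},\mathbb{P})$. $\mathcal{N}_d(m,\Sigma)$ is the Gaussian law on $\mathbb{R}^d$ with mean $m$ and covariance $\Sigma$. Conditionally Gaussian: an integrable random vector $X$ in $\mathbb{R}^d$ with $\mathbb{E}[X]=0$ is conditionally Gaussian with respect to a $\sigma$-field $\mathcal{F}\subseteq\mathcal{A}$ if there is an $\mathcal{F}$-measurable, positive semi-definite random matrix $A\in\mathbb{R}^{d\times d}$ (the conditional covariance matrix) such that, almost surely, $\mathbb{E}[e^{i\langle y,X\rangle}\mid\mathcal{F}]=e^{-\frac12\langle y,Ay\rangle}$ for every $y\in\mathbb{R}^d$. Distances between laws: $d_{TV}(X,Y)=\sup_{B\in\mathcal{B}(\mathbb{R}^d)}|\mathbb{P}(X\in B)-\mathbb{P}(Y\in B)|$; $W_2(X,Y)=\inf\mathbb{E}[\|Z-W\|^2]^{1/2}$,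 the infimum over all couplings $(Z,W)$ with $Z\sim X$, $W\sim Y$. $\|M\|_{HS}$ is the Hilbert–Schmidt (Frobenius) norm, $\|M\|_{op}$ the Euclidean operator norm, and $\lambda(M)$ the smallest eigenvalue of $M$. *)

theory Defs
  imports "HOL-Probability.Probability"
begin

definition positive_semidefinite :: "real^'n^'n \<Rightarrow> bool" where
  "positive_semidefinite A \<longleftrightarrow> transpose A = A \<and> (\<forall>y. 0 \<le> y \<bullet> (A *v y))"

text \<open>The Euclidean norm of the type of matrices is the Hilbert--Schmidt norm, see
  \<open>hs_norm_eq\<close> below.\<close>

abbreviation hs_norm :: "real^'m^'n \<Rightarrow> real" where
  "hs_norm A \<equiv> norm A"

lemma hs_norm_eq: "hs_norm A = sqrt (\<Sum>i\<in>UNIV. \<Sum>j\<in>UNIV. (A $ i $ j)\<^sup>2)"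
  by (simp add: norm_vec_def L2_set_def sum_nonneg)

definition op_norm :: "real^'m^'n \<Rightarrow> real" where
  "op_norm A = onorm (\<lambda>x. A *v x)"

definition eigenvalues :: "real^'n^'n \<Rightarrow> real set" where
  "eigenvalues A = {l. \<exists>v. v \<noteq> 0 \<and> A *v v = l *\<^sub>R v}"

text \<open>The set of eigenvalues is always finite, and it is nonempty for symmetric matrices, the
  only ones for which \<open>min_eigenvalue\<close> is used.\<close>

definition min_eigenvalue :: "real^'n^'n \<Rightarrow> real" where
  "min_eigenvalue A = Min (eigenvalues A)"

text \<open>The Gaussian law with mean \<open>m\<close> and covariance \<open>\<Sigma>\<close> is described by its characteristic
  function, which also covers degenerate covariance matrices.\<close>

definition gaussian_law :: "real^'n \<Rightarrow> real^'n^'n \<Rightarrow> (real^'n) measure \<Rightarrow> bool" where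
  "gaussian_law m \<Sigma> \<mu> \<longleftrightarrow>
     prob_space \<mu> \<and> sets \<mu> = sets borel \<and> positive_semidefinite \<Sigma> \<and>
     (\<forall>y. (\<integral>x. exp (\<i> * of_real (y \<bullet> x)) \<partial>\<mu>)
           = exp (\<i> * of_real (y \<bullet> m) - of_real (y \<bullet> (\<Sigma> *v y)) / 2))"

definition complex_cond_exp :: "'a measure \<Rightarrow> 'a measure \<Rightarrow> ('a \<Rightarrow> complex) \<Rightarrow> 'a \<Rightarrow> complex" where
  "complex_cond_exp M \<F> f \<omega> =
     Complex (real_cond_exp M \<F> (\<lambda>x. Re (f x)) \<omega>) (real_cond_exp M \<F> (\<lambda>x. Im (f x)) \<omega>)"

text \<open>A conditional expectation is determined only up to a null set, and for each \<open>y\<close> the term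
  \<open>complex_cond_exp\<close> is one arbitrarily chosen version. The identity is therefore required almost
  surely for each \<open>y\<close>; by this identity, the right-hand side defines versions for which the
  equation holds outside a null set that does not depend on \<open>y\<close>.\<close>

definition conditionally_gaussian ::
    "'a measure \<Rightarrow> 'a measure \<Rightarrow> ('a \<Rightarrow> real^'n^'n) \<Rightarrow> ('a \<Rightarrow> real^'n) \<Rightarrow> bool" where
  "conditionally_gaussian M \<F> A X \<longleftrightarrow>
     subalgebra M \<F> \<and>
     integrable M X \<and> integral\<^sup>L M X = 0 \<and>
     A \<in> borel_measurable \<F> \<and> (\<forall>\<omega>\<in>space M. positive_semidefinite (A \<omega>)) \<and>
     (\<forall>y. AE \<omega> in M.
        complex_cond_exp M \<F> (\<lambda>x. exp (\<i> * of_real (y \<bullet> X x))) \<omega>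
          = of_real (exp (- (y \<bullet> (A \<omega> *v y)) / 2)))"

definition tv_dist :: "'b::topological_space measure \<Rightarrow> 'b measure \<Rightarrow> real" where
  "tv_dist \<mu> \<nu> = (SUP B\<in>sets borel. \<bar>measure \<mu> B - measure \<nu> B\<bar>)"

text \<open>A coupling is represented by its joint law.\<close>

definition couplings :: "'b::topological_space measure \<Rightarrow> 'b measure \<Rightarrow> ('b \<times> 'b) measure set" where
  "couplings \<mu> \<nu> = {\<pi>. prob_space \<pi> \<and> sets \<pi> = sets (borel \<Otimes>\<^sub>M borel) \<and>
      distr \<pi> borel fst = \<mu> \<and> distr \<pi> borel snd = \<nu>}"

definition ennreal_sqrt :: "ennreal \<Rightarrow> ennreal" where
  "ennreal_sqrt x = (if x = \<infinity> then \<infinity> else ennreal (sqrt (enn2real x)))"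

text \<open>The distance takes values in the extended nonnegative reals, so that couplings of infinite
  cost do not count as couplings of cost zero.\<close>

definition wasserstein2 :: "'b::real_normed_vector measure \<Rightarrow> 'b measure \<Rightarrow> ennreal" where
  "wasserstein2 \<mu> \<nu> =
     (INF \<pi>\<in>couplings \<mu> \<nu>. ennreal_sqrt (\<integral>\<^sup>+p. ennreal ((norm (fst p - snd p))\<^sup>2) \<partial>\<pi>))"

definition d_TV :: "'a measure \<Rightarrow> ('a \<Rightarrow> real^'n) \<Rightarrow> ('a \<Rightarrow> real^'n) \<Rightarrow> real" where
  "d_TV M X Y = tv_dist (distr M borel X) (distr M borel Y)"

definition W2 :: "'a measure \<Rightarrow> ('a \<Rightarrow> real^'n) \<Rightarrow> ('a \<Rightarrow> real^'n) \<Rightarrow> ennreal" where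
  "W2 M X Y = wasserstein2 (distr M borel X) (distr M borel Y)"

definition S_const :: "nat \<Rightarrow> real" where
  "S_const d = 2 * sqrt 6 + 3 * sqrt 2 + 2 + sqrt (real d)"

definition c0 :: real where
  "c0 = 3 + sqrt 3 / 8 + 5 * sqrt 10 + 4 * sqrt 30 / 3 + sqrt 15 / 3 + 10 * sqrt 5 / 3"

definition M_const :: "real^'n^'n \<Rightarrow> real" where
  "M_const K =
     max \<bar>ln (2 ^ CARD('n) * det K / (2 * op_norm K + min_eigenvalue K) ^ CARD('n))\<bar>
         (ln (2 ^ CARD('n) * det K / min_eigenvalue K ^ CARD('n)))"

definition a1 :: "real^'n^'n \<Rightarrow> real" where
  "a1 K = sqrt (sqrt 3 / (24 * sqrt 2) * S_const CARD('n)) * hs_norm (matrix_inv K)"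

definition a2 :: "real^'n^'n \<Rightarrow> real" where
  "a2 K = sqrt (op_norm K) * sqrt (sqrt 3 / (6 * sqrt 2) * S_const CARD('n))
          * hs_norm (matrix_inv K)"

definition b1 :: "real^'n^'n \<Rightarrow> real" where
  "b1 K = (let d = real CARD('n); l = min_eigenvalue K in
     sqrt (sqrt 2 / (2 * sqrt 3 * l ^ 4) * S_const CARD('n) * (hs_norm (matrix_inv K))\<^sup>2
             * (l\<^sup>2 + 4 * (hs_norm K)\<^sup>2)
           + sqrt 70 * d\<^sup>2 / (2 * l ^ 4) * (M_const K / 2 + (sqrt 2 + 1) * d / 4)
           + c0 * d\<^sup>2 / (2 * l ^ 4))
     + 8 / l\<^sup>2)"

definition b2 :: "real^'n^'n \<Rightarrow> real" where
  "b2 K = (let d = real CARD('n); l = min_eigenvalue K in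
     sqrt (op_norm K) *
     sqrt (2 * sqrt 2 / (sqrt 3 * l ^ 4) * S_const CARD('n) * (hs_norm (matrix_inv K))\<^sup>2
             * (l\<^sup>2 + 4 * (hs_norm K)\<^sup>2)
           + 2 * sqrt 70 * d\<^sup>2 / l ^ 4 * (M_const K / 2 + (sqrt 2 + 1) * d / 4)
           + 2 * c0 * d\<^sup>2 / l ^ 4)
     + 2 / l\<^sup>2)"

definition C3 :: "real^'n^'n \<Rightarrow> real" where
  "C3 K = max (a1 K) (a2 K)"

definition C4 :: "real^'n^'n \<Rightarrow> real" where
  "C4 K = max (b1 K) (b2 K)"

end

theory Submission
  imports Defs "HOL-Real_Asymp.Real_Asymp"
begin

text \<open>After the linear change of variables \<open>X = K\<^bsup>-1/2\<^esup> F\<close> the reference law is the standard Gaussian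
  measure, and the conditional covariance is \<open>I + D\<close> with \<open>\<parallel>D\<parallel> \<le> \<parallel>A - K\<parallel> / \<lambda>(K)\<close>. On the event
  \<open>\<parallel>D\<parallel> \<le> 1/2\<close> the law of \<open>X\<close> has a density with respect to the standard Gaussian measure, namely the
  average of the densities of the laws \<open>N(0, I + D)\<close>. The first-order part of such a density in \<open>D\<close> is
  linear in \<open>D\<close>, hence averages to a term governed by \<open>E[D]\<close>, while the remainder has \<open>L\<^sup>2\<close> norm at most
  \<open>\<parallel>D\<parallel>\<^sup>2 / \<surd>2\<close>. This bounds the \<open>\<chi>\<^sup>2\<close> divergence, which controls the total variation distance by
  Cauchy--Schwarz and the Wasserstein distance by Talagrand's transport inequality together with
  \<open>Ent \<le> \<chi>\<^sup>2\<close>. The complementary event is handled by Markov's inequality and an independent coupling.\<close>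

subsection \<open>One-dimensional transport\<close>

text \<open>The threshold 1/2 does three jobs. The density of \<open>N(0, I + D)\<close> relative to
  the standard Gaussian measure is square integrable only for eigenvalues of \<open>D\<close> in
  (-1, 1); its growth stays below exp(|x|^2 / 6), which marginals and conditional densities inherit
  in the transport argument; and the squared eigenvalues sum to at most 1/4, where 1 / sqrt (1 - u)
  \<le> 1 + u / 2 + u^2 / 2. The event lies in \<F>, so the conditional characteristic function can
  be integrated over it. Talagrand's inequality comes from the Knothe-Rosenblatt map: one coordinate
  after another is moved by a monotone map, and the chain rule for the entropy adds up the costs.
  All errors other than E[D] are bounded by multiples of sqrt (E |D|^4), and E |A - K|^4 is at most
  the square root of the eighth moment; hence the power 1/4. Up to factors from K, the constants
  obtained are 1 / sqrt 2 and 8 for total variation, sqrt 2 and sqrt (96 + 66 d^2) for the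
  Wasserstein distance; numerical bounds on \<open>S_const\<close> and \<open>c0\<close> place them
  below those of the statement.\<close>

lemma nn_integral_continuous_Icc:
  fixes f :: "real \<Rightarrow> real"
  assumes "continuous_on {a..b} f" "\<And>x. x \<in> {a..b} \<Longrightarrow> 0 \<le> f x"
  shows "(\<integral>\<^sup>+x. ennreal (f x) * indicator {a..b} x \<partial>lborel) = ennreal (integral {a..b} f)"
proof -
  let ?f = "\<lambda>x. indicator {a..b} x *\<^sub>R f x"
  have "set_integrable lborel {a..b} f"
    using assms by (intro borel_integrable_atLeastAtMost') auto
  then have 1: "integrable lborel ?f" by (simp add: set_integrable_def)
  have "(\<integral>\<^sup>+x. ennreal (f x) * indicator {a..b} x \<partial>lborel) = (\<integral>\<^sup>+x. ennreal (?f x) \<partial>lborel)"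
    by (intro nn_integral_cong) (auto simp: indicator_def)
  also have "\<dots> = ennreal (integral\<^sup>L lborel ?f)"
    using assms by (intro nn_integral_eq_integral 1) (auto simp: indicator_def)
  also have "integral\<^sup>L lborel ?f = integral {a..b} f"
    using set_borel_integral_eq_integral(2)[of "{a..b}" f] 1
    by (simp add: set_integrable_def set_lebesgue_integral_def)
  finally show ?thesis .
qed

text \<open>Positivity and continuity make the distribution function a differentiable increasing
  bijection onto (0, 1), so that the quantile function is a true inverse with a derivative.\<close>

locale pos_density =
  fixes w :: "real \<Rightarrow> real"
  assumes cont: "continuous_on UNIV w" and pos: "\<And>x. 0 < w x"
    and total: "(\<integral>\<^sup>+x. ennreal (w x) \<partial>lborel) = 1"
begin

lemma w_measurable [measurable]: "w \<in> borel_measurable borel"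
  using cont by (rule borel_measurable_continuous_onI)

definition "\<mu> = density lborel (\<lambda>x. ennreal (w x))"

lemma real_distribution: "real_distribution \<mu>"
proof -
  have "prob_space \<mu>" unfolding \<mu>_def by (rule prob_spaceI) (simp add: emeasure_density total)
  then show ?thesis
    unfolding real_distribution_def real_distribution_axioms_def by (auto simp: \<mu>_def)
qed

sublocale real_distribution \<mu> by (rule real_distribution)

abbreviation "H \<equiv> cdf \<mu>"

lemma cdf_diff:
  assumes "a \<le> b" shows "H b - H a = integral {a..b} w"
proof -
  have 1: "continuous_on {a..b} w" by (rule continuous_on_subset[OF cont]) auto
  have "ennreal (H b - H a) = emeasure \<mu> {a<..b}"
    using emeasure_Ioc[OF assms] by simp
  also have "\<dots> = (\<integral>\<^sup>+x. ennreal (w x) * indicator {a<..b} x \<partial>lborel)"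
    by (simp add: \<mu>_def emeasure_density)
  also have "\<dots> = (\<integral>\<^sup>+x. ennreal (w x) * indicator {a..b} x \<partial>lborel)"
    by (rule nn_integral_cong_AE, rule AE_mp[OF AE_lborel_singleton[of a]])
      (auto simp: indicator_def)
  also have "\<dots> = ennreal (integral {a..b} w)"
    using pos by (intro nn_integral_continuous_Icc 1) (auto simp: less_imp_le)
  finally have "ennreal (H b - H a) = ennreal (integral {a..b} w)" .
  moreover have "0 \<le> integral {a..b} w"
    using pos by (intro integral_nonneg integrable_continuous_real 1) (simp add: less_imp_le)
  ultimately show ?thesis using assms by (simp add: cdf_nondecreasing)
qed

text \<open>On [t - 1, t + 1] the distribution function is a constant plus the integral of the
  continuous function \<open>w\<close>, so the fundamental theorem of calculus applies at the
  interior point \<open>t\<close>.\<close>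

lemma DERIV_cdf: "(H has_real_derivative w t) (at t)"
proof -
  have c: "continuous_on {t-1..t+1} w" by (rule continuous_on_subset[OF cont]) auto
  have "((\<lambda>x. integral {t-1..x} w) has_real_derivative w t) (at t within {t-1..t+1})"
    by (rule integral_has_real_derivative[OF c]) auto
  then have "((\<lambda>x. H (t-1) + integral {t-1..x} w) has_real_derivative w t) (at t within {t-1..t+1})"
    by (auto intro!: derivative_eq_intros)
  then have "(H has_real_derivative w t) (at t within {t-1..t+1})"
    by (rule has_field_derivative_transform_within[where d=1])
      (auto simp: cdf_diff[symmetric] dist_real_def)
  moreover have "at t within {t-1..t+1} = at t"
    by (rule at_within_interior) auto
  ultimately show ?thesis by simp
qed

lemma cdf_strict_mono: "x < y \<Longrightarrow> H x < H y"
  by (rule DERIV_pos_imp_increasing[of x y H]) (auto intro!: DERIV_cdf exI pos)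

lemma cdf_less_iff: "H x < H y \<longleftrightarrow> x < y"
  by (metis cdf_strict_mono less_asym linorder_neqE_linordered_idom order_less_irrefl)

lemma cdf_le_iff: "H x \<le> H y \<longleftrightarrow> x \<le> y"
  by (meson cdf_less_iff not_le)

lemma cdf_eq_iff: "H x = H y \<longleftrightarrow> x = y"
  by (metis cdf_le_iff order_antisym order_refl)

lemma cdf_range: "0 < H x" "H x < 1"
proof -
  have "0 \<le> H (x - 1)" by (simp add: cdf_def)
  also have "\<dots> < H x" by (rule cdf_strict_mono) simp
  finally show "0 < H x" .
  have "H x < H (x + 1)" by (rule cdf_strict_mono) simp
  also have "\<dots> \<le> 1" by (rule cdf_bounded_prob)
  finally show "H x < 1" .
qed

lemma continuous_cdf: "isCont H x"
  using DERIV_cdf by (rule DERIV_isCont)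

lemma cdf_surj: assumes "0 < p" "p < 1" shows "\<exists>t. H t = p"
proof -
  obtain a where a: "H a < p"
    using order_tendstoD(2)[OF cdf_lim_at_bot assms(1)] 
    by (auto simp: eventually_at_bot_linorder)
  obtain b where b: "p < H b"
    using order_tendstoD(1)[OF cdf_lim_at_top_prob assms(2)] 
    by (auto simp: eventually_at_top_linorder)
  have "a \<le> b" using a b cdf_less_iff[of a b] by auto
  then show ?thesis
    using IVT[of H a p b] a b continuous_cdf by auto
qed

text \<open>Meaningful only for \<open>p\<close> in (0, 1), where \<open>cdf_surj\<close> gives
  existence and strict monotonicity gives uniqueness.\<close>

definition "quantile p = (THE t. H t = p)"

lemma quantile_cdf: "quantile (H t) = t"
  unfolding quantile_def by (auto simp: cdf_eq_iff)

lemma cdf_quantile: "0 < p \<Longrightarrow> p < 1 \<Longrightarrow> H (quantile p) = p"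
  using cdf_surj quantile_cdf by metis

lemma isCont_quantile: assumes "0 < p" "p < 1" shows "isCont quantile p"
proof -
  have "isCont quantile (H (quantile p))"
    by (rule isCont_inverse_function[where d=1]) (auto simp: quantile_cdf continuous_cdf)
  then show ?thesis using cdf_quantile assms by simp
qed

lemma DERIV_quantile:
  assumes "0 < p" "p < 1"
  shows "(quantile has_real_derivative inverse (w (quantile p))) (at p)"
  using pos[of "quantile p"] assms
  by (intro DERIV_inverse_function[where f=H and a=0 and b=1] DERIV_cdf isCont_quantile)
    (auto simp: cdf_quantile)

end

abbreviation "\<phi> \<equiv> std_normal_density"
abbreviation "\<gamma>1 \<equiv> density lborel (\<lambda>x. ennreal (std_normal_density x))"

lemma nn_integral_gamma1:
  "f \<in> borel_measurable borel \<Longrightarrow> (\<integral>\<^sup>+x. f x \<partial>\<gamma>1) = (\<integral>\<^sup>+x. ennreal (\<phi> x) * f x \<partial>lborel)"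
  by (subst nn_integral_density) auto

lemma prob_space_gamma1: "prob_space \<gamma>1"
  by (rule prob_space_normal_density) simp

lemma phi_pos: "0 < \<phi> x" by (rule normal_density_pos) simp

lemma DERIV_phi: "(\<phi> has_real_derivative (- x * \<phi> x)) (at x)"
  unfolding std_normal_density_def by (auto intro!: derivative_eq_intros simp: field_simps)

lemma continuous_phi: "continuous_on S \<phi>"
  using DERIV_phi by (meson DERIV_isCont continuous_at_imp_continuous_on)

lemma phi_minus: "\<phi> (- x) = \<phi> x" by (simp add: std_normal_density_def)

lemma phi_mono: "\<bar>y\<bar> \<le> \<bar>x\<bar> \<Longrightarrow> \<phi> x \<le> \<phi> y"
  unfolding std_normal_density_def
  by (intro mult_left_mono) (auto simp: abs_le_square_iff)

text \<open>The exponent is -n^2/2 + (n + 1)^2/4, which tends to minus infinity. The shift by one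
  comes from \<open>phi_T_bound\<close>, where a second moment is tested on an interval of length
  one.\<close>

lemma phi_ratio: "(\<lambda>n::nat. \<phi> (real n) / sqrt (\<phi> (real n + 1))) \<longlonglongrightarrow> 0"
proof -
  have "\<phi> x / sqrt (\<phi> (x + 1)) = sqrt (1 / sqrt (2 * pi)) * exp (- x\<^sup>2/4 + x/2 + 1/4)" for x
  proof -
    define c :: real where "c = 1 / sqrt (2 * pi)"
    have c: "0 < c" by (simp add: c_def)
    have e: "sqrt (exp (- (x + 1)\<^sup>2 / 2)) = exp (- (x + 1)\<^sup>2 / 4)"
      by (rule real_sqrt_unique) (auto simp: power2_eq_square exp_add[symmetric])
    have "\<phi> x / sqrt (\<phi> (x + 1)) = c * exp (- x\<^sup>2/2) / (sqrt c * exp (- (x + 1)\<^sup>2 / 4))"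
      by (simp only: std_normal_density_def c_def[symmetric] e real_sqrt_mult[of c])
    also have "\<dots> = c / sqrt c * (exp (- x\<^sup>2/2) / exp (- (x + 1)\<^sup>2 / 4))"
      by simp
    also have "exp (- x\<^sup>2/2) / exp (- (x + 1)\<^sup>2 / 4) = exp (- x\<^sup>2/2 + (x + 1)\<^sup>2 / 4)"
      by (subst exp_diff[symmetric]) simp
    also have "c / sqrt c = sqrt c" using c by (simp add: real_div_sqrt)
    also have "- x\<^sup>2/2 + (x + 1)\<^sup>2 / 4 = - x\<^sup>2/4 + x/2 + 1/4"
      by (simp add: power2_eq_square field_simps)
    finally show ?thesis by (simp add: c_def)
  qed
  moreover have "filterlim (\<lambda>n::nat. - (real n)\<^sup>2/4 + real n/2 + 1/4) at_bot sequentially"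
    by real_asymp
  then have "(\<lambda>n::nat. exp (- (real n)\<^sup>2/4 + real n/2 + 1/4)) \<longlonglongrightarrow> 0"
    by (rule filterlim_compose[OF exp_at_bot])
  ultimately show ?thesis by (simp add: tendsto_mult_right_zero)
qed

lemma x_phi_lim: "(\<lambda>n::nat. real n * \<phi> (real n)) \<longlonglongrightarrow> 0"
  unfolding std_normal_density_def by real_asymp

interpretation std: pos_density \<phi>
proof
  show "(\<integral>\<^sup>+x. ennreal (\<phi> x) \<partial>lborel) = 1"
    using prob_space.emeasure_space_1[OF prob_space_gamma1] by (simp add: emeasure_density)
qed (auto simp: phi_pos continuous_phi)

text \<open>The summand \<open>1 - u\<close> integrates to zero against a probability measure. It makes the entropy
  density nonnegative, so that entropies can be taken as extended nonnegative integrals.\<close>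

definition ent :: "real \<Rightarrow> real" where "ent u = u * ln u - u + 1"

lemma ent_nonneg: "0 < u \<Longrightarrow> 0 \<le> ent u"
proof -
  assume u: "0 < u"
  have "ln (1 / u) \<le> 1 / u - 1" using u by (intro ln_le_minus_one) auto
  then have "u * (- ln u) \<le> u * (1 / u - 1)" using u by (intro mult_left_mono) (auto simp: ln_div)
  also have "u * (1 / u - 1) = 1 - u" using u by (simp add: right_diff_distrib)
  finally show ?thesis by (simp add: ent_def)
qed

lemma measurable_ent [measurable]: "ent \<in> borel_measurable borel"
  unfolding ent_def[abs_def] by measurable

section \<open>Monotone rearrangement of the Gaussian measure on the line\<close>

locale gauss_density =
  fixes g :: "real \<Rightarrow> real"
  assumes contg: "continuous_on UNIV g" and posg: "\<And>x. 0 < g x"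
    and totalg: "(\<integral>\<^sup>+x. ennreal (g x) \<partial>\<gamma>1) = 1"
    and moment: "(\<integral>\<^sup>+x. ennreal (x\<^sup>2 * g x) \<partial>\<gamma>1) < \<infinity>"
begin

lemma g_measurable [measurable]: "g \<in> borel_measurable borel"
  using contg by (rule borel_measurable_continuous_onI)

sublocale pos_density "\<lambda>x. \<phi> x * g x"
proof
  show "(\<integral>\<^sup>+x. ennreal (\<phi> x * g x) \<partial>lborel) = 1"
    using totalg by (subst (asm) nn_integral_gamma1) (auto simp: ennreal_mult' less_imp_le posg)
qed (auto intro!: continuous_intros contg continuous_phi mult_pos_pos posg phi_pos)

lemma mu_eq: "\<mu> = density \<gamma>1 (\<lambda>x. ennreal (g x))"
  unfolding \<mu>_def by (subst density_density_eq) (auto simp: ennreal_mult' less_imp_le posg)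

text \<open>The monotone rearrangement: the increasing map that carries the standard Gaussian
  measure to the measure with density \<open>g\<close> relative to it.\<close>

definition T :: "real \<Rightarrow> real" where "T x = quantile (std.H x)"

lemma H_T: "H (T x) = std.H x"
  unfolding T_def by (rule cdf_quantile) (auto simp: std.cdf_range)

lemma T_less_iff: "T x < T y \<longleftrightarrow> x < y"
  using cdf_less_iff[of "T x" "T y"] by (simp add: H_T std.cdf_less_iff)

lemma T_le_iff: "T x \<le> T y \<longleftrightarrow> x \<le> y"
  by (meson T_less_iff not_le)

lemma T_surj: "\<exists>x. T x = t"
proof -
  obtain x where "std.H x = H t" using std.cdf_surj[of "H t"] cdf_range by auto
  then show ?thesis using quantile_cdf unfolding T_def by metis
qed

lemma DERIV_T: "(T has_real_derivative (\<phi> x / (\<phi> (T x) * g (T x)))) (at x)"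
proof -
  have "((\<lambda>x. quantile (std.H x)) has_real_derivative
      (inverse (\<phi> (quantile (std.H x)) * g (quantile (std.H x))) * \<phi> x)) (at x)"
    by (rule DERIV_chain2[OF DERIV_quantile std.DERIV_cdf]) (auto simp: std.cdf_range)
  then show ?thesis by (simp add: T_def[abs_def] field_simps)
qed

lemma continuous_T: "continuous_on S T"
  using DERIV_T by (meson DERIV_isCont continuous_at_imp_continuous_on)

lemma T_measurable [measurable]: "T \<in> borel_measurable borel"
  using continuous_T by (rule borel_measurable_continuous_onI)

lemma distr_T: "distr \<gamma>1 borel T = density \<gamma>1 (\<lambda>x. ennreal (g x))"
  unfolding mu_eq[symmetric]
proof (rule cdf_unique)
  show "real_distribution (distr \<gamma>1 borel T)"
    using std.real_distribution_distr[of T] by (simp add: std.\<mu>_def)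
  show "real_distribution \<mu>" by (rule real_distribution)
  show "cdf (distr \<gamma>1 borel T) = cdf \<mu>"
  proof
    fix t
    obtain x where x: "T x = t" using T_surj by auto
    have "cdf (distr \<gamma>1 borel T) t = measure \<gamma>1 (T -` {..t})"
      unfolding cdf_def by (subst measure_distr) auto
    also have "T -` {..t} = {..x}" using x T_le_iff by auto
    also have "measure \<gamma>1 {..x} = H t"
      using H_T[of x] x by (simp add: cdf_def std.\<mu>_def)
    finally show "cdf (distr \<gamma>1 borel T) t = cdf \<mu> t" .
  qed
qed

lemma nn_integral_T:
  assumes [measurable]: "f \<in> borel_measurable borel"
  shows "(\<integral>\<^sup>+x. f (T x) \<partial>\<gamma>1) = (\<integral>\<^sup>+x. f x * ennreal (g x) \<partial>\<gamma>1)"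
proof -
  have "(\<integral>\<^sup>+x. f (T x) \<partial>\<gamma>1) = (\<integral>\<^sup>+x. f x \<partial>distr \<gamma>1 borel T)"
    by (subst nn_integral_distr) auto
  also have "\<dots> = (\<integral>\<^sup>+x. f x * ennreal (g x) \<partial>\<gamma>1)"
    unfolding distr_T by (subst nn_integral_density) (auto simp: mult.commute)
  finally show ?thesis .
qed

lemma T_at_top: "filterlim T at_top at_top"
  unfolding filterlim_at_top
proof
  fix Z obtain x where "T x = Z" using T_surj by auto
  then show "\<forall>\<^sub>F x in at_top. Z \<le> T x"
    using T_le_iff by (auto simp: eventually_at_top_linorder)
qed

lemma T_at_bot: "filterlim T at_bot at_bot"
  unfolding filterlim_at_bot
proof
  fix Z obtain x where "T x = Z" using T_surj by auto
  then show "\<forall>\<^sub>F x in at_bot. T x \<le> Z"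
    using T_le_iff by (auto simp: eventually_at_bot_linorder)
qed

text \<open>In the change of variables for the monotone map \<open>T\<close>, all terms other than the cost and the
  entropy combine to the derivative of \<open>Z\<close>, which contributes only boundary terms that vanish at
  infinity.\<close>

definition "Z x = std.H x - std.H (T x) + (T x - x) * \<phi> x"

definition "Z' x = \<phi> x - \<phi> x / g (T x) + (\<phi> x / (\<phi> (T x) * g (T x)) - 1) * \<phi> x - x * (T x - x) * \<phi> x"

lemma DERIV_Z: "(Z has_real_derivative Z' x) (at x)"
proof -
  have "((\<lambda>x. std.H (T x)) has_real_derivative (\<phi> (T x) * (\<phi> x / (\<phi> (T x) * g (T x))))) (at x)"
    by (rule DERIV_chain2[OF std.DERIV_cdf DERIV_T])
  then have 1: "((\<lambda>x. std.H (T x)) has_real_derivative (\<phi> x / g (T x))) (at x)"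
    using phi_pos[of "T x"] by simp
  show ?thesis
    unfolding Z_def[abs_def] Z'_def
    by (rule DERIV_cong[OF DERIV_add[OF DERIV_diff[OF std.DERIV_cdf 1]
        DERIV_mult[OF DERIV_diff[OF DERIV_T DERIV_ident] DERIV_phi]]]) (simp add: algebra_simps)
qed

text \<open>Logarithms in g(T) \<phi>(T) T' = \<phi> give ln g(T x) = (T x)^2 / 2 - x^2 / 2 - ln
  T'(x), and ln T' \<le> T' - 1 makes the inequality linear in T'. Since \<open>ent u / u\<close>
  equals ln u - 1 + 1 / u, the terms left over are those collected in \<open>Z'\<close>.\<close>

lemma pointwise: "(T x - x)\<^sup>2 / 2 * \<phi> x \<le> ent (g (T x)) / g (T x) * \<phi> x + Z' x"
proof -
  define D where "D = \<phi> x / (\<phi> (T x) * g (T x))"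
  have D: "0 < D" unfolding D_def using phi_pos posg by simp
  have "g (T x) = \<phi> x / (\<phi> (T x) * D)"
    unfolding D_def using phi_pos[of x] phi_pos[of "T x"] posg[of "T x"] by (simp add: field_simps)
  also have "\<phi> x / (\<phi> (T x) * D) = exp ((T x)\<^sup>2 / 2 - x\<^sup>2 / 2) / D"
    unfolding std_normal_density_def exp_diff by (simp add: exp_minus field_simps)
  finally have "ln (g (T x)) = (T x)\<^sup>2 / 2 - x\<^sup>2 / 2 - ln D" using D by (simp add: ln_div)
  moreover have "ln D \<le> D - 1" using D by (rule ln_le_minus_one)
  ultimately have "(T x)\<^sup>2 / 2 - x\<^sup>2 / 2 - (D - 1) \<le> ln (g (T x))" by simp
  then have "(T x - x)\<^sup>2 / 2 \<le> ln (g (T x)) + (D - 1) - x * (T x - x)"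
    by (simp add: power2_eq_square field_simps)
  then have "(T x - x)\<^sup>2 / 2 * \<phi> x \<le> (ln (g (T x)) + (D - 1) - x * (T x - x)) * \<phi> x"
    by (intro mult_right_mono) auto
  also have "\<dots> = ent (g (T x)) / g (T x) * \<phi> x + Z' x"
    unfolding Z'_def D_def[symmetric] ent_def using posg[of "T x"] by (simp add: field_simps)
  finally show ?thesis .
qed

text \<open>The second moment of the target law, rewritten through the transport map. It is what
  forces the boundary terms of \<open>Z\<close> to vanish.\<close>

lemma second_moment_T: "\<exists>C>0. (\<integral>\<^sup>+x. ennreal ((T x)\<^sup>2) \<partial>\<gamma>1) \<le> ennreal C"
proof -
  have "(\<integral>\<^sup>+x. ennreal ((T x)\<^sup>2) \<partial>\<gamma>1) = (\<integral>\<^sup>+x. ennreal (x\<^sup>2 * g x) \<partial>\<gamma>1)"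
    by (subst nn_integral_T) (auto simp: ennreal_mult')
  with moment obtain c where "(\<integral>\<^sup>+x. ennreal ((T x)\<^sup>2) \<partial>\<gamma>1) = ennreal c" "0 \<le> c"
    by (metis ennreal_cases infinity_ennreal_def order_less_irrefl)
  then show ?thesis by (intro exI[of _ "c + 1"]) (auto intro!: ennreal_leI)
qed

text \<open>Markov's inequality on a unit interval. Monotonicity of \<open>T\<close> will supply
  \<open>B\<close> as the square of the value at one endpoint.\<close>

lemma phi_T_bound:
  assumes C: "(\<integral>\<^sup>+x. ennreal ((T x)\<^sup>2) \<partial>\<gamma>1) \<le> ennreal C" "0 < C"
    and x: "\<And>y. y \<in> {a..a+1} \<Longrightarrow> B \<le> (T y)\<^sup>2 \<and> p \<le> \<phi> y" "0 \<le> B" "0 < p"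
  shows "B * p \<le> C"
proof -
  have "ennreal (B * p) = (\<integral>\<^sup>+x. ennreal (B * p) * indicator {a..a+1} x \<partial>lborel)"
    by (subst nn_integral_cmult_indicator) auto
  also have "\<dots> \<le> (\<integral>\<^sup>+x. ennreal (\<phi> x) * ennreal ((T x)\<^sup>2) \<partial>lborel)"
  proof (rule nn_integral_mono)
    fix y :: real
    have "B * p \<le> \<phi> y * (T y)\<^sup>2" if "y \<in> {a..a+1}"
    proof -
      have "p * B \<le> \<phi> y * (T y)\<^sup>2" using x that by (intro mult_mono) auto
      then show ?thesis by (simp add: mult.commute)
    qed
    then show "ennreal (B * p) * indicator {a..a+1} y \<le> ennreal (\<phi> y) * ennreal ((T y)\<^sup>2)"
      by (auto simp: indicator_def ennreal_mult'[symmetric] intro!: ennreal_leI)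
  qed
  also have "\<dots> = (\<integral>\<^sup>+x. ennreal ((T x)\<^sup>2) \<partial>\<gamma>1)" by (subst nn_integral_gamma1) auto
  also have "\<dots> \<le> ennreal C" by fact
  finally show ?thesis using C by (simp add: ennreal_le_iff2)
qed

text \<open>On [n, n + 1] one has T \<ge> T n \<ge> 0 for large n and \<phi> \<ge> \<phi>(n + 1), so
  (T n)^2 \<phi>(n + 1) \<le> C by the second moment. Hence |T n| \<phi>(n) is at most sqrt C times
  the quotient in \<open>phi_ratio\<close>. At minus infinity the interval is [-n - 1, -n].\<close>

lemma T_phi_lim: "(\<lambda>n::nat. T (real n) * \<phi> (real n)) \<longlonglongrightarrow> 0" (is ?A)
  "(\<lambda>n::nat. T (- real n) * \<phi> (- real n)) \<longlonglongrightarrow> 0" (is ?B)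
proof -
  obtain C where C: "(\<integral>\<^sup>+x. ennreal ((T x)\<^sup>2) \<partial>\<gamma>1) \<le> ennreal C" "0 < C"
    using second_moment_T by auto
  have lim: "(\<lambda>n::nat. sqrt C * (\<phi> (real n) / sqrt (\<phi> (real n + 1)))) \<longlonglongrightarrow> 0"
    by (intro tendsto_mult_right_zero phi_ratio)
  have step: "\<bar>t\<bar> * \<phi> (real n) \<le> sqrt C * (\<phi> (real n) / sqrt (\<phi> (real n + 1)))"
    if "t\<^sup>2 * \<phi> (real n + 1) \<le> C" for t n
  proof -
    have "sqrt (t\<^sup>2 * \<phi> (real n + 1)) \<le> sqrt C" using that by simp
    then have "\<bar>t\<bar> * sqrt (\<phi> (real n + 1)) \<le> sqrt C" by (simp add: real_sqrt_mult)
    then have "\<bar>t\<bar> \<le> sqrt C / sqrt (\<phi> (real n + 1))"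
      using phi_pos[of "real n + 1"] by (simp add: field_simps)
    then have "\<bar>t\<bar> * \<phi> (real n) \<le> sqrt C / sqrt (\<phi> (real n + 1)) * \<phi> (real n)"
      using phi_pos[of "real n"] by (intro mult_right_mono) auto
    then show ?thesis by simp
  qed
  have e1: "\<forall>\<^sub>F n::nat in sequentially. 0 \<le> T (real n)"
    using filterlim_compose[OF T_at_top filterlim_real_sequentially]
    by (auto simp: filterlim_at_top)
  have e2: "\<forall>\<^sub>F n::nat in sequentially. T (- real n) \<le> 0"
    using filterlim_compose[OF T_at_bot, OF filterlim_compose[OF filterlim_uminus_at_bot_at_top filterlim_real_sequentially]]
    by (auto simp: filterlim_at_bot)
  show ?A
  proof (rule Lim_null_comparison[OF _ lim], rule eventually_mono[OF e1])
    fix n :: nat assume n: "0 \<le> T (real n)"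
    have "(T (real n))\<^sup>2 * \<phi> (real n + 1) \<le> C"
      by (rule phi_T_bound[OF C, of "real n"]) (auto simp: T_le_iff n phi_pos intro!: power_mono phi_mono)
    from step[OF this] show "norm (T (real n) * \<phi> (real n)) \<le> sqrt C * (\<phi> (real n) / sqrt (\<phi> (real n + 1)))"
      by (simp add: abs_mult)
  qed
  show ?B
  proof (rule Lim_null_comparison[OF _ lim], rule eventually_mono[OF e2])
    fix n :: nat assume n: "T (- real n) \<le> 0"
    have "(T (- real n))\<^sup>2 * \<phi> (real n + 1) \<le> C"
    proof (rule phi_T_bound[OF C, of "- real n - 1"])
      fix y assume y: "y \<in> {- real n - 1..- real n - 1 + 1}"
      then have "T y \<le> T (- real n)" by (auto simp: T_le_iff)
      then have "\<bar>T (- real n)\<bar> \<le> \<bar>T y\<bar>" using n by auto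
      then show "(T (- real n))\<^sup>2 \<le> (T y)\<^sup>2 \<and> \<phi> (real n + 1) \<le> \<phi> y"
        using y by (auto simp: abs_le_square_iff intro!: phi_mono)
    qed (auto simp: phi_pos)
    from step[OF this] show "norm (T (- real n) * \<phi> (- real n)) \<le> sqrt C * (\<phi> (real n) / sqrt (\<phi> (real n + 1)))"
      by (simp add: abs_mult phi_minus)
  qed
qed

text \<open>The distribution function has the same limit along x and along T x at either end, and
  the products with \<phi> vanish there.\<close>

lemma Z_lim: "(\<lambda>n::nat. Z (real n) - Z (- real n)) \<longlonglongrightarrow> 0"
proof -
  have n: "filterlim (\<lambda>n::nat. - real n) at_bot sequentially"
    by (rule filterlim_compose[OF filterlim_uminus_at_bot_at_top filterlim_real_sequentially])
  have 1: "(\<lambda>n::nat. Z (real n)) \<longlonglongrightarrow> 1 - 1 + (0 - 0)"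
    unfolding Z_def left_diff_distrib
    by (intro tendsto_add tendsto_diff T_phi_lim x_phi_lim
      filterlim_compose[OF std.cdf_lim_at_top_prob] filterlim_compose[OF T_at_top] filterlim_real_sequentially)
  have x2: "(\<lambda>n::nat. - real n * \<phi> (- real n)) \<longlonglongrightarrow> 0"
    using tendsto_minus[OF x_phi_lim] by (simp add: phi_minus)
  have 2: "(\<lambda>n::nat. Z (- real n)) \<longlonglongrightarrow> 0 - 0 + (0 - 0)"
    unfolding Z_def left_diff_distrib
    by (intro tendsto_add tendsto_diff T_phi_lim x2
      filterlim_compose[OF std.cdf_lim_at_bot] filterlim_compose[OF T_at_bot] n)
  from tendsto_diff[OF 1 2] show ?thesis by simp
qed

text \<open>The pointwise inequality is integrated over [-n, n], where every term is continuous and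
  finite. Only the increment of \<open>Z\<close> is signed; it enters in absolute value and tends to
  zero, so a possibly infinite entropy is never subtracted.\<close>

lemma cost_T:
  "(\<integral>\<^sup>+x. ennreal ((T x - x)\<^sup>2) \<partial>\<gamma>1) \<le> (\<integral>\<^sup>+x. ennreal (2 * ent (g x)) \<partial>\<gamma>1)"
proof -
  define a where "a x = (T x - x)\<^sup>2 / 2 * \<phi> x" for x
  define b where "b x = ent (g (T x)) / g (T x) * \<phi> x" for x
  have gT: "continuous_on S (\<lambda>x. g (T x))" for S
    by (rule continuous_on_compose2[OF contg continuous_T]) auto
  have pT: "continuous_on S (\<lambda>x. \<phi> (T x))" for S
    by (rule continuous_on_compose2[OF continuous_phi continuous_T]) auto
  have n0: "g (T x) \<noteq> 0" "\<phi> (T x) \<noteq> 0" for x using posg[of "T x"] phi_pos[of "T x"] by auto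
  have ca: "continuous_on S a" for S
    unfolding a_def by (intro continuous_intros continuous_T continuous_phi) auto
  have cb: "continuous_on S b" for S
    unfolding b_def ent_def using n0 by (intro continuous_intros gT continuous_phi) auto
  have cZ: "continuous_on S Z'" for S
    unfolding Z'_def using n0 by (intro continuous_intros gT pT continuous_T continuous_phi) auto
  have a0: "0 \<le> a x" for x by (simp add: a_def)
  have b0: "0 \<le> b x" for x unfolding b_def using posg ent_nonneg by (simp add: less_imp_le)
  have [measurable]: "a \<in> borel_measurable borel" "b \<in> borel_measurable borel"
    using ca cb by (auto intro: borel_measurable_continuous_onI)
  define I where "I = (\<integral>\<^sup>+x. ennreal (b x) \<partial>lborel)"
  have le: "(\<integral>\<^sup>+x. ennreal (a x) * indicator {- real n..real n} x \<partial>lborel)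
      \<le> I + ennreal \<bar>Z (real n) - Z (- real n)\<bar>" for n
  proof -
    let ?S = "{- real n..real n}"
    have hZ: "(Z' has_integral (Z (real n) - Z (- real n))) ?S"
      by (rule fundamental_theorem_of_calculus)
        (auto intro: has_vector_derivative_at_within simp: DERIV_Z[unfolded has_real_derivative_iff_has_vector_derivative])
    have ib: "b integrable_on ?S" by (intro integrable_continuous_real cb)
    have "integral ?S a \<le> integral ?S (\<lambda>x. b x + Z' x)"
      using pointwise by (intro integral_le integrable_continuous_real continuous_intros ca cb cZ)
        (auto simp: a_def b_def)
    also have "\<dots> = integral ?S b + (Z (real n) - Z (- real n))"
      using integral_unique[OF has_integral_add[OF integrable_integral[OF ib] hZ]] .
    also have "\<dots> \<le> integral ?S b + \<bar>Z (real n) - Z (- real n)\<bar>" by simp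
    finally have *: "ennreal (integral ?S a) \<le> ennreal (integral ?S b) + ennreal \<bar>Z (real n) - Z (- real n)\<bar>"
      using b0 by (subst ennreal_plus[symmetric]) (auto intro!: integral_nonneg ib ennreal_leI)
    have "ennreal (integral ?S b) \<le> I"
    proof -
      have "ennreal (integral ?S b) = (\<integral>\<^sup>+x. ennreal (b x) * indicator ?S x \<partial>lborel)"
        using b0 by (subst nn_integral_continuous_Icc) (auto intro: cb)
      also have "\<dots> \<le> I" unfolding I_def
        by (rule nn_integral_mono) (auto simp: indicator_def)
      finally show ?thesis .
    qed
    moreover have "(\<integral>\<^sup>+x. ennreal (a x) * indicator ?S x \<partial>lborel) = ennreal (integral ?S a)"
      using a0 by (subst nn_integral_continuous_Icc) (auto intro: ca)
    ultimately show ?thesis using * by (metis add_right_mono order_trans)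
  qed
  have "(\<lambda>n::nat. \<integral>\<^sup>+x. ennreal (a x) * indicator {- real n..real n} x \<partial>lborel)
      \<longlonglongrightarrow> (\<integral>\<^sup>+x. ennreal (a x) \<partial>lborel)"
  proof (rule nn_integral_LIMSEQ)
    show "incseq (\<lambda>n x. ennreal (a x) * indicator {- real n..real n} x)"
      by (auto simp: incseq_def le_fun_def indicator_def)
    fix x :: real
    obtain N :: nat where "\<bar>x\<bar> \<le> real N" using real_arch_simple by auto
    then have "\<forall>\<^sub>F n in sequentially. ennreal (a x) * indicator {- real n..real n} x = ennreal (a x)"
      by (intro eventually_sequentiallyI[of N]) (auto simp: indicator_def)
    then show "(\<lambda>n. ennreal (a x) * indicator {- real n..real n} x) \<longlonglongrightarrow> ennreal (a x)"
      by (rule tendsto_eventually)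
  qed auto
  moreover have "(\<lambda>n::nat. I + ennreal \<bar>Z (real n) - Z (- real n)\<bar>) \<longlonglongrightarrow> I + ennreal 0"
    using tendsto_rabs_zero[OF Z_lim] by (intro tendsto_add tendsto_const tendsto_ennrealI)
  ultimately have "(\<integral>\<^sup>+x. ennreal (a x) \<partial>lborel) \<le> I + ennreal 0"
    using le by (intro LIMSEQ_le) auto
  then have "2 * (\<integral>\<^sup>+x. ennreal (a x) \<partial>lborel) \<le> 2 * I" by (simp add: mult_left_mono)
  moreover have "2 * (\<integral>\<^sup>+x. ennreal (a x) \<partial>lborel) = (\<integral>\<^sup>+x. ennreal ((T x - x)\<^sup>2) \<partial>\<gamma>1)"
    by (subst nn_integral_gamma1, simp, subst nn_integral_cmult[symmetric])
      (auto intro!: nn_integral_cong simp: a_def ennreal_mult'[symmetric] ennreal_numeral[symmetric]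
        simp del: ennreal_numeral)
  moreover have "I = (\<integral>\<^sup>+x. ennreal (ent (g (T x)) / g (T x)) \<partial>\<gamma>1)"
    unfolding I_def b_def using posg
    by (subst nn_integral_gamma1, simp)
      (auto intro!: nn_integral_cong simp: ennreal_mult'[symmetric] mult.commute)
  \<comment> \<open>Undoing the substitution by \<open>T\<close> multiplies the integrand by
    \<open>g\<close>, which cancels the denominator left by \<open>pointwise\<close>.\<close>
  moreover have "\<dots> = (\<integral>\<^sup>+x. ennreal (ent (g x)) \<partial>\<gamma>1)"
    using posg posg[THEN less_imp_neq]
    by (subst nn_integral_T[of "\<lambda>x. ennreal (ent (g x) / g x)"], simp)
       (auto intro!: nn_integral_cong simp: ennreal_mult''[symmetric] less_imp_le)
  moreover have "2 * (\<integral>\<^sup>+x. ennreal (ent (g x)) \<partial>\<gamma>1) = (\<integral>\<^sup>+x. ennreal (2 * ent (g x)) \<partial>\<gamma>1)"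
    by (subst nn_integral_cmult[symmetric]) (auto intro!: nn_integral_cong simp: ennreal_mult')
  ultimately show ?thesis by simp
qed

end

subsection \<open>Tensorization of the transport inequality\<close>

abbreviation borel_fun :: "('n \<Rightarrow> real) measure" where "borel_fun \<equiv> PiM UNIV (\<lambda>_. borel)"

text \<open>The listed coordinates are integrated out, the head of the list outermost, and the
  remaining ones stay as parameters. Marginals and conditional densities thus live on one space of
  functions, and statements about them can be proved by induction on the list.\<close>

fun iter_integral :: "'n::finite list \<Rightarrow> (('n \<Rightarrow> real) \<Rightarrow> ennreal) \<Rightarrow> ('n \<Rightarrow> real) \<Rightarrow> ennreal" where
  "iter_integral [] f x = f x"
| "iter_integral (i # js) f x = (\<integral>\<^sup>+t. iter_integral js f (x(i := t)) \<partial>\<gamma>1)"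

lemma measurable_fun_upd' [measurable (raw)]:
  fixes f :: "'a \<Rightarrow> 'n \<Rightarrow> real"
  assumes [measurable]: "f \<in> measurable M borel_fun" "g \<in> borel_measurable M"
  shows "(\<lambda>x. (f x)(i := g x)) \<in> measurable M borel_fun"
proof (rule measurable_PiM_single')
  fix j show "(\<lambda>x. ((f x)(i := g x)) j) \<in> borel_measurable M"
    by (cases "j = i") auto
qed (auto simp: space_PiM)

lemma sigma_finite_gamma1: "sigma_finite_measure \<gamma>1"
  using prob_space_gamma1 by (meson prob_space_imp_sigma_finite)

lemma nn_integral_gamma1_measurable [measurable (raw)]:
  assumes [measurable]: "case_prod f \<in> borel_measurable (N \<Otimes>\<^sub>M borel)"
  shows "(\<lambda>x. \<integral>\<^sup>+t. f x t \<partial>\<gamma>1) \<in> borel_measurable N"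
proof -
  interpret sigma_finite_measure \<gamma>1 by (rule sigma_finite_gamma1)
  have "case_prod f \<in> borel_measurable (N \<Otimes>\<^sub>M \<gamma>1)"
    using assms by (simp cong: measurable_cong_sets)
  then show ?thesis by (rule borel_measurable_nn_integral)
qed

lemma iter_integral_measurable [measurable]:
  assumes [measurable]: "f \<in> borel_measurable borel_fun"
  shows "iter_integral js f \<in> borel_measurable borel_fun"
proof (induction js)
  case (Cons i js)
  note Cons[measurable]
  show ?case unfolding iter_integral.simps by measurable
qed simp

lemma borel_fun_const_measurable [measurable, simp]: "(\<lambda>t. x) \<in> measurable M borel_fun"
  by (rule measurable_const) (simp add: space_PiM)

lemma iter_integral_upd_measurable [measurable]:
  assumes [measurable]: "f \<in> borel_measurable borel_fun"
  shows "(\<lambda>t. iter_integral js f (x(i := t))) \<in> borel_measurable borel"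
  by measurable

text \<open>The fibre over \<open>x\<close>: the points visited by an iterated integral over the
  coordinates in \<open>I\<close> started at \<open>x\<close>. Comparison lemmas need their
  hypotheses on this fibre only.\<close>

definition agree :: "'n set \<Rightarrow> ('n \<Rightarrow> real) \<Rightarrow> ('n \<Rightarrow> real) \<Rightarrow> bool" where
  "agree I x y \<longleftrightarrow> (\<forall>j. j \<notin> I \<longrightarrow> y j = x j)"

lemma agree_refl [simp]: "agree I x x" by (simp add: agree_def)

lemma agree_Cons: "agree (set js) (x(i := t)) y \<Longrightarrow> agree (set (i # js)) x y"
  by (auto simp: agree_def fun_upd_def split: if_splits)

lemma iter_integral_mono:
  assumes "\<And>y. agree (set js) x y \<Longrightarrow> f y \<le> g y"
  shows "iter_integral js f x \<le> iter_integral js g x"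
  using assms
proof (induction js arbitrary: x)
  case (Cons i js)
  show ?case unfolding iter_integral.simps
    by (intro nn_integral_mono Cons.IH Cons.prems agree_Cons)
qed simp

lemma iter_integral_cong:
  assumes "\<And>y. agree (set js) x y \<Longrightarrow> f y = g y"
  shows "iter_integral js f x = iter_integral js g x"
  using assms by (intro antisym iter_integral_mono) auto

lemma iter_integral_add:
  assumes [measurable]: "f \<in> borel_measurable borel_fun" "g \<in> borel_measurable borel_fun"
  shows "iter_integral js (\<lambda>y. f y + g y) x = iter_integral js f x + iter_integral js g x"
  by (induction js arbitrary: x) (auto intro!: nn_integral_add iter_integral_upd_measurable assms)

lemma iter_integral_cmult:
  assumes [measurable]: "f \<in> borel_measurable borel_fun"
  shows "iter_integral js (\<lambda>y. c * f y) x = c * iter_integral js f x"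
  by (induction js arbitrary: x) (auto intro!: nn_integral_cmult iter_integral_upd_measurable assms)

lemma iter_integral_const: "iter_integral js (\<lambda>y. c) x = c"
  using prob_space.emeasure_space_1[OF prob_space_gamma1]
  by (induction js arbitrary: x) auto

lemma iter_integral_agree: "agree (set js) x y \<Longrightarrow> iter_integral js f x = iter_integral js f y"
proof (induction js arbitrary: x y)
  case Nil
  then have "x = y" by (auto simp: agree_def)
  then show ?case by simp
next
  case (Cons i js)
  then show ?case unfolding iter_integral.simps
    by (intro nn_integral_cong Cons.IH) (auto simp: agree_def)
qed

lemma iter_integral_upd:
  assumes "i \<notin> set js"
  shows "iter_integral js f (x(i := t)) = iter_integral js (\<lambda>y. f (y(i := t))) x"
  using assms
  by (induction js arbitrary: x) (auto simp: fun_upd_twist)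

lemma iter_integral_upd2:
  assumes "i \<notin> set js"
  shows "iter_integral js f (x(i := t)) = iter_integral js (\<lambda>y. f (y(i := t))) (x(i := s))"
  using iter_integral_upd[OF assms, of f "x(i := s)" t] by simp

text \<open>Used in the contrapositive, to see that marginals of positive densities are positive. A
  probability measure cannot be carried by an empty set of values \<open>t\<close>.\<close>

lemma iter_integral_eq_0:
  assumes [measurable]: "f \<in> borel_measurable borel_fun" and "iter_integral js f x = 0"
  shows "\<exists>y. f y = 0"
  using assms(2)
proof (induction js arbitrary: x)
  case (Cons i js)
  then have "AE t in \<gamma>1. iter_integral js f (x(i := t)) = 0"
    by (subst (asm) iter_integral.simps, subst (asm) nn_integral_0_iff_AE) (auto intro!: iter_integral_upd_measurable assms)
  then have "\<exists>t. iter_integral js f (x(i := t)) = 0"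
    using prob_space.AE_False[OF prob_space_gamma1] eventually_mono[of _ "ae_filter \<gamma>1" "\<lambda>_. False"]
    by blast
  then show ?case using Cons.IH by auto
qed auto

text \<open>Finiteness of the iterated integral of the bound \<open>w\<close> makes the inner
  integral finite for almost every \<open>t\<close>, which is the hypothesis of the induction; the
  outer limit is then dominated by that inner integral.\<close>

lemma iter_integral_dominated:
  assumes [measurable]: "\<And>n. f n \<in> borel_measurable borel_fun" "h \<in> borel_measurable borel_fun" "w \<in> borel_measurable borel_fun"
    and "\<And>y. agree (set js) x y \<Longrightarrow> (\<lambda>n. f n y) \<longlonglongrightarrow> h y"
    and "\<And>y n. agree (set js) x y \<Longrightarrow> f n y \<le> w y"
    and "iter_integral js w x < \<infinity>"
  shows "(\<lambda>n. iter_integral js (f n) x) \<longlonglongrightarrow> iter_integral js h x"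
  using assms(4-6)
proof (induction js arbitrary: x)
  case (Cons i js)
  show ?case unfolding iter_integral.simps
  proof (rule nn_integral_dominated_convergence)
    show "(\<integral>\<^sup>+t. iter_integral js w (x(i := t)) \<partial>\<gamma>1) < \<infinity>" using Cons.prems(3) by simp
    then have "AE t in \<gamma>1. iter_integral js w (x(i := t)) \<noteq> \<infinity>"
      by (intro nn_integral_PInf_AE) (auto intro!: iter_integral_upd_measurable assms)
    then show "AE t in \<gamma>1. (\<lambda>n. iter_integral js (f n) (x(i := t))) \<longlonglongrightarrow> iter_integral js h (x(i := t))"
    proof eventually_elim
      case (elim t)
      show ?case
        using elim by (intro Cons.IH) (auto intro!: Cons.prems(1,2) agree_Cons simp: less_top[symmetric] simp del: fun_upd_apply)
    qed
    show "AE t in \<gamma>1. iter_integral js (f n) (x(i := t)) \<le> iter_integral js w (x(i := t))" for n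
      by (intro AE_I2 iter_integral_mono Cons.prems agree_Cons)
  qed auto
qed auto

section \<open>Densities of Gaussian growth, their marginals and conditional densities\<close>

lemma exp_phi:
  assumes "a < 1/2"
  shows "exp (a * x\<^sup>2) * \<phi> x = (1 / sqrt (1 - 2 * a)) * normal_density 0 (1 / sqrt (1 - 2 * a)) x"
proof -
  define s where "s = sqrt (1 - 2 * a)"
  have s: "0 < s" "s\<^sup>2 = 1 - 2 * a" using assms by (auto simp: s_def)
  have "(1 / s) * normal_density 0 (1 / s) x = 1 / s * (1 / sqrt (2 * pi * (1 / s)\<^sup>2)) * exp (- x\<^sup>2 * s\<^sup>2 / 2)"
    by (simp add: normal_density_def power_divide)
  also have "sqrt (2 * pi * (1 / s)\<^sup>2) = sqrt (2 * pi) * (1 / s)"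
    using s by (subst real_sqrt_mult) simp
  also have "1 / s * (1 / (sqrt (2 * pi) * (1 / s))) = 1 / sqrt (2 * pi)"
    using s by (simp del: real_sqrt_mult)
  also have "exp (- x\<^sup>2 * s\<^sup>2 / 2) = exp (a * x\<^sup>2) * exp (- x\<^sup>2 / 2)"
    unfolding s by (simp add: exp_add[symmetric] field_simps)
  finally show ?thesis unfolding s_def[symmetric] std_normal_density_def by (simp only: mult_ac)
qed

text \<open>Completing the square in \<open>exp_phi\<close> turns the integrand into a multiple of
  the Gaussian density with variance 1 / (1 - 2a), whose mass is one.\<close>

lemma nn_integral_exp_gamma1:
  assumes "a < 1/2"
  shows "(\<integral>\<^sup>+x. ennreal (exp (a * x\<^sup>2)) \<partial>\<gamma>1) = ennreal (1 / sqrt (1 - 2 * a))"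
proof -
  have "(\<integral>\<^sup>+x. ennreal (exp (a * x\<^sup>2)) \<partial>\<gamma>1) =
      (\<integral>\<^sup>+x. ennreal (1 / sqrt (1 - 2 * a)) * ennreal (normal_density 0 (1 / sqrt (1 - 2 * a)) x) \<partial>lborel)"
  proof (subst nn_integral_gamma1, simp, rule nn_integral_cong)
    fix x :: real
    have "ennreal (\<phi> x) * ennreal (exp (a * x\<^sup>2)) = ennreal (exp (a * x\<^sup>2) * \<phi> x)"
      by (simp add: ennreal_mult'[symmetric] mult.commute)
    also have "\<dots> = ennreal (1 / sqrt (1 - 2 * a)) * ennreal (normal_density 0 (1 / sqrt (1 - 2 * a)) x)"
      unfolding exp_phi[OF assms] using assms by (intro ennreal_mult) auto
    finally show "ennreal (\<phi> x) * ennreal (exp (a * x\<^sup>2)) =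
        ennreal (1 / sqrt (1 - 2 * a)) * ennreal (normal_density 0 (1 / sqrt (1 - 2 * a)) x)" .
  qed
  also have "\<dots> = ennreal (1 / sqrt (1 - 2 * a)) * (\<integral>\<^sup>+x. ennreal (normal_density 0 (1 / sqrt (1 - 2 * a)) x) \<partial>lborel)"
    by (rule nn_integral_cmult) auto
  also have "(\<integral>\<^sup>+x. ennreal (normal_density 0 (1 / sqrt (1 - 2 * a)) x) \<partial>lborel) = 1"
    using assms by (subst nn_integral_eq_integral) auto
  finally show ?thesis by simp
qed

text \<open>This class is closed under taking marginals and conditional densities: the Gaussian bound gives
  finiteness and, by dominated convergence, continuity of the marginals. The constant \<open>c\<close> may depend
  on the coordinates outside \<open>I\<close>, which are parameters.\<close>

definition tame_density :: "'n::finite set \<Rightarrow> (('n \<Rightarrow> real) \<Rightarrow> real) \<Rightarrow> bool" where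
  "tame_density I f \<longleftrightarrow> f \<in> borel_measurable borel_fun \<and> (\<forall>x. 0 < f x) \<and>
     (\<forall>x. \<forall>j\<in>I. continuous_on UNIV (\<lambda>t. f (x(j := t)))) \<and>
     (\<forall>x. \<exists>c\<ge>0. \<forall>y. agree I x y \<longrightarrow> f y \<le> c * exp (\<Sum>j\<in>I. (y j)\<^sup>2 / 6))"

text \<open>Each coordinate contributes the value of \<open>nn_integral_exp_gamma1\<close> at a =
  1/6, where 1 - 2a = 2/3.\<close>

lemma iter_integral_exp_finite:
  assumes "distinct js" "0 \<le> c"
  shows "iter_integral js (\<lambda>y. ennreal (c * exp (\<Sum>j\<in>set js. (y j)\<^sup>2 / 6))) x = ennreal (c * (1 / sqrt (2/3)) ^ length js)"
  using assms
proof (induction js arbitrary: x c)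
  case (Cons i js)
  have "iter_integral (i # js) (\<lambda>y. ennreal (c * exp (\<Sum>j\<in>set (i # js). (y j)\<^sup>2 / 6))) x
      = (\<integral>\<^sup>+t. iter_integral js (\<lambda>y. ennreal ((c * exp (1 / 6 * t\<^sup>2)) * exp (\<Sum>j\<in>set js. (y j)\<^sup>2 / 6))) (x(i := t)) \<partial>\<gamma>1)"
    unfolding iter_integral.simps
  proof (intro nn_integral_cong iter_integral_cong)
    fix t y assume "agree (set js) (x(i := t)) y"
    then have "y i = t" using Cons.prems by (auto simp: agree_def)
    then show "ennreal (c * exp (\<Sum>j\<in>set (i # js). (y j)\<^sup>2 / 6))
        = ennreal ((c * exp (1 / 6 * t\<^sup>2)) * exp (\<Sum>j\<in>set js. (y j)\<^sup>2 / 6))"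
      using Cons.prems by (simp add: exp_add)
  qed
  also have "\<dots> = (\<integral>\<^sup>+t. ennreal ((c * exp (1 / 6 * t\<^sup>2)) * (1 / sqrt (2/3)) ^ length js) \<partial>\<gamma>1)"
    using Cons.prems by (intro nn_integral_cong Cons.IH) auto
  also have "\<dots> = (\<integral>\<^sup>+t. ennreal (c * (1 / sqrt (2/3)) ^ length js) * ennreal (exp (1 / 6 * t\<^sup>2)) \<partial>\<gamma>1)"
    using Cons.prems by (intro nn_integral_cong) (simp add: ennreal_mult'[symmetric] mult_ac)
  also have "\<dots> = ennreal (c * (1 / sqrt (2/3)) ^ length js) * ennreal (1 / sqrt (2 / 3))"
    using nn_integral_exp_gamma1[of "1/6"] by (subst nn_integral_cmult) auto
  also have "\<dots> = ennreal (c * (1 / sqrt (2/3)) ^ length (i # js))"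
    by (subst ennreal_mult''[symmetric]) (auto simp: mult_ac)
  finally show ?case .
qed simp

text \<open>The passage to the reals loses nothing for tame densities, since the iterated integral
  is finite by \<open>iter_integral_marg\<close>.\<close>

definition marg :: "'n::finite list \<Rightarrow> (('n \<Rightarrow> real) \<Rightarrow> real) \<Rightarrow> ('n \<Rightarrow> real) \<Rightarrow> real" where
  "marg js f x = enn2real (iter_integral js (\<lambda>y. ennreal (f y)) x)"

context
  fixes f :: "('n::finite \<Rightarrow> real) \<Rightarrow> real" and i :: 'n and js :: "'n list"
  assumes f: "tame_density (set (i # js)) f" and d: "distinct (i # js)"
begin

lemma marg_f_measurable [measurable]: "f \<in> borel_measurable borel_fun" and f_pos: "0 < f x"
  and f_cont: "j \<in> set (i # js) \<Longrightarrow> continuous_on UNIV (\<lambda>t. f (x(j := t)))"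
  and f_bound: "\<exists>c\<ge>0. \<forall>y. agree (set (i # js)) x y \<longrightarrow> f y \<le> c * exp (\<Sum>j\<in>set (i # js). (y j)\<^sup>2 / 6)"
  using f unfolding tame_density_def by blast+

lemma marg_measurable [measurable]: "marg js f \<in> borel_measurable borel_fun"
  unfolding marg_def[abs_def] by measurable

lemma f_bound':
  "\<exists>c\<ge>0. \<forall>t y. agree (set js) (x(i := t)) y \<longrightarrow> f y \<le> c * exp (t\<^sup>2 / 6) * exp (\<Sum>j\<in>set js. (y j)\<^sup>2 / 6)"
proof -
  obtain c where c: "c \<ge> 0" "\<And>y. agree (set (i # js)) x y \<Longrightarrow> f y \<le> c * exp (\<Sum>j\<in>set (i # js). (y j)\<^sup>2 / 6)"
    using f_bound by blast
  have "f y \<le> c * exp (t\<^sup>2 / 6) * exp (\<Sum>j\<in>set js. (y j)\<^sup>2 / 6)" if "agree (set js) (x(i := t)) y" for t y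
  proof -
    have "y i = t" using that d by (auto simp: agree_def)
    then show ?thesis using c(2)[OF agree_Cons[OF that]] d by (simp add: exp_add)
  qed
  then show ?thesis using c by blast
qed

lemma marg_bound: "\<exists>c\<ge>0. \<forall>t. iter_integral js (\<lambda>y. ennreal (f y)) (x(i := t)) \<le> ennreal (c * exp (t\<^sup>2 / 6))"
proof -
  obtain c where c: "c \<ge> 0" "\<And>t y. agree (set js) (x(i := t)) y \<Longrightarrow> f y \<le> c * exp (t\<^sup>2 / 6) * exp (\<Sum>j\<in>set js. (y j)\<^sup>2 / 6)"
    using f_bound' by blast
  let ?c = "c * (1 / sqrt (2/3)) ^ length js"
  have "iter_integral js (\<lambda>y. ennreal (f y)) (x(i := t)) \<le> ennreal (?c * exp (t\<^sup>2 / 6))" for t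
  proof -
    have "iter_integral js (\<lambda>y. ennreal (f y)) (x(i := t)) \<le>
        iter_integral js (\<lambda>y. ennreal ((c * exp (t\<^sup>2 / 6)) * exp (\<Sum>j\<in>set js. (y j)\<^sup>2 / 6))) (x(i := t))"
      by (intro iter_integral_mono ennreal_leI c)
    also have "\<dots> = ennreal ((c * exp (t\<^sup>2 / 6)) * (1 / sqrt (2/3)) ^ length js)"
      using d c by (intro iter_integral_exp_finite) auto
    finally show ?thesis by (simp add: mult_ac)
  qed
  moreover have "0 \<le> ?c" using c by simp
  ultimately show ?thesis by blast
qed

lemma iter_integral_marg: "iter_integral js (\<lambda>y. ennreal (f y)) x = ennreal (marg js f x)"
proof -
  obtain c where "\<And>t. iter_integral js (\<lambda>y. ennreal (f y)) (x(i := t)) \<le> ennreal (c * exp (t\<^sup>2 / 6))"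
    using marg_bound by blast
  from this[of "x i"] have "iter_integral js (\<lambda>y. ennreal (f y)) x < \<top>"
    by (simp add: order_le_less_trans[OF _ ennreal_less_top])
  then show ?thesis by (simp add: marg_def)
qed

lemma marg_pos: "0 < marg js f x"
proof (rule ccontr)
  assume "\<not> 0 < marg js f x"
  then have "iter_integral js (\<lambda>y. ennreal (f y)) x = 0" by (simp add: iter_integral_marg ennreal_eq_0_iff)
  then have "\<exists>y. ennreal (f y) = 0" by (intro iter_integral_eq_0) auto
  then obtain y where "f y \<le> 0" by (auto simp: ennreal_eq_0_iff)
  with f_pos[of y] show False by simp
qed

lemma marg_agree: "agree (set js) x y \<Longrightarrow> marg js f x = marg js f y"
  unfolding marg_def by (simp add: iter_integral_agree)

lemma marg_bound': "\<exists>c\<ge>0. \<forall>t. marg js f (x(i := t)) \<le> c * exp (t\<^sup>2 / 6)"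
proof -
  obtain c where "c \<ge> 0" "\<And>t. iter_integral js (\<lambda>y. ennreal (f y)) (x(i := t)) \<le> ennreal (c * exp (t\<^sup>2 / 6))"
    using marg_bound by blast
  then show ?thesis by (auto simp: iter_integral_marg ennreal_le_iff intro!: exI[of _ c])
qed

lemma marg_cont: "continuous_on UNIV (\<lambda>t. marg js f (x(i := t)))"
  unfolding continuous_on_sequentially comp_def
proof (intro allI ballI impI)
  fix u :: "nat \<Rightarrow> real" and a assume "(\<forall>n. u n \<in> UNIV) \<and> u \<longlonglongrightarrow> a"
  then have u: "u \<longlonglongrightarrow> a" by simp
  \<comment> \<open>A convergent sequence is bounded, so replacing \<open>u n\<close> by
    \<open>B\<close> in the growth bound gives one dominating function for all
    \<open>n\<close>.\<close>
  obtain B where B: "\<And>n. \<bar>u n\<bar> \<le> B" using convergent_imp_Bseq[OF convergentI[OF u]] by (auto simp: Bseq_def)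
  obtain c where c: "c \<ge> 0" "\<And>t y. agree (set js) (x(i := t)) y \<Longrightarrow> f y \<le> c * exp (t\<^sup>2 / 6) * exp (\<Sum>j\<in>set js. (y j)\<^sup>2 / 6)"
    using f_bound' by blast
  have i: "i \<notin> set js" using d by simp
  let ?w = "\<lambda>y. ennreal ((c * exp (B\<^sup>2 / 6)) * exp (\<Sum>j\<in>set js. (y j)\<^sup>2 / 6))"
  have "(\<lambda>n. iter_integral js (\<lambda>y. ennreal (f (y(i := u n)))) x) \<longlonglongrightarrow> iter_integral js (\<lambda>y. ennreal (f (y(i := a)))) x"
  proof (rule iter_integral_dominated[where w="?w"])
    fix y assume y: "agree (set js) x y"
    have "isCont (\<lambda>t. f (y(i := t))) a"
      using f_cont[of i y] by (simp add: continuous_on_eq_continuous_at)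
    then show "(\<lambda>n. ennreal (f (y(i := u n)))) \<longlonglongrightarrow> ennreal (f (y(i := a)))"
      using u by (intro tendsto_ennrealI) (rule isCont_tendsto_compose)
    fix n
    have "f (y(i := u n)) \<le> c * exp ((u n)\<^sup>2 / 6) * exp (\<Sum>j\<in>set js. ((y(i := u n)) j)\<^sup>2 / 6)"
      by (rule c(2)) (use y in \<open>auto simp: agree_def\<close>)
    also have "(\<Sum>j\<in>set js. ((y(i := u n)) j)\<^sup>2 / 6) = (\<Sum>j\<in>set js. (y j)\<^sup>2 / 6)"
      using i by (intro sum.cong) auto
    also have "c * exp ((u n)\<^sup>2 / 6) * exp (\<Sum>j\<in>set js. (y j)\<^sup>2 / 6) \<le> (c * exp (B\<^sup>2 / 6)) * exp (\<Sum>j\<in>set js. (y j)\<^sup>2 / 6)"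
      using c B[of n] by (intro mult_right_mono mult_left_mono) (auto simp: abs_le_square_iff[symmetric])
    finally show "ennreal (f (y(i := u n))) \<le> ?w y" by (intro ennreal_leI)
  next
    show "iter_integral js ?w x < \<infinity>"
      using c d by (subst iter_integral_exp_finite) auto
  qed measurable
  then have "(\<lambda>n. ennreal (marg js f (x(i := u n)))) \<longlonglongrightarrow> ennreal (marg js f (x(i := a)))"
    unfolding iter_integral_upd[OF i, of "\<lambda>y. ennreal (f y)", symmetric] iter_integral_marg .
  then show "(\<lambda>n. marg js f (x(i := u n))) \<longlonglongrightarrow> marg js f (x(i := a))"
    using marg_pos by (intro tendsto_ennrealD) (auto simp: less_imp_le)
qed

lemma gauss_density_marg:
  assumes "iter_integral (i # js) (\<lambda>y. ennreal (f y)) x = 1"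
  shows "gauss_density (\<lambda>t. marg js f (x(i := t)))"
proof
  show "(\<integral>\<^sup>+t. ennreal (marg js f (x(i := t))) \<partial>\<gamma>1) = 1"
    using assms by (simp add: iter_integral_marg)
  obtain c where c: "c \<ge> 0" "\<And>t. marg js f (x(i := t)) \<le> c * exp (t\<^sup>2 / 6)" using marg_bound' by blast
  have "(\<integral>\<^sup>+t. ennreal (t\<^sup>2 * marg js f (x(i := t))) \<partial>\<gamma>1) \<le> (\<integral>\<^sup>+t. ennreal (12 * c) * ennreal (exp (1/4 * t\<^sup>2)) \<partial>\<gamma>1)"
  proof (intro nn_integral_mono)
    fix t :: real
    \<comment> \<open>The polynomial factor is absorbed at the price of 1/12 in the exponent; 1/12 +
      1/6 = 1/4 is still below the critical value 1/2.\<close>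
    have "t\<^sup>2 / 12 \<le> exp (t\<^sup>2 / 12)" using exp_ge_add_one_self[of "t\<^sup>2/12"] by linarith
    then have "t\<^sup>2 \<le> 12 * exp (t\<^sup>2 / 12)" by simp
    then have "t\<^sup>2 * marg js f (x(i := t)) \<le> (12 * exp (t\<^sup>2 / 12)) * (c * exp (t\<^sup>2 / 6))"
      using c marg_pos[of "x(i := t)"] by (intro mult_mono) auto
    also have "\<dots> = 12 * c * (exp (t\<^sup>2 / 12) * exp (t\<^sup>2 / 6))" by simp
    also have "exp (t\<^sup>2 / 12) * exp (t\<^sup>2 / 6) = exp (1/4 * t\<^sup>2)"
      by (simp add: exp_add[symmetric])
    finally show "ennreal (t\<^sup>2 * marg js f (x(i := t))) \<le> ennreal (12 * c) * ennreal (exp (1/4 * t\<^sup>2))"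
      using c by (subst ennreal_mult'[symmetric]) (auto intro!: ennreal_leI simp del: fun_upd_apply)
  qed
  also have "\<dots> < \<infinity>"
    using nn_integral_exp_gamma1[of "1/4"] by (subst nn_integral_cmult) (auto simp: ennreal_mult_less_top)
  finally show "(\<integral>\<^sup>+t. ennreal (t\<^sup>2 * marg js f (x(i := t))) \<partial>\<gamma>1) < \<infinity>" .
qed (auto simp: marg_pos marg_cont)

text \<open>On a fibre over the remaining coordinates the marginal is a positive constant, and
  division by it changes only the constant in the growth bound. This is why that constant is allowed
  to depend on the parameters.\<close>

lemma tame_density_cond: "tame_density (set js) (\<lambda>y. f y / marg js f y)"
  unfolding tame_density_def
proof (intro conjI allI ballI)
  fix x j assume j: "j \<in> set js"
  have "marg js f (x(j := t)) = marg js f x" for t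
    by (rule marg_agree) (use j in \<open>auto simp: agree_def\<close>)
  then show "continuous_on UNIV (\<lambda>t. f (x(j := t)) / marg js f (x(j := t)))"
    using j marg_pos[of x] by (auto intro!: continuous_intros f_cont)
next
  fix x
  obtain c where c: "c \<ge> 0" "\<And>t y. agree (set js) (x(i := t)) y \<Longrightarrow> f y \<le> c * exp (t\<^sup>2 / 6) * exp (\<Sum>j\<in>set js. (y j)\<^sup>2 / 6)"
    using f_bound' by blast
  have "f y / marg js f y \<le> (c * exp ((x i)\<^sup>2 / 6) / marg js f x) * exp (\<Sum>j\<in>set js. (y j)\<^sup>2 / 6)"
    if "agree (set js) x y" for y
    unfolding marg_agree[OF that, symmetric]
    using c(2)[of "x i" y] that marg_pos[of x] by (simp add: field_simps)
  then show "\<exists>c\<ge>0. \<forall>y. agree (set js) x y \<longrightarrow> f y / marg js f y \<le> c * exp (\<Sum>j\<in>set js. (y j)\<^sup>2 / 6)"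
    using c(1) marg_pos[of x] by (intro exI[of _ "c * exp ((x i)\<^sup>2 / 6) / marg js f x"]) auto
qed (use f_pos marg_pos in \<open>auto intro!: divide_pos_pos\<close>)

lemma iter_integral_mult_cond:
  assumes [measurable]: "h \<in> borel_measurable borel_fun"
  shows "iter_integral js (\<lambda>y. h y * ennreal (f y)) x = ennreal (marg js f x) * iter_integral js (\<lambda>y. h y * ennreal (f y / marg js f y)) x"
proof -
  have "iter_integral js (\<lambda>y. h y * ennreal (f y)) x = iter_integral js (\<lambda>y. ennreal (marg js f x) * (h y * ennreal (f y / marg js f y))) x"
  proof (rule iter_integral_cong)
    fix y assume "agree (set js) x y"
    then have *: "marg js f y = marg js f x" by (simp add: marg_agree)
    have "ennreal (f y) = ennreal (marg js f x) * ennreal (f y / marg js f y)"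
      using marg_pos[of x] f_pos[of y] unfolding * by (subst ennreal_mult'[symmetric]) auto
    then show "h y * ennreal (f y) = ennreal (marg js f x) * (h y * ennreal (f y / marg js f y))"
      by (simp add: mult_ac)
  qed
  also have "\<dots> = ennreal (marg js f x) * iter_integral js (\<lambda>y. h y * ennreal (f y / marg js f y)) x"
    by (rule iter_integral_cmult) measurable
  finally show ?thesis .
qed

lemma iter_integral_cond: "iter_integral js (\<lambda>y. ennreal (f y / marg js f y)) x = 1"
proof -
  have "ennreal (marg js f x) * iter_integral js (\<lambda>y. ennreal (f y / marg js f y)) x = ennreal (marg js f x) * 1"
    using iter_integral_mult_cond[of "\<lambda>_. 1" x] by (simp add: iter_integral_marg)
  then show ?thesis using marg_pos[of x]
    by (subst (asm) ennreal_mult_cancel_left) (auto simp: ennreal_eq_0_iff not_le)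
qed

text \<open>The chain rule for the entropy. The case distinction on the sign of \<open>ln m\<close> moves all negative
  terms to the other side, since subtraction is not available for extended nonnegative integrals.\<close>

lemma ent_chain:
  "iter_integral js (\<lambda>y. ennreal (ent (f y))) x =
    ennreal (ent (marg js f x)) + ennreal (marg js f x) * iter_integral js (\<lambda>y. ennreal (ent (f y / marg js f y))) x"
proof -
  define m where "m = marg js f x"
  have m: "0 < m" unfolding m_def by (rule marg_pos)
  define q where "q y = f y / marg js f y" for y
  have [measurable]: "q \<in> borel_measurable borel_fun" unfolding q_def[abs_def] by measurable
  have q: "0 < q y" for y unfolding q_def using f_pos marg_pos by simp
  have e: "0 \<le> ent (q y)" "0 \<le> ent (f y)" "0 \<le> ent m" for y using q f_pos m by (auto intro!: ent_nonneg)
  define E where "E = iter_integral js (\<lambda>y. ennreal (ent (q y))) x"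
  \<comment> \<open>The entropy of the product f = m q. Averaging \<open>q\<close>, whose mean is
    one, turns q m ln m into m ln m, and m ln m - m + 1 is \<open>ent m\<close>.\<close>
  have id: "ent (f y) = m * ent (q y) + q y * (m * ln m) - m + 1" if "agree (set js) x y" for y
  proof -
    have "marg js f y = m" using marg_agree[OF that] by (simp add: m_def)
    then have "f y = m * q y" using m by (simp add: q_def)
    then show ?thesis using m q[of y] by (simp add: ent_def ln_mult algebra_simps)
  qed
  have n1: "iter_integral js (\<lambda>y. ennreal (q y)) x = 1" unfolding q_def by (rule iter_integral_cond)
  have nm: "iter_integral js (\<lambda>y. ennreal (m * ent (q y))) x = ennreal m * E"
    unfolding E_def using m by (subst iter_integral_cmult[symmetric]) (auto simp: ennreal_mult')
  have nq: "iter_integral js (\<lambda>y. ennreal (q y * c)) x = ennreal c" if "0 \<le> c" for c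
    using that by (subst mult.commute, subst ennreal_mult', simp, subst iter_integral_cmult) (auto simp: n1)
  have "iter_integral js (\<lambda>y. ennreal (ent (f y))) x = ennreal (ent m) + ennreal m * E"
  proof (cases "0 \<le> ln m")
    case True
    have "iter_integral js (\<lambda>y. ennreal (ent (f y)) + ennreal m) x
        = iter_integral js (\<lambda>y. ennreal (m * ent (q y)) + (ennreal (q y * (m * ln m)) + ennreal 1)) x"
    proof (rule iter_integral_cong)
      fix y assume y: "agree (set js) x y"
      show "ennreal (ent (f y)) + ennreal m = ennreal (m * ent (q y)) + (ennreal (q y * (m * ln m)) + ennreal 1)"
        using e(1,2)[of y] e(3) m q[of y] True
        by (simp add: ennreal_plus[symmetric] id[OF y] del: ennreal_plus ennreal_1)
    qed
    then have "iter_integral js (\<lambda>y. ennreal (ent (f y))) x + ennreal m = ennreal m * E + (ennreal (m * ln m) + ennreal 1)"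
      using m True by (simp add: iter_integral_add iter_integral_const nm nq del: ennreal_1)
    also have "\<dots> = ennreal m * E + (ennreal (ent m) + ennreal m)"
      using e m True by (subst (1 2) ennreal_plus[symmetric]) (auto simp: ent_def simp del: ennreal_plus)
    finally have "iter_integral js (\<lambda>y. ennreal (ent (f y))) x + ennreal m = (ennreal (ent m) + ennreal m * E) + ennreal m"
      by (simp add: add_ac)
    then show ?thesis by simp
  next
    case False
    have "iter_integral js (\<lambda>y. ennreal (ent (f y)) + (ennreal (q y * (m * (- ln m))) + ennreal m)) x
        = iter_integral js (\<lambda>y. ennreal (m * ent (q y)) + ennreal 1) x"
    proof (rule iter_integral_cong)
      fix y assume y: "agree (set js) x y"
      define p where "p = q y * (m * (- ln m))"
      have p: "0 \<le> p" unfolding p_def using q[of y] m False by (intro mult_nonneg_nonneg) auto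
      have "ent (f y) + (p + m) = m * ent (q y) + 1" unfolding id[OF y] by (simp add: p_def)
      moreover have "ennreal (ent (f y)) + (ennreal p + ennreal m) = ennreal (ent (f y) + (p + m))"
        using e(1,2)[of y] m p by simp
      moreover have "ennreal (m * ent (q y)) + ennreal 1 = ennreal (m * ent (q y) + 1)"
        using e(1)[of y] m by (simp del: ennreal_1)
      ultimately show "ennreal (ent (f y)) + (ennreal (q y * (m * (- ln m))) + ennreal m) = ennreal (m * ent (q y)) + ennreal 1"
        by (simp add: p_def)
    qed
    moreover have nl: "0 \<le> m * (- ln m)" using m False by (intro mult_nonneg_nonneg) auto
    ultimately have "iter_integral js (\<lambda>y. ennreal (ent (f y))) x + (ennreal (m * (- ln m)) + ennreal m) = ennreal m * E + ennreal 1"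
      using nq[OF nl] by (simp add: iter_integral_add iter_integral_const nm del: ennreal_1)
    also have "ennreal 1 = ennreal (ent m + (m * (- ln m) + m))" by (simp add: ent_def)
    also have "\<dots> = ennreal (ent m) + (ennreal (m * (- ln m)) + ennreal m)"
      using e(3) m nl by (metis ennreal_plus add_nonneg_nonneg less_imp_le)
    finally have "iter_integral js (\<lambda>y. ennreal (ent (f y))) x + (ennreal (m * (- ln m)) + ennreal m)
        = (ennreal (ent m) + ennreal m * E) + (ennreal (m * (- ln m)) + ennreal m)"
      by (simp add: add_ac)
    then show ?thesis
      unfolding add.commute[of _ "ennreal (m * (- ln m)) + ennreal m"] ennreal_add_left_cancel
      by simp
  qed
  then show ?thesis by (simp add: E_def q_def m_def)
qed

end

text \<open>The Knothe-Rosenblatt map: the first coordinate is moved by the monotone map of its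
  marginal, the others by the map for the conditional density over the new value. Quantifying over
  all \<open>x\<close> provides one jointly measurable map for all parameter values at once, which
  the induction needs to insert the moved coordinate as a parameter.\<close>

lemma transport_exists:
  fixes f :: "('n::finite \<Rightarrow> real) \<Rightarrow> real"
  assumes "distinct js" "tame_density (set js) f" "\<And>x. iter_integral js (\<lambda>y. ennreal (f y)) x = 1"
  shows "\<exists>T \<in> measurable borel_fun borel_fun. (\<forall>x j. j \<notin> set js \<longrightarrow> T x j = x j) \<and>
     (\<forall>h\<in>borel_measurable borel_fun. \<forall>x. iter_integral js (\<lambda>y. h (T y)) x = iter_integral js (\<lambda>y. h y * ennreal (f y)) x) \<and>
     (\<forall>x. iter_integral js (\<lambda>y. ennreal (\<Sum>j\<in>set js. (T y j - y j)\<^sup>2)) x \<le> iter_integral js (\<lambda>y. ennreal (2 * ent (f y))) x)"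
  using assms
proof (induction js arbitrary: f)
  case Nil
  have "f x = 1" for x using Nil(3)[of x] by simp
  then have f: "f = (\<lambda>x. 1)" by (rule ext)
  show ?case unfolding f
  proof (rule bexI[of _ "\<lambda>x. x"], intro conjI allI ballI impI)
    show "(\<lambda>x. x) \<in> measurable borel_fun borel_fun" by (rule measurable_ident_sets) (rule refl)
  next
    fix x
    show "iter_integral [] (\<lambda>y. ennreal (\<Sum>j\<in>set []. (y j - y j)\<^sup>2)) x \<le> iter_integral [] (\<lambda>y. ennreal (2 * ent 1)) x"
      by (simp add: ent_def)
  next
    fix h :: "('n \<Rightarrow> real) \<Rightarrow> ennreal" and x
    show "iter_integral [] (\<lambda>y. h y) x = iter_integral [] (\<lambda>y. h y * ennreal 1) x"
      by simp
  qed (rule refl)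
next
  case (Cons i js)
  note f = Cons.prems(2) and d = Cons.prems(1)
  have [measurable]: "f \<in> borel_measurable borel_fun" using f unfolding tame_density_def by blast
  note [measurable] = marg_measurable[OF f d]
  have i: "i \<notin> set js" using d by simp
  define m where "m = marg js f"
  define q where "q y = f y / m y" for y
  have [measurable]: "m \<in> borel_measurable borel_fun" unfolding m_def by measurable
  have [measurable]: "q \<in> borel_measurable borel_fun" unfolding q_def by measurable
  have mpos: "0 < m y" for y unfolding m_def by (rule marg_pos[OF f d])
  have qpos: "0 < q y" for y unfolding q_def using mpos f_pos[OF f d] by simp
  have "tame_density (set js) q" "\<And>x. iter_integral js (\<lambda>y. ennreal (q y)) x = 1"
    using tame_density_cond[OF f d] iter_integral_cond[OF f d] by (auto simp: q_def[abs_def] m_def)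
  from Cons.IH[OF _ this] d obtain S where [measurable]: "S \<in> measurable borel_fun borel_fun"
    and S1: "\<And>x j. j \<notin> set js \<Longrightarrow> S x j = x j"
    and S2: "\<And>h x. h \<in> borel_measurable borel_fun \<Longrightarrow> iter_integral js (\<lambda>y. h (S y)) x = iter_integral js (\<lambda>y. h y * ennreal (q y)) x"
    and S3: "\<And>x. iter_integral js (\<lambda>y. ennreal (\<Sum>j\<in>set js. (S y j - y j)\<^sup>2)) x \<le> iter_integral js (\<lambda>y. ennreal (2 * ent (q y))) x"
    by auto
  have gd: "gauss_density (\<lambda>t. m (x(i := t)))" for x
    unfolding m_def by (rule gauss_density_marg[OF f d Cons.prems(3)])
  \<comment> \<open>The new value of coordinate \<open>i\<close>. The marginal and hence the
    monotone map depend on the coordinates outside the list.\<close>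
  define \<tau> where "\<tau> x = gauss_density.T (\<lambda>t. m (x(i := t))) (x i)" for x
  have \<tau>_eq: "\<tau> y = gauss_density.T (\<lambda>t. m (x(i := t))) s" if "agree (set js) (x(i := s)) y" for x s y
  proof -
    have "y i = s" using that i by (auto simp: agree_def)
    moreover have "m (y(i := t)) = m (x(i := t))" for t
      unfolding m_def by (rule marg_agree[OF f d, symmetric]) (use that in \<open>auto simp: agree_def\<close>)
    ultimately show ?thesis by (simp add: \<tau>_def)
  qed
  have \<tau>_meas [measurable]: "\<tau> \<in> borel_measurable borel_fun"
  proof (rule borel_measurableI_le)
    fix t
    \<comment> \<open>Applying the increasing distribution function of the marginal removes the
      quantile from the inequality; both sides of the result are measurable in \<open>x\<close>, the
      right one as a parameter integral.\<close>
    have "\<tau> x \<le> t \<longleftrightarrow> std.H (x i) \<le> enn2real (\<integral>\<^sup>+u. ennreal (m (x(i := u))) * indicator {..t} u \<partial>\<gamma>1)" for x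
    proof -
      interpret gauss_density "\<lambda>t. m (x(i := t))" by (rule gd)
      have "\<tau> x \<le> t \<longleftrightarrow> H (T (x i)) \<le> H t" by (simp add: cdf_le_iff \<tau>_def)
      also have "H (T (x i)) = std.H (x i)" by (rule H_T)
      also have "H t = enn2real (\<integral>\<^sup>+u. ennreal (m (x(i := u))) * indicator {..t} u \<partial>\<gamma>1)"
        unfolding cdf_def mu_eq measure_def by (subst emeasure_density) auto
      finally show ?thesis .
    qed
    moreover have "{x \<in> space borel_fun. std.H (x i) \<le> enn2real (\<integral>\<^sup>+u. ennreal (m (x(i := u))) * indicator {..t} u \<partial>\<gamma>1)} \<in> sets borel_fun"
    proof (rule borel_measurable_le)
      have "std.H \<in> borel_measurable borel"
        by (intro borel_measurable_continuous_onI continuous_at_imp_continuous_on) (auto simp: std.continuous_cdf)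
      then show "(\<lambda>x. std.H (x i)) \<in> borel_measurable borel_fun"
        by (rule measurable_compose[rotated]) measurable
      have "(\<lambda>x. \<integral>\<^sup>+u. ennreal (m (x(i := u))) * indicator {..t} u \<partial>\<gamma>1) \<in> borel_measurable borel_fun"
        by (rule nn_integral_gamma1_measurable) measurable
      then show "(\<lambda>x. enn2real (\<integral>\<^sup>+u. ennreal (m (x(i := u))) * indicator {..t} u \<partial>\<gamma>1)) \<in> borel_measurable borel_fun"
        by (rule borel_measurable_enn2real)
    qed
    ultimately show "{x \<in> space borel_fun. \<tau> x \<le> t} \<in> sets borel_fun" by simp
  qed
  define R where "R x = S (x(i := \<tau> x))" for x
  have [measurable]: "R \<in> measurable borel_fun borel_fun" unfolding R_def[abs_def] by measurable
  \<comment> \<open>On the fibre where coordinate \<open>i\<close> equals \<open>s\<close> the value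
    of \<tau> is constant, so integrating over \<open>R\<close> is integrating over \<open>S\<close>
    with that coordinate replaced by its image.\<close>
  have push: "iter_integral js (\<lambda>y. h (R y)) (x(i := s)) = iter_integral js (\<lambda>y. h (S y)) (x(i := gauss_density.T (\<lambda>t. m (x(i := t))) s))" for h x s
  proof -
    have "iter_integral js (\<lambda>y. h (R y)) (x(i := s)) = iter_integral js (\<lambda>y. h (S (y(i := gauss_density.T (\<lambda>t. m (x(i := t))) s)))) (x(i := s))"
      by (rule iter_integral_cong) (simp add: R_def \<tau>_eq)
    then show ?thesis using iter_integral_upd2[OF i, of "\<lambda>y. h (S y)"] by simp
  qed
  show ?case
  proof (intro bexI[of _ R] conjI allI ballI impI)
    fix x j assume "j \<notin> set (i # js)"
    then show "R x j = x j" by (simp add: R_def S1)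
  next
    fix h :: "('n \<Rightarrow> real) \<Rightarrow> ennreal" and x assume [measurable]: "h \<in> borel_measurable borel_fun"
    interpret gauss_density "\<lambda>t. m (x(i := t))" by (rule gd)
    have "iter_integral (i # js) (\<lambda>y. h (R y)) x = (\<integral>\<^sup>+s. iter_integral js (\<lambda>y. h y * ennreal (q y)) (x(i := T s)) \<partial>\<gamma>1)"
      by (simp add: push S2)
    also have "\<dots> = (\<integral>\<^sup>+t. iter_integral js (\<lambda>y. h y * ennreal (q y)) (x(i := t)) * ennreal (m (x(i := t))) \<partial>\<gamma>1)"
      by (rule nn_integral_T[of "\<lambda>t. iter_integral js (\<lambda>y. h y * ennreal (q y)) (x(i := t))"]) measurable
    also have "\<dots> = (\<integral>\<^sup>+t. iter_integral js (\<lambda>y. h y * ennreal (f y)) (x(i := t)) \<partial>\<gamma>1)"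
      by (simp add: iter_integral_mult_cond[OF f d] m_def q_def mult.commute)
    finally show "iter_integral (i # js) (\<lambda>y. h (R y)) x = iter_integral (i # js) (\<lambda>y. h y * ennreal (f y)) x" by simp
  next
    fix x
    interpret gauss_density "\<lambda>t. m (x(i := t))" by (rule gd)
    define k where "k y = iter_integral js (\<lambda>y. ennreal (2 * ent (q y))) y" for y
    have [measurable]: "k \<in> borel_measurable borel_fun" unfolding k_def[abs_def] by measurable
    have "iter_integral (i # js) (\<lambda>y. ennreal (\<Sum>j\<in>set (i # js). (R y j - y j)\<^sup>2)) x
        \<le> (\<integral>\<^sup>+s. ennreal ((T s - s)\<^sup>2) + k (x(i := T s)) \<partial>\<gamma>1)"
      unfolding iter_integral.simps
    proof (rule nn_integral_mono)
      fix s
      \<comment> \<open>The cost splits: \<open>S\<close> leaves coordinate \<open>i\<close> fixed,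
        which therefore contributes (T s - s)^2, and the others contribute the cost of
        \<open>S\<close> over the moved value T s.\<close>
      have "iter_integral js (\<lambda>y. ennreal (\<Sum>j\<in>set (i # js). (R y j - y j)\<^sup>2)) (x(i := s))
        = iter_integral js (\<lambda>y. ennreal ((T s - s)\<^sup>2) + ennreal (\<Sum>j\<in>set js. (S (y(i := T s)) j - (y(i := T s)) j)\<^sup>2)) (x(i := s))"
      proof (rule iter_integral_cong)
        fix y assume y: "agree (set js) (x(i := s)) y"
        have yi: "y i = s" using y i by (auto simp: agree_def)
        have "(\<Sum>j\<in>set js. (R y j - y j)\<^sup>2) = (\<Sum>j\<in>set js. (S (y(i := T s)) j - (y(i := T s)) j)\<^sup>2)"
          using i by (intro sum.cong) (auto simp: R_def \<tau>_eq[OF y])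
        moreover have "R y i = T s" using i by (simp add: R_def S1 \<tau>_eq[OF y])
        ultimately show "ennreal (\<Sum>j\<in>set (i # js). (R y j - y j)\<^sup>2) =
            ennreal ((T s - s)\<^sup>2) + ennreal (\<Sum>j\<in>set js. (S (y(i := T s)) j - (y(i := T s)) j)\<^sup>2)"
          using i yi by (subst ennreal_plus[symmetric]) (auto intro!: sum_nonneg)
      qed
      also have "\<dots> = ennreal ((T s - s)\<^sup>2) + iter_integral js (\<lambda>y. ennreal (\<Sum>j\<in>set js. (S (y(i := T s)) j - (y(i := T s)) j)\<^sup>2)) (x(i := s))"
        by (subst iter_integral_add) (auto simp: iter_integral_const)
      also have "iter_integral js (\<lambda>y. ennreal (\<Sum>j\<in>set js. (S (y(i := T s)) j - (y(i := T s)) j)\<^sup>2)) (x(i := s))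
          = iter_integral js (\<lambda>y. ennreal (\<Sum>j\<in>set js. (S y j - y j)\<^sup>2)) (x(i := T s))"
        using iter_integral_upd2[OF i, of "\<lambda>y. ennreal (\<Sum>j\<in>set js. (S y j - y j)\<^sup>2)" x "T s" s] by simp
      also have "\<dots> \<le> k (x(i := T s))" unfolding k_def by (rule S3)
      finally show "iter_integral js (\<lambda>y. ennreal (\<Sum>j\<in>set (i # js). (R y j - y j)\<^sup>2)) (x(i := s))
          \<le> ennreal ((T s - s)\<^sup>2) + k (x(i := T s))" by (simp add: add_left_mono del: fun_upd_apply)
    qed
    also have "\<dots> = (\<integral>\<^sup>+s. ennreal ((T s - s)\<^sup>2) \<partial>\<gamma>1) + (\<integral>\<^sup>+s. k (x(i := T s)) \<partial>\<gamma>1)"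
      by (rule nn_integral_add) auto
    \<comment> \<open>The image of the Gaussian measure under \<open>T\<close> has density
      \<open>m\<close>, so the conditional entropies acquire exactly the weight they have in the
      chain rule \<open>ent_chain\<close>.\<close>
    also have "(\<integral>\<^sup>+s. k (x(i := T s)) \<partial>\<gamma>1) = (\<integral>\<^sup>+t. k (x(i := t)) * ennreal (m (x(i := t))) \<partial>\<gamma>1)"
      by (rule nn_integral_T[of "\<lambda>t. k (x(i := t))"]) measurable
    also have "(\<integral>\<^sup>+s. ennreal ((T s - s)\<^sup>2) \<partial>\<gamma>1) + (\<integral>\<^sup>+t. k (x(i := t)) * ennreal (m (x(i := t))) \<partial>\<gamma>1)
        \<le> (\<integral>\<^sup>+t. ennreal (2 * ent (m (x(i := t)))) \<partial>\<gamma>1) + (\<integral>\<^sup>+t. k (x(i := t)) * ennreal (m (x(i := t))) \<partial>\<gamma>1)"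
      by (intro add_right_mono cost_T)
    also have "\<dots> = (\<integral>\<^sup>+t. ennreal (2 * ent (m (x(i := t)))) + k (x(i := t)) * ennreal (m (x(i := t))) \<partial>\<gamma>1)"
      by (rule nn_integral_add[symmetric]) auto
    also have "\<dots> = iter_integral (i # js) (\<lambda>y. ennreal (2 * ent (f y))) x"
      unfolding iter_integral.simps
    proof (rule nn_integral_cong)
      fix t
      have two: "iter_integral js (\<lambda>y. 2 * ennreal (ent (h y))) z = 2 * iter_integral js (\<lambda>y. ennreal (ent (h y))) z"
        if [measurable]: "h \<in> borel_measurable borel_fun" for h z
        by (rule iter_integral_cmult) measurable
      show "ennreal (2 * ent (m (x(i := t)))) + k (x(i := t)) * ennreal (m (x(i := t)))
          = iter_integral js (\<lambda>y. ennreal (2 * ent (f y))) (x(i := t))"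
        unfolding k_def by (simp add: two ent_chain[OF f d] m_def[symmetric] q_def[symmetric] ennreal_mult' algebra_simps)
    qed
    finally show "iter_integral (i # js) (\<lambda>y. ennreal (\<Sum>j\<in>set (i # js). (R y j - y j)\<^sup>2)) x \<le> iter_integral (i # js) (\<lambda>y. ennreal (2 * ent (f y))) x" .
  qed measurable
qed

lemma iter_integral_PiM:
  fixes h :: "('n::finite \<Rightarrow> real) \<Rightarrow> ennreal"
  assumes [measurable]: "h \<in> borel_measurable borel_fun" and "distinct js"
  shows "iter_integral js h x = (\<integral>\<^sup>+y. h (\<lambda>j. if j \<in> set js then y j else x j) \<partial>PiM (set js) (\<lambda>_. \<gamma>1))"
  using assms(2)
proof (induction js arbitrary: x)
  case Nil
  then show ?case by (simp add: PiM_empty nn_integral_count_space_finite)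
next
  case (Cons i js)
  interpret product_sigma_finite "\<lambda>_::'n. \<gamma>1"
    by (simp add: product_sigma_finite_def sigma_finite_gamma1)
  have m: "(\<lambda>y. h (\<lambda>j. if j \<in> insert i (set js) then y j else x j)) \<in> borel_measurable (PiM (insert i (set js)) (\<lambda>_. \<gamma>1))"
  proof (rule measurable_compose[OF _ assms(1)], rule measurable_PiM_single')
    fix j show "(\<lambda>y. if j \<in> insert i (set js) then y j else x j) \<in> borel_measurable (PiM (insert i (set js)) (\<lambda>_. \<gamma>1))"
    proof (cases "j \<in> insert i (set js)")
      case True
      then have "(\<lambda>y. y j) \<in> measurable (PiM (insert i (set js)) (\<lambda>_. \<gamma>1)) \<gamma>1" by (rule measurable_component_singleton)
      then show ?thesis using True by simp
    qed simp
  qed auto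
  have "(\<integral>\<^sup>+y. h (\<lambda>j. if j \<in> set (i # js) then y j else x j) \<partial>PiM (set (i # js)) (\<lambda>_. \<gamma>1))
     = (\<integral>\<^sup>+t. \<integral>\<^sup>+y. h (\<lambda>j. if j \<in> set (i # js) then (y(i := t)) j else x j) \<partial>PiM (set js) (\<lambda>_. \<gamma>1) \<partial>\<gamma>1)"
    using Cons.prems m unfolding list.set by (subst product_nn_integral_insert_rev) auto
  also have "\<dots> = (\<integral>\<^sup>+t. \<integral>\<^sup>+y. h (\<lambda>j. if j \<in> set js then y j else (x(i := t)) j) \<partial>PiM (set js) (\<lambda>_. \<gamma>1) \<partial>\<gamma>1)"
    using Cons.prems by (intro nn_integral_cong arg_cong[where f=h] ext) auto
  also have "\<dots> = iter_integral (i # js) h x" using Cons by simp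
  finally show ?case by simp
qed

abbreviation \<Gamma> :: "('n::finite \<Rightarrow> real) measure" where "\<Gamma> \<equiv> PiM UNIV (\<lambda>_. \<gamma>1)"

lemma talagrand_PiM:
  fixes f :: "('n::finite \<Rightarrow> real) \<Rightarrow> real"
  assumes f: "tame_density UNIV f" and total: "(\<integral>\<^sup>+y. ennreal (f y) \<partial>\<Gamma>) = 1"
  shows "\<exists>T\<in>measurable borel_fun borel_fun. 
     (\<forall>h\<in>borel_measurable borel_fun. (\<integral>\<^sup>+y. h (T y) \<partial>\<Gamma>) = (\<integral>\<^sup>+y. h y * ennreal (f y) \<partial>\<Gamma>)) \<and>
     (\<integral>\<^sup>+y. ennreal (\<Sum>j\<in>UNIV. (T y j - y j)\<^sup>2) \<partial>\<Gamma>) \<le> (\<integral>\<^sup>+y. ennreal (2 * ent (f y)) \<partial>\<Gamma>)"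
proof -
  obtain js :: "'n list" where js: "set js = UNIV" "distinct js"
    using finite_distinct_list[of "UNIV :: 'n set"] by auto
  have [measurable]: "f \<in> borel_measurable borel_fun" using f unfolding tame_density_def by blast
  have eq: "iter_integral js h x = (\<integral>\<^sup>+y. h y \<partial>\<Gamma>)" if "h \<in> borel_measurable borel_fun" for h x
    using iter_integral_PiM[OF that js(2)] js(1) by simp
  have "tame_density (set js) f" using f js by simp
  moreover have "iter_integral js (\<lambda>y. ennreal (f y)) x = 1" for x using total by (subst eq) auto
  ultimately obtain T where [measurable]: "T \<in> measurable borel_fun borel_fun" 
    and T: "\<And>h x. h\<in>borel_measurable borel_fun \<Longrightarrow> iter_integral js (\<lambda>y. h (T y)) x = iter_integral js (\<lambda>y. h y * ennreal (f y)) x"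
    "\<And>x. iter_integral js (\<lambda>y. ennreal (\<Sum>j\<in>set js. (T y j - y j)\<^sup>2)) x \<le> iter_integral js (\<lambda>y. ennreal (2 * ent (f y))) x"
    using transport_exists[OF js(2), of f] unfolding Bex_def by blast
  show ?thesis
  proof (intro bexI[of _ T] conjI ballI)
    fix h :: "('n \<Rightarrow> real) \<Rightarrow> ennreal" assume [measurable]: "h\<in>borel_measurable borel_fun"
    show "(\<integral>\<^sup>+y. h (T y) \<partial>\<Gamma>) = (\<integral>\<^sup>+y. h y * ennreal (f y) \<partial>\<Gamma>)"
      using T(1)[of h] by (simp add: eq)
  next
    show "(\<integral>\<^sup>+y. ennreal (\<Sum>j\<in>UNIV. (T y j - y j)\<^sup>2) \<partial>\<Gamma>) \<le> (\<integral>\<^sup>+y. ennreal (2 * ent (f y)) \<partial>\<Gamma>)"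
      using T(2) js by (simp add: eq)
  qed measurable
qed

subsection \<open>Spectral theory of symmetric matrices\<close>

text \<open>A maximiser \<open>v\<close> of the quadratic form x \<bullet> f x on the unit sphere of
  \<open>S\<close> is an eigenvector: perturbing it along w in \<open>S\<close> shows that f v - l v
  is orthogonal to \<open>S\<close>, and this vector lies in \<open>S\<close> itself.\<close>

lemma self_adjoint_eigenvector:
  fixes f :: "'a::euclidean_space \<Rightarrow> 'a"
  assumes lin: "linear f" and sa: "\<And>x y. f x \<bullet> y = x \<bullet> f y"
    and S: "subspace S" "f ` S \<subseteq> S" "S \<noteq> {0}"
  shows "\<exists>v\<in>S. norm v = 1 \<and> f v = (v \<bullet> f v) *\<^sub>R v"
proof -
  let ?C = "S \<inter> sphere 0 1"
  have "compact ?C" by (intro closed_Int_compact closed_subspace S) simp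
  moreover have "?C \<noteq> {}"
  proof -
    obtain x where "x \<in> S" "x \<noteq> 0" using S subspace_0 by fastforce
    then have "(1 / norm x) *\<^sub>R x \<in> ?C" using S by (auto intro!: subspace_mul)
    then show ?thesis by blast
  qed
  moreover have "continuous_on ?C (\<lambda>x. x \<bullet> f x)"
    using lin by (intro continuous_intros linear_continuous_on) (simp add: linear_conv_bounded_linear)
  ultimately obtain v where v: "v \<in> ?C" and max: "\<And>x. x \<in> ?C \<Longrightarrow> x \<bullet> f x \<le> v \<bullet> f v"
    using continuous_attains_sup by metis
  define l where "l = v \<bullet> f v"
  have ineq: "x \<bullet> f x \<le> l * (x \<bullet> x)" if "x \<in> S" for x
  proof (cases "x = 0")
    case False
    then have "(1 / norm x) *\<^sub>R x \<in> ?C" using S that by (auto intro!: subspace_mul)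
    from max[OF this] show ?thesis
      using False by (simp add: linear_scale[OF lin] l_def field_simps power2_eq_square dot_square_norm)
  qed (simp add: linear_0[OF lin])
  have vv: "v \<in> S" "v \<bullet> v = 1" "norm v = 1" using v by (auto simp: dot_square_norm)
  have orth: "w \<bullet> (f v - l *\<^sub>R v) = 0" if w: "w \<in> S" for w
  proof -
    define c where "c = w \<bullet> (f v - l *\<^sub>R v)"
    define e where "e = l * (w \<bullet> w) - w \<bullet> f w"
    have e: "0 \<le> e" using ineq[OF w] by (simp add: e_def)
    have q: "2 * t * c \<le> t\<^sup>2 * e" for t
    proof -
      have "v + t *\<^sub>R w \<in> S" using vv w S by (intro subspace_add subspace_mul) auto
      note le = ineq[OF this]
      have 1: "(v + t *\<^sub>R w) \<bullet> f (v + t *\<^sub>R w) = l + 2 * t * (w \<bullet> f v) + t\<^sup>2 * (w \<bullet> f w)"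
      proof -
        have "v \<bullet> f w = w \<bullet> f v" using sa[of v w] by (metis inner_commute)
        then show ?thesis
          by (simp add: linear_add[OF lin] linear_scale[OF lin] inner_add l_def power2_eq_square algebra_simps)
      qed
      have 2: "(v + t *\<^sub>R w) \<bullet> (v + t *\<^sub>R w) = 1 + 2 * t * (w \<bullet> v) + t\<^sup>2 * (w \<bullet> w)"
        using vv by (simp add: inner_add inner_commute[of v w] power2_eq_square algebra_simps)
      show ?thesis using le unfolding 1 2 by (simp add: c_def e_def inner_diff_right algebra_simps)
    qed
    show ?thesis
    proof (rule ccontr)
      assume "w \<bullet> (f v - l *\<^sub>R v) \<noteq> 0"
      then have c: "c \<noteq> 0" by (simp add: c_def)
      \<comment> \<open>For small t the linear term 2tc exceeds the quadratic term t^2 e. The choice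
        t = c / (e + 1) is small enough, and adding 1 covers e = 0.\<close>
      have "2 * (c / (e + 1)) * c \<le> (c / (e + 1))\<^sup>2 * e" by (rule q)
      then have "2 * c\<^sup>2 / (e + 1) \<le> c\<^sup>2 * e / (e + 1)\<^sup>2" by (simp add: power2_eq_square field_simps)
      then have "2 * c\<^sup>2 * (e + 1) \<le> c\<^sup>2 * e"
        using e by (simp add: divide_simps power2_eq_square split: if_splits)
      then have "c\<^sup>2 * (e + 2) \<le> 0" by (simp add: algebra_simps)
      moreover have "0 < c\<^sup>2 * (e + 2)" using c e by (intro mult_pos_pos) auto
      ultimately show False by simp
    qed
  qed
  have "f v - l *\<^sub>R v \<in> S" using S vv by (intro subspace_diff subspace_mul) auto
  from orth[OF this] have "f v = l *\<^sub>R v" by simp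
  then show ?thesis using vv by (auto simp: l_def)
qed

text \<open>Induction on the dimension: the orthogonal complement in \<open>S\<close> of an
  eigenvector is again invariant, because f is self-adjoint.\<close>

lemma self_adjoint_orthonormal_basis:
  fixes f :: "'a::euclidean_space \<Rightarrow> 'a"
  assumes lin: "linear f" and sa: "\<And>x y. f x \<bullet> y = x \<bullet> f y"
    and S: "subspace S" "f ` S \<subseteq> S"
  shows "\<exists>B\<subseteq>S. pairwise orthogonal B \<and> (\<forall>b\<in>B. norm b = 1 \<and> (\<exists>l. f b = l *\<^sub>R b)) \<and> S \<subseteq> span B"
  using S
proof (induction "dim S" arbitrary: S rule: less_induct)
  case less
  show ?case
  proof (cases "S = {0}")
    case True
    then show ?thesis by (intro exI[of _ "{}"]) auto
  next
    case False
    obtain v where v: "v \<in> S" "norm v = 1" "f v = (v \<bullet> f v) *\<^sub>R v"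
      using self_adjoint_eigenvector[OF lin sa less.prems False] by blast
    have vv: "v \<bullet> v = 1" using v by (simp add: dot_square_norm)
    define S' where "S' = {x \<in> S. v \<bullet> x = 0}"
    have sub: "subspace S'" unfolding S'_def
      using less.prems(1) by (auto simp: subspace_def inner_add_right)
    have inv: "f ` S' \<subseteq> S'"
    proof
      fix y assume "y \<in> f ` S'"
      then obtain x where x: "x \<in> S" "v \<bullet> x = 0" "y = f x" by (auto simp: S'_def)
      have "v \<bullet> f x = f v \<bullet> x" using sa by simp
      also have "\<dots> = (v \<bullet> f v) * (v \<bullet> x)" by (subst v(3)) simp
      finally show "y \<in> S'" using x less.prems by (auto simp: S'_def)
    qed
    have "v \<notin> S'" using vv by (simp add: S'_def)
    moreover have "S' \<subseteq> S" by (auto simp: S'_def)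
    ultimately have "S' \<subset> S" using v(1) by blast
    then have "dim S' < dim S"
      using sub less.prems(1) by (intro dim_psubset) (simp add: span_eq_iff[THEN iffD2])
    from less.hyps[OF this sub inv] obtain B where B: "B \<subseteq> S'" "pairwise orthogonal B"
      "\<forall>b\<in>B. norm b = 1 \<and> (\<exists>l. f b = l *\<^sub>R b)" "S' \<subseteq> span B" by blast
    have "S \<subseteq> span (insert v B)"
    proof
      fix x assume x: "x \<in> S"
      then have "x - (v \<bullet> x) *\<^sub>R v \<in> S'"
        using less.prems(1) v vv by (auto simp: S'_def inner_diff_right intro!: subspace_diff subspace_mul)
      then have "x - (v \<bullet> x) *\<^sub>R v \<in> span (insert v B)"
        using B(4) span_mono[of B "insert v B"] by blast
      moreover have "(v \<bullet> x) *\<^sub>R v \<in> span (insert v B)" by (intro span_mul span_base) simp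
      ultimately have "(x - (v \<bullet> x) *\<^sub>R v) + (v \<bullet> x) *\<^sub>R v \<in> span (insert v B)" by (rule span_add)
      then show "x \<in> span (insert v B)" by simp
    qed
    moreover have "pairwise orthogonal (insert v B)"
      using B(1,2) by (auto simp: pairwise_insert orthogonal_def S'_def inner_commute)
    moreover have "\<exists>l. f v = l *\<^sub>R v" using v(3) by blast
    ultimately show ?thesis using v B(1,3) by (intro exI[of _ "insert v B"]) (auto simp: S'_def)
  qed
qed

section \<open>Symmetric matrices in spectral form\<close>

definition diagm :: "('n \<Rightarrow> real) \<Rightarrow> real^'n^'n" where
  "diagm a = (\<chi> i j. if i = j then a i else 0)"

text \<open>For orthogonal \<open>P\<close>, the symmetric matrix whose eigenvectors are the columns
  of \<open>P\<close> and whose eigenvalues are \<open>a\<close>. With \<open>P\<close> fixed, sums,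
  products, trace, determinant and norm are computed from the eigenvalues alone.\<close>

definition conjm :: "real^'n^'n \<Rightarrow> ('n \<Rightarrow> real) \<Rightarrow> real^'n^'n" where
  "conjm P a = P ** diagm a ** transpose P"

lemma diagm_mult_vec: "diagm a *v x = (\<chi> i. a i * x $ i)"
  by (simp add: diagm_def matrix_vector_mult_def vec_eq_iff if_distrib[of "\<lambda>x. x * _"] sum.delta cong: if_cong)

lemma diagm_mult: "diagm a ** diagm b = diagm (\<lambda>i. a i * b i)"
  by (simp add: diagm_def matrix_matrix_mult_def vec_eq_iff if_distrib[of "\<lambda>x. x * _"] sum.delta cong: if_cong)

lemma transpose_diagm: "transpose (diagm a) = diagm a"
  by (simp add: diagm_def transpose_def vec_eq_iff)

lemma diagm_1: "diagm (\<lambda>_. 1) = mat 1"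
  by (simp add: diagm_def mat_def)

lemma diagm_add: "diagm a + diagm b = diagm (\<lambda>i. a i + b i)"
  by (simp add: diagm_def vec_eq_iff)

lemma trace_diagm: "trace (diagm a) = sum a UNIV"
  by (simp add: diagm_def trace_def)

lemma det_diagm: "det (diagm a) = prod a UNIV"
  by (subst det_diagonal) (auto simp: diagm_def)

lemma transpose_conjm: "transpose (conjm P a) = conjm P a"
  by (simp add: conjm_def matrix_transpose_mul transpose_diagm matrix_mul_assoc)

context
  fixes P :: "real^'n^'n"
  assumes P: "orthogonal_matrix P"
begin

lemma PtP: "transpose P ** P = mat 1" and PPt: "P ** transpose P = mat 1"
  using P by (auto simp: orthogonal_matrix_def)

lemma conjm_mult: "conjm P a ** conjm P b = conjm P (\<lambda>i. a i * b i)"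
proof -
  have "conjm P a ** conjm P b = P ** diagm a ** (transpose P ** P) ** diagm b ** transpose P"
    by (simp add: conjm_def matrix_mul_assoc)
  also have "\<dots> = P ** (diagm a ** diagm b) ** transpose P"
    by (simp add: PtP matrix_mul_assoc)
  finally show ?thesis by (simp add: conjm_def diagm_mult)
qed

lemma conjm_1: "conjm P (\<lambda>_. 1) = mat 1"
  by (simp add: conjm_def diagm_1 PPt)

lemma conjm_add: "conjm P a + conjm P b = conjm P (\<lambda>i. a i + b i)"
  unfolding conjm_def diagm_add[symmetric] matrix_add_ldistrib
  by (simp add: matrix_matrix_mult_def vec_eq_iff sum.distrib distrib_right)

lemma trace_conjm: "trace (conjm P a) = sum a UNIV"
proof -
  have "trace (conjm P a) = trace (transpose P ** (P ** diagm a))"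
    unfolding conjm_def by (rule trace_mul_sym)
  then show ?thesis by (simp add: matrix_mul_assoc PtP trace_diagm)
qed

lemma det_conjm: "det (conjm P a) = prod a UNIV"
proof -
  have "det P * det P = 1" using arg_cong[OF PPt, of det] by (simp add: det_mul)
  then show ?thesis by (simp add: conjm_def det_mul det_diagm)
qed

lemma conjm_vec: "conjm P a *v (P *v x) = P *v (\<chi> i. a i * x $ i)"
proof -
  have "conjm P a *v (P *v x) = P *v (diagm a *v ((transpose P ** P) *v x))"
    by (simp add: conjm_def matrix_vector_mul_assoc matrix_mul_assoc)
  then show ?thesis by (simp add: PtP diagm_mult_vec)
qed

lemma inner_orth: "(P *v x) \<bullet> (P *v y) = x \<bullet> y"
proof -
  have "(P *v x) \<bullet> (P *v y) = x \<bullet> (transpose P *v (P *v y))"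
    by (metis dot_lmul_matrix vector_transpose_matrix)
  then show ?thesis by (simp add: matrix_vector_mul_assoc PtP)
qed

lemma norm_orth: "norm (P *v x) = norm x"
  by (simp add: norm_eq_sqrt_inner inner_orth)

lemma orth_surj: "\<exists>y. x = P *v y"
  by (rule exI[of _ "transpose P *v x"]) (simp add: matrix_vector_mul_assoc PPt del: transpose_matrix_vector)

end


theorem spectral_theorem:
  fixes A :: "real^'n^'n"
  assumes A: "transpose A = A"
  shows "\<exists>P a. orthogonal_matrix P \<and> A = conjm P a"
proof -
  have sa: "(A *v x) \<bullet> y = x \<bullet> (A *v y)" for x y
    by (metis A dot_lmul_matrix vector_transpose_matrix)
  obtain B where B: "pairwise orthogonal B" "\<And>b. b \<in> B \<Longrightarrow> norm b = 1"
    "\<And>b. b \<in> B \<Longrightarrow> \<exists>l. A *v b = l *\<^sub>R b" "UNIV \<subseteq> span B"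
    using self_adjoint_orthonormal_basis[of "(*v) A" UNIV] sa by auto
  have "0 \<notin> B" using B(2) by fastforce
  then have ind: "independent B" using B(1) by (simp add: pairwise_orthogonal_independent)
  have "card B = dim (UNIV :: (real^'n) set)"
    using ind B(4) by (intro dim_eq_card[symmetric]) (auto simp: span_UNIV)
  then have cB: "card B = CARD('n)" by simp
  then have fB: "finite B" by (metis card.infinite zero_less_card_finite less_irrefl)
  then obtain e where e: "bij_betw e (UNIV :: 'n set) B"
    using cB by (metis bij_betw_iff_card finite)
  define P :: "real^'n^'n" where "P = (\<chi> i j. e j $ i)"
  have col: "column j P = e j" for j by (simp add: column_def P_def vec_eq_iff)
  have eB: "e j \<in> B" for j using e by (auto simp: bij_betw_def)
  have P: "orthogonal_matrix P"
    unfolding orthogonal_matrix_orthonormal_columns col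
    by (intro conjI allI impI B(2)[OF eB] pairwiseD[OF B(1) eB eB])
      (simp add: inj_eq[OF bij_betw_imp_inj_on[OF e]])
  define a where "a j = (SOME l. A *v e j = l *\<^sub>R e j)" for j
  have a: "A *v e j = a j *\<^sub>R e j" for j
    unfolding a_def by (rule someI_ex) (rule B(3)[OF eB])
  have "A *v (P *v x) = conjm P a *v (P *v x)" for x
  proof -
    have "A *v (P *v x) = A *v (\<Sum>j\<in>UNIV. x $ j *\<^sub>R e j)"
      by (simp add: matrix_mult_sum[of P] col scalar_mult_eq_scaleR)
    also have "\<dots> = (\<Sum>j\<in>UNIV. (a j * x $ j) *\<^sub>R e j)"
      by (simp add: linear_sum[OF matrix_vector_mul_linear] matrix_vector_mult_scaleR a mult.commute)
    also have "\<dots> = P *v (\<chi> i. a i * x $ i)"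
      by (simp add: matrix_mult_sum[of P] col scalar_mult_eq_scaleR)
    finally show ?thesis by (simp add: conjm_vec[OF P])
  qed
  then have "A *v y = conjm P a *v y" for y using orth_surj[OF P, of y] by auto
  then have "A = conjm P a" by (simp add: matrix_eq)
  then show ?thesis using P by blast
qed

lemma norm_vec_sq: "(norm (x :: real^'n))\<^sup>2 = (\<Sum>i\<in>UNIV. (x $ i)\<^sup>2)"
  unfolding power2_norm_eq_inner inner_vec_def by (simp add: power2_eq_square)

lemma norm_sq_trace: "(norm (A :: real^'m^'n))\<^sup>2 = trace (transpose A ** A)"
  unfolding power2_norm_eq_inner inner_vec_def trace_def transpose_def matrix_matrix_mult_def
  by (simp add: sum.swap[of _ "UNIV :: 'm set"])

lemma norm_conjm:
  assumes "orthogonal_matrix P" shows "(norm (conjm P a))\<^sup>2 = (\<Sum>i\<in>UNIV. (a i)\<^sup>2)"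
  unfolding norm_sq_trace transpose_conjm conjm_mult[OF assms] trace_conjm[OF assms] by (simp add: power2_eq_square)

lemma norm_transpose: "norm (transpose A) = norm (A :: real^'m^'n)"
proof -
  have "(norm (transpose A))\<^sup>2 = (norm A)\<^sup>2"
    unfolding norm_sq_trace transpose_transpose by (rule trace_mul_sym)
  then show ?thesis by (simp add: power2_eq_iff_nonneg)
qed

lemma norm_matrix_vector_mult_le: "norm (A *v x) \<le> norm (A :: real^'m^'n) * norm x"
proof (rule power2_le_imp_le)
  have "(norm (A *v x))\<^sup>2 = (\<Sum>i\<in>UNIV. (A $ i \<bullet> x)\<^sup>2)"
    by (simp add: norm_vec_sq matrix_vector_mul_component)
  also have "\<dots> \<le> (\<Sum>i\<in>UNIV. (norm (A $ i))\<^sup>2 * (norm x)\<^sup>2)"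
  proof (rule sum_mono)
    fix i
    have "\<bar>A $ i \<bullet> x\<bar> \<le> \<bar>norm (A $ i) * norm x\<bar>" using Cauchy_Schwarz_ineq2[of "A $ i" x] by simp
    then show "(A $ i \<bullet> x)\<^sup>2 \<le> (norm (A $ i))\<^sup>2 * (norm x)\<^sup>2"
      by (metis abs_le_square_iff power_mult_distrib)
  qed
  also have "\<dots> = (norm A * norm x)\<^sup>2"
    unfolding power_mult_distrib sum_distrib_right[symmetric]
    by (simp add: power2_norm_eq_inner inner_vec_def)
  finally show "(norm (A *v x))\<^sup>2 \<le> (norm A * norm x)\<^sup>2" .
qed simp

text \<open>The squared Hilbert-Schmidt norm is the sum over the columns. The left factor then
  enters through an operator bound, which yields powers of 1 / \<lambda>(K) rather than
  Hilbert-Schmidt norms of the root.\<close>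

lemma norm_matrix_mult_le:
  fixes A :: "real^'n^'m" and B :: "real^'k^'n"
  assumes "\<And>v. norm (A *v v) \<le> c * norm v" "0 \<le> c"
  shows "norm (A ** B) \<le> c * norm B"
proof (rule power2_le_imp_le)
  have col: "(norm C)\<^sup>2 = (\<Sum>j\<in>UNIV. (norm (column j C))\<^sup>2)" for C :: "real^'k^'l"
    unfolding power2_norm_eq_inner inner_vec_def column_def
    by (simp add: sum.swap[of _ "UNIV :: 'k set"])
  have "(norm (A ** B))\<^sup>2 = (\<Sum>j\<in>UNIV. (norm (A *v column j B))\<^sup>2)"
    unfolding col by (intro sum.cong refl arg_cong[where f="\<lambda>v. (norm v)\<^sup>2"])
      (simp add: column_def matrix_matrix_mult_def matrix_vector_mult_def vec_eq_iff)
  also have "\<dots> \<le> (\<Sum>j\<in>UNIV. (c * norm (column j B))\<^sup>2)"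
    by (intro sum_mono power_mono assms) simp
  also have "\<dots> = (c * norm B)\<^sup>2"
    unfolding power_mult_distrib col[of B] sum_distrib_left ..
  finally show "(norm (A ** B))\<^sup>2 \<le> (c * norm B)\<^sup>2" .
qed (use assms in simp)

lemma eigenvalues_conjm:
  fixes P :: "real^'n^'n"
  assumes P: "orthogonal_matrix P"
  shows "eigenvalues (conjm P a) = range a"
proof
  show "eigenvalues (conjm P a) \<subseteq> range a"
  proof
    fix l assume "l \<in> eigenvalues (conjm P a)"
    then obtain v where v: "v \<noteq> 0" "conjm P a *v v = l *\<^sub>R v" by (auto simp: eigenvalues_def)
    obtain x where x: "v = P *v x" using orth_surj[OF P] by auto
    have "P *v (\<chi> i. a i * x $ i) = P *v (l *\<^sub>R x)"
      using v(2) unfolding x conjm_vec[OF P] by (simp add: matrix_vector_mult_scaleR)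
    then have "P *v ((\<chi> i. a i * x $ i) - l *\<^sub>R x) = 0" by (simp add: matrix_vector_mult_diff_distrib)
    then have "(\<chi> i. a i * x $ i) = l *\<^sub>R x" using norm_orth[OF P] by (metis eq_iff_diff_eq_0 norm_eq_zero)
    moreover obtain i where "x $ i \<noteq> 0" using v(1) x by (metis matrix_vector_mult_0_right vec_eq_iff zero_index)
    ultimately show "l \<in> range a" by (auto simp: vec_eq_iff)
  qed
  show "range a \<subseteq> eigenvalues (conjm P a)"
  proof
    fix l assume "l \<in> range a"
    then obtain i where i: "l = a i" by auto
    have "(\<chi> j. a j * axis i 1 $ j) = l *\<^sub>R (axis i 1 :: real^'n)"
      by (auto simp: vec_eq_iff axis_def i)
    then have "conjm P a *v (P *v axis i 1) = l *\<^sub>R (P *v axis i 1)"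
      by (simp add: conjm_vec[OF P] matrix_vector_mult_scaleR)
    moreover have "P *v axis i 1 \<noteq> 0" using norm_orth[OF P, of "axis i 1"] by auto
    ultimately show "l \<in> eigenvalues (conjm P a)" by (auto simp: eigenvalues_def)
  qed
qed

lemma inner_conjm:
  assumes P: "orthogonal_matrix P"
  shows "(P *v x) \<bullet> (conjm P a *v (P *v x)) = (\<Sum>i\<in>UNIV. a i * (x $ i)\<^sup>2)"
  unfolding conjm_vec[OF P] inner_orth[OF P]
  by (simp add: inner_vec_def power2_eq_square mult_ac)

lemma norm_conjm_vec_sq:
  assumes P: "orthogonal_matrix P"
  shows "(norm (conjm P a *v (P *v x)))\<^sup>2 = (\<Sum>i\<in>UNIV. (a i)\<^sup>2 * (x $ i)\<^sup>2)"
  unfolding conjm_vec[OF P] norm_orth[OF P]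
  by (simp add: norm_vec_sq power_mult_distrib)

section \<open>The covariance matrix, its eigenvalues and its square root\<close>

context
  fixes K :: "real^'n^'n"
  assumes psd: "positive_semidefinite K" and inv: "invertible K"
begin

text \<open>Semidefiniteness makes the eigenvalues nonnegative, and a zero eigenvalue would make the
  determinant vanish.\<close>

lemma covariance_spectral:
  obtains P a where "orthogonal_matrix P" "K = conjm P a"
    "\<And>i. min_eigenvalue K \<le> a i" "\<And>i. a i \<le> op_norm K" "0 < min_eigenvalue K"
    "min_eigenvalue K \<in> range a"
proof -
  obtain P a where P: "orthogonal_matrix P" and K: "K = conjm P a"
    using spectral_theorem[of K] psd by (auto simp: positive_semidefinite_def)
  have ev: "eigenvalues K = range a" unfolding K by (rule eigenvalues_conjm[OF P])
  have mem: "min_eigenvalue K \<in> range a"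
    unfolding min_eigenvalue_def ev by (rule Min_in) auto
  have le: "min_eigenvalue K \<le> a i" for i
    unfolding min_eigenvalue_def ev by (rule Min_le) auto
  have pos: "0 < a i" for i
  proof -
    have "0 \<le> a i"
    proof -
      have "0 \<le> (P *v axis i 1) \<bullet> (K *v (P *v axis i 1))" using psd by (simp add: positive_semidefinite_def)
      also have "\<dots> = (\<Sum>j\<in>UNIV. if j = i then a i else 0)"
        unfolding K inner_conjm[OF P] by (intro sum.cong) (auto simp: axis_def)
      finally show ?thesis by simp
    qed
    moreover have "a i \<noteq> 0"
    proof
      assume "a i = 0"
      then have "det K = 0" unfolding K det_conjm[OF P] by (auto intro: prod_zero)
      then show False using inv by (simp add: invertible_det_nz)
    qed
    ultimately show ?thesis by simp
  qed
  have op: "a i \<le> op_norm K" for i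
  proof -
    have "a i \<in> eigenvalues K" by (simp add: ev)
    then obtain v where v: "v \<noteq> 0" "K *v v = a i *\<^sub>R v" by (auto simp: eigenvalues_def)
    have "norm (K *v v) \<le> op_norm K * norm v"
      unfolding op_norm_def by (rule onorm) (rule matrix_vector_mul_bounded_linear)
    then show ?thesis using v pos[of i] by simp
  qed
  show thesis
    by (rule that[OF P K le op _ mem]) (use mem pos in auto)
qed

lemma min_eigenvalue_pos: "0 < min_eigenvalue K"
  using covariance_spectral by blast

lemma min_eigenvalue_le_op_norm: "min_eigenvalue K \<le> op_norm K"
  using covariance_spectral by (metis order_trans)

lemma norm_ge_min_eigenvalue: "sqrt (real CARD('n)) * min_eigenvalue K \<le> norm K"
proof -
  obtain P a where P: "orthogonal_matrix P" and K: "K = conjm P a" and le: "\<And>i. min_eigenvalue K \<le> a i"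
    and pos: "0 < min_eigenvalue K" using covariance_spectral by metis
  have "(sqrt (real CARD('n)) * min_eigenvalue K)\<^sup>2 = (\<Sum>i\<in>(UNIV::'n set). (min_eigenvalue K)\<^sup>2)"
    by (simp add: power_mult_distrib)
  also have "\<dots> \<le> (norm K)\<^sup>2"
    unfolding K norm_conjm[OF P] unfolding K[symmetric]
    using le pos by (intro sum_mono power_mono) auto
  finally show ?thesis by (rule power2_le_imp_le) simp
qed

text \<open>The inverse stretches the eigenvector of the smallest eigenvalue by 1 / \<lambda>(K).
  This links the norm of the inverse in the constants of the theorem to the powers of 1 /
  \<lambda>(K) that the proof produces.\<close>

lemma norm_inv_ge: "1 / min_eigenvalue K \<le> norm (matrix_inv K)"
proof -
  have "min_eigenvalue K \<in> eigenvalues K"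
    using covariance_spectral eigenvalues_conjm by metis
  then obtain v where v: "v \<noteq> 0" "K *v v = min_eigenvalue K *\<^sub>R v" by (auto simp: eigenvalues_def)
  have "matrix_inv K *v (K *v v) = v"
    using someI_ex[OF inv[unfolded invertible_def]]
    by (simp add: matrix_vector_mul_assoc matrix_inv_def)
  then have "v = min_eigenvalue K *\<^sub>R (matrix_inv K *v v)"
    unfolding v(2) by (simp add: matrix_vector_mult_scaleR)
  then have "norm v = min_eigenvalue K * norm (matrix_inv K *v v)"
    using min_eigenvalue_pos by (metis abs_of_pos norm_scaleR)
  also have "\<dots> \<le> min_eigenvalue K * (norm (matrix_inv K) * norm v)"
    using min_eigenvalue_pos by (intro mult_left_mono norm_matrix_vector_mult_le) auto
  finally have "norm v \<le> min_eigenvalue K * (norm (matrix_inv K) * norm v)" .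
  then have "1 \<le> min_eigenvalue K * norm (matrix_inv K)"
    using v(1) by simp
  then show ?thesis using min_eigenvalue_pos by (simp add: field_simps)
qed

text \<open>\<open>R\<close> is the square root of \<open>K\<close> and \<open>S\<close> is its
  inverse. The bound on \<open>S\<close> controls the standardised covariance, and the bound on
  \<open>R\<close> is the source of the factor sqrt (\<open>op_norm K\<close>) in the Wasserstein
  estimate.\<close>

lemma covariance_root:
  obtains R S :: "real^'n^'n" where
    "transpose S = S" "R ** S = mat 1" "S ** K ** S = mat 1" "transpose R = R" "S ** R = mat 1"
    "\<And>x. (norm (R *v x))\<^sup>2 \<le> op_norm K * (norm x)\<^sup>2"
    "\<And>x. (norm (S *v x))\<^sup>2 \<le> (norm x)\<^sup>2 / min_eigenvalue K"
proof -
  obtain P a where P: "orthogonal_matrix P" and K: "K = conjm P a" and le: "\<And>i. min_eigenvalue K \<le> a i"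
    and op: "\<And>i. a i \<le> op_norm K" and pos: "0 < min_eigenvalue K" using covariance_spectral by metis
  have a: "0 < a i" for i using le[of i] pos by simp
  have a0: "a i \<noteq> 0" for i using a[of i] by simp
  define R where "R = conjm P (\<lambda>i. sqrt (a i))"
  define S where "S = conjm P (\<lambda>i. 1 / sqrt (a i))"
  show thesis
  proof (rule that)
    show "transpose S = S" "transpose R = R" by (simp_all add: R_def S_def transpose_conjm)
    show "R ** S = mat 1" "S ** R = mat 1"
      using a0 by (simp_all add: R_def S_def conjm_mult[OF P] conjm_1[OF P])
    have "1 / sqrt (a i) * a i * (1 / sqrt (a i)) = 1" for i
      using a[of i] by (simp add: field_simps)
    then have "conjm P (\<lambda>i. 1 / sqrt (a i) * a i * (1 / sqrt (a i))) = conjm P (\<lambda>_. 1)" by presburger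
    then show "S ** K ** S = mat 1"
      unfolding S_def K conjm_mult[OF P] conjm_1[OF P] by simp
    fix x
    obtain y where y: "x = P *v y" using orth_surj[OF P] by auto
    have nx: "(norm x)\<^sup>2 = (\<Sum>i\<in>UNIV. (y $ i)\<^sup>2)" unfolding y norm_orth[OF P] norm_vec_sq ..
    have "(norm (R *v x))\<^sup>2 = (\<Sum>i\<in>UNIV. a i * (y $ i)\<^sup>2)"
      unfolding R_def y norm_conjm_vec_sq[OF P] using a by (simp add: less_imp_le)
    also have "\<dots> \<le> op_norm K * (norm x)\<^sup>2"
      unfolding nx sum_distrib_left using op by (intro sum_mono mult_right_mono) auto
    finally show "(norm (R *v x))\<^sup>2 \<le> op_norm K * (norm x)\<^sup>2" .
    have "(norm (S *v x))\<^sup>2 = (\<Sum>i\<in>UNIV. (1 / a i) * (y $ i)\<^sup>2)"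
      unfolding S_def y norm_conjm_vec_sq[OF P] using a by (simp add: less_imp_le power_divide)
    also have "\<dots> \<le> (\<Sum>i\<in>UNIV. (1 / min_eigenvalue K) * (y $ i)\<^sup>2)"
      using le pos by (intro sum_mono mult_right_mono) (auto intro!: divide_left_mono mult_pos_pos a)
    also have "\<dots> = (norm x)\<^sup>2 / min_eigenvalue K"
      unfolding nx by (simp add: sum_divide_distrib)
    finally show "(norm (S *v x))\<^sup>2 \<le> (norm x)\<^sup>2 / min_eigenvalue K" .
  qed
qed

end

subsection \<open>The standard Gaussian measure and characteristic functions\<close>

lemma borel_measurable_vec_nth [measurable (raw)]:
  fixes f :: "'a \<Rightarrow> 'b::real_normed_vector^'n"
  assumes "f \<in> borel_measurable M" shows "(\<lambda>x. f x $ i) \<in> borel_measurable M"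
  by (rule measurable_compose[OF assms borel_measurable_continuous_onI])
    (intro linear_continuous_on bounded_linear_vec_nth)

lemma borel_measurable_vec_iff:
  fixes f :: "'a \<Rightarrow> real^'n"
  shows "f \<in> borel_measurable M \<longleftrightarrow> (\<forall>i. (\<lambda>x. f x $ i) \<in> borel_measurable M)"
proof
  assume *: "\<forall>i. (\<lambda>x. f x $ i) \<in> borel_measurable M"
  show "f \<in> borel_measurable M"
    unfolding borel_measurable_euclidean_space[of f]
  proof
    fix b :: "real^'n" assume "b \<in> Basis"
    then obtain i where "b = axis i 1" by (auto simp: Basis_vec_def)
    then show "(\<lambda>x. f x \<bullet> b) \<in> borel_measurable M"
      using * by (simp add: cart_eq_inner_axis[symmetric])
  qed
qed (auto intro: borel_measurable_vec_nth)

lemma borel_measurable_vec_lambda [measurable (raw)]: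
  fixes f :: "'n::finite \<Rightarrow> 'a \<Rightarrow> real"
  assumes "\<And>i. f i \<in> borel_measurable M" shows "(\<lambda>x. \<chi> i. f i x) \<in> borel_measurable M"
  using assms by (simp add: borel_measurable_vec_iff)

lemma vec_nth_measurable [measurable]: "vec_nth \<in> measurable borel (borel_fun :: ('n::finite \<Rightarrow> real) measure)"
  by (rule measurable_PiM_single') (auto simp: space_PiM)

lemma vec_lambda_measurable [measurable]: "vec_lambda \<in> measurable (borel_fun :: ('n::finite \<Rightarrow> real) measure) borel"
proof -
  have "(\<lambda>f::'n \<Rightarrow> real. \<chi> i. f i) \<in> borel_measurable borel_fun" by measurable
  then show ?thesis by simp
qed

lemma matrix_vector_mult_measurable [measurable (raw)]:
  fixes f :: "'a \<Rightarrow> real^'n^'m" and g :: "'a \<Rightarrow> real^'n"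
  assumes [measurable]: "f \<in> borel_measurable M" "g \<in> borel_measurable M"
  shows "(\<lambda>x. f x *v g x) \<in> borel_measurable M"
  by (simp add: borel_measurable_vec_iff matrix_vector_mult_def)

text \<open>Built as an image of the product measure, so that the coordinates are independent and
  the transport theorem for the product carries over.\<close>

definition gauss :: "(real^'n) measure" where
  "gauss = distr (\<Gamma>) borel vec_lambda"

lemma sets_PiM_gamma1: "sets ((\<Gamma> :: ('n::finite \<Rightarrow> real) measure)) = sets borel_fun"
  by (intro sets_PiM_cong) auto

lemma vec_lambda_measurable' [measurable]:
  "vec_lambda \<in> measurable ((\<Gamma> :: ('n::finite \<Rightarrow> real) measure)) borel"
  using vec_lambda_measurable by (simp cong: measurable_cong_sets add: sets_PiM_gamma1)

interpretation gamma1: product_sigma_finite "\<lambda>_::'n::finite. \<gamma>1"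
  by (simp add: product_sigma_finite_def sigma_finite_gamma1)

lemma sets_gauss [measurable_cong, simp]: "sets gauss = sets borel"
  by (simp add: gauss_def)

lemma space_gauss [simp]: "space gauss = UNIV"
  by (simp add: gauss_def)

lemma prob_space_gauss: "prob_space (gauss :: (real^'n) measure)"
  unfolding gauss_def
  by (intro prob_space.prob_space_distr vec_lambda_measurable' prob_space_PiM prob_space_gamma1)

interpretation gauss: prob_space "gauss :: (real^'n) measure" by (rule prob_space_gauss)

lemma emeasure_gauss_UNIV [simp]: "emeasure gauss UNIV = 1"
  using gauss.emeasure_space_1 by simp

lemma nn_integral_gauss:
  assumes [measurable]: "h \<in> borel_measurable borel"
  shows "(\<integral>\<^sup>+x. h x \<partial>(gauss :: (real^'n) measure)) = (\<integral>\<^sup>+f. h (vec_lambda f) \<partial>\<Gamma>)"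
  unfolding gauss_def by (subst nn_integral_distr) auto

lemma gauss_prod:
  fixes f :: "'n::finite \<Rightarrow> real \<Rightarrow> 'b::{real_normed_field,banach,second_countable_topology}"
  assumes f: "\<And>i. integrable \<gamma>1 (f i)"
  shows "integrable gauss (\<lambda>x::real^'n. \<Prod>i\<in>UNIV. f i (x $ i))"
    "(\<integral>x. (\<Prod>i\<in>UNIV. f i ((x::real^'n) $ i)) \<partial>gauss) = (\<Prod>i\<in>UNIV. \<integral>t. f i t \<partial>\<gamma>1)"
proof -
  have [measurable]: "f i \<in> borel_measurable borel" for i
    using borel_measurable_integrable[OF f[of i]] by simp
  show "integrable gauss (\<lambda>x::real^'n. \<Prod>i\<in>UNIV. f i (x $ i))"
    unfolding gauss_def
    by (subst integrable_distr_eq) (auto intro!: gamma1.product_integrable_prod f)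
  show "(\<integral>x. (\<Prod>i\<in>UNIV. f i ((x::real^'n) $ i)) \<partial>gauss) = (\<Prod>i\<in>UNIV. \<integral>t. f i t \<partial>\<gamma>1)"
    unfolding gauss_def
    by (subst integral_distr) (auto intro!: gamma1.product_integral_prod f)
qed

text \<open>The smoothing argument shifts the Gaussian measure, for which a density relative to
  Lebesgue measure is required.\<close>

lemma gauss_density: "gauss = density lborel (\<lambda>z::real^'n. \<Prod>i\<in>UNIV. ennreal (\<phi> (z $ i)))"
proof -
  let ?Q = "density lborel (\<lambda>z::real^'n. \<Prod>i\<in>UNIV. ennreal (\<phi> (z $ i)))"
  have "distr ?Q borel_fun vec_nth = \<Gamma>"
  proof (rule gamma1.PiM_eqI)
    show "sets (distr ?Q borel_fun vec_nth) = sets (\<Gamma>)" by (simp add: sets_PiM_gamma1)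
    fix A :: "'n \<Rightarrow> real set" assume "\<And>i. i \<in> UNIV \<Longrightarrow> A i \<in> sets \<gamma>1"
    then have A [measurable]: "A i \<in> sets borel" for i by simp
    have [measurable]: "Pi\<^sub>E UNIV A \<in> sets borel_fun" by (intro sets_PiM_I_finite) auto
    define F where "F i t = ennreal (\<phi> t) * indicator (A i) t" for i t
    have [measurable]: "F i \<in> borel_measurable borel" for i unfolding F_def by measurable
    \<comment> \<open>Lebesgue integrals of products factorize over the standard basis vectors; this
      and \<open>idx\<close> translate between basis vectors and indices.\<close>
    have re: "(\<Prod>i\<in>UNIV. G (axis i (1::real))) = (\<Prod>b\<in>Basis. G b)" for G :: "real^'n \<Rightarrow> ennreal"
    proof -
      have "Basis = range (\<lambda>i::'n. axis i (1::real))" by (auto simp: Basis_vec_def)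
      moreover have "inj (\<lambda>i::'n. axis i (1::real))" by (auto simp: inj_on_def axis_eq_axis)
      ultimately show ?thesis using prod.reindex[of "\<lambda>i::'n. axis i (1::real)" UNIV G] by (metis comp_apply prod.cong)
    qed
    define idx where "idx b = (THE i. b = axis i (1::real))" for b :: "real^'n"
    have idx [simp]: "idx (axis i 1) = i" for i unfolding idx_def by (simp add: axis_eq_axis)
    have "emeasure (distr ?Q borel_fun vec_nth) (Pi\<^sub>E UNIV A) = (\<integral>\<^sup>+z. (\<Prod>i\<in>UNIV. ennreal (\<phi> (z $ i))) * indicator (Pi\<^sub>E UNIV A) (vec_nth z) \<partial>lborel)"
    proof -
      have [measurable]: "vec_nth -` Pi\<^sub>E UNIV A \<in> sets (borel :: (real^'n) measure)"
        using measurable_sets[OF vec_nth_measurable, of "Pi\<^sub>E UNIV A"] by simp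
      show ?thesis
        by (subst emeasure_distr, simp, simp, subst emeasure_density) (auto simp: indicator_def intro!: nn_integral_cong)
    qed
    also have "\<dots> = (\<integral>\<^sup>+z. (\<Prod>i\<in>UNIV. F i (z $ i)) \<partial>lborel)"
    proof (rule nn_integral_cong)
      fix z :: "real^'n"
      have "indicator (Pi\<^sub>E UNIV A) (vec_nth z) = (\<Prod>i\<in>UNIV. indicator (A i) (z $ i) :: ennreal)"
        by (auto simp: indicator_def PiE_def Pi_def prod.If_cases intro!: prod_zero)
      then show "(\<Prod>i\<in>UNIV. ennreal (\<phi> (z $ i))) * indicator (Pi\<^sub>E UNIV A) (vec_nth z) = (\<Prod>i\<in>UNIV. F i (z $ i))"
        by (simp add: F_def prod.distrib)
    qed
    also have "\<dots> = (\<integral>\<^sup>+z. (\<Prod>b\<in>Basis. F (idx b) (z \<bullet> b)) \<partial>lborel)"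
      by (simp add: re[symmetric] cart_eq_inner_axis[symmetric])
    also have "\<dots> = (\<Prod>b\<in>Basis. \<integral>\<^sup>+t. F (idx b) t \<partial>lborel)"
      by (rule nn_integral_lborel_prod) auto
    also have "\<dots> = (\<Prod>i\<in>UNIV. \<integral>\<^sup>+t. F i t \<partial>lborel)"
      by (simp add: re[symmetric])
    also have "\<dots> = (\<Prod>i\<in>UNIV. emeasure \<gamma>1 (A i))"
      by (intro prod.cong refl) (simp add: emeasure_density F_def)
    finally show "emeasure (distr ?Q borel_fun vec_nth) (Pi\<^sub>E UNIV A) = (\<Prod>i\<in>UNIV. emeasure \<gamma>1 (A i))" .
  qed simp
  then have "gauss = distr (distr ?Q borel_fun vec_nth) borel vec_lambda" by (simp add: gauss_def)
  also have "\<dots> = distr ?Q borel (vec_lambda \<circ> vec_nth)" by (rule distr_distr) auto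
  also have "\<dots> = distr ?Q ?Q (\<lambda>x. x)" by (intro distr_cong) (auto simp: comp_def)
  finally show ?thesis by (simp add: distr_id)
qed

section \<open>Characteristic functions and their uniqueness\<close>

abbreviation iex :: "real \<Rightarrow> complex" where "iex t \<equiv> exp (\<i> * of_real t)"

lemma norm_iex [simp]: "norm (iex t) = 1"
  by (simp add: norm_exp_i_times)

lemma iex_measurable [measurable]: "(\<lambda>t. iex t) \<in> borel_measurable borel"
  by (intro borel_measurable_continuous_onI continuous_intros)

lemma iex_add: "iex (a + b) = iex a * iex b"
  by (simp add: exp_add[symmetric] ring_distribs)

lemma iex_sum: "finite I \<Longrightarrow> iex (\<Sum>i\<in>I. a i) = (\<Prod>i\<in>I. iex (a i))"
  by (simp add: exp_sum[symmetric] sum_distrib_left)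

lemma inner_vec_eq: "(y::real^'n) \<bullet> x = (\<Sum>i\<in>UNIV. y $ i * x $ i)"
  by (simp add: inner_vec_def)

lemma cf_gauss: "(\<integral>x. iex (y \<bullet> x) \<partial>gauss) = of_real (exp (- (norm (y::real^'n))\<^sup>2 / 2))"
proof -
  interpret g1: prob_space \<gamma>1 by (rule prob_space_gamma1)
  have i: "integrable \<gamma>1 (\<lambda>t. iex (a * t))" for a
    by (rule g1.integrable_const_bound[of _ 1]) auto
  have "(\<integral>x. iex (y \<bullet> x) \<partial>gauss) = (\<integral>x. (\<Prod>j\<in>UNIV. iex (y $ j * x $ j)) \<partial>gauss)"
    by (simp add: inner_vec_eq iex_sum del: of_real_sum)
  also have "\<dots> = (\<Prod>j\<in>UNIV. \<integral>t. iex (y $ j * t) \<partial>\<gamma>1)"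
    by (rule gauss_prod(2)) (rule i)
  also have "\<dots> = (\<Prod>j\<in>UNIV. of_real (exp (- (y $ j)\<^sup>2 / 2)))"
    using char_std_normal_distribution by (simp add: char_def fun_eq_iff)
  also have "\<dots> = of_real (exp (\<Sum>j\<in>UNIV. - (y $ j)\<^sup>2 / 2))"
    by (simp add: exp_sum of_real_prod)
  also have "(\<Sum>j\<in>UNIV. - (y $ j)\<^sup>2 / 2) = - (norm y)\<^sup>2 / 2"
    unfolding norm_vec_sq by (simp add: sum_divide_distrib sum_negf)
  finally show ?thesis .
qed

lemma Re_of_real_mult: "Re (of_real c * z) = c * Re z"
  by simp

text \<open>The convolution of \<open>\<mu>\<close> with a Gaussian law has a density which depends on \<open>\<mu>\<close> only through its
  characteristic function, because the Gaussian density is itself a Fourier transform.\<close>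

lemma gauss_smoothing:
  fixes \<mu> :: "(real^'n) measure" and \<sigma> :: real
  assumes fin: "finite_measure \<mu>" and s [measurable_cong]: "sets \<mu> = sets borel"
    and \<sigma>: "0 < \<sigma>" and [measurable]: "\<psi> \<in> borel_measurable borel"
  shows "(\<integral>\<^sup>+x. \<integral>\<^sup>+y. \<psi> (x + \<sigma> *\<^sub>R y) \<partial>gauss \<partial>\<mu>) =
    (\<integral>\<^sup>+z. ennreal (\<bar>1 / \<sigma>\<bar> ^ CARD('n)) * \<psi> z * ennreal ((1 / sqrt (2 * pi)) ^ CARD('n) *
      Re (\<integral>y. iex (y \<bullet> z / \<sigma>) * (\<integral>x. iex (((-1 / \<sigma>) *\<^sub>R y) \<bullet> x) \<partial>\<mu>) \<partial>gauss)) \<partial>lborel)"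
proof -
  interpret m: finite_measure \<mu> by fact
  define p where "p z = (\<Prod>i\<in>UNIV. \<phi> (z $ i))" for z :: "real^'n"
  have [measurable]: "p \<in> borel_measurable borel" unfolding p_def by measurable
  have p0: "0 \<le> p z" for z unfolding p_def by (intro prod_nonneg) auto
  have p_eq: "p z = (1 / sqrt (2 * pi)) ^ CARD('n) * exp (- (norm z)\<^sup>2 / 2)" for z
  proof -
    have "p z = (1 / sqrt (2 * pi)) ^ CARD('n) * (\<Prod>i\<in>UNIV. exp (- (z $ i)\<^sup>2 / 2))"
      unfolding p_def std_normal_density_def prod.distrib by simp
    also have "(\<Prod>i\<in>UNIV. exp (- (z $ i)\<^sup>2 / 2)) = exp (- (norm z)\<^sup>2 / 2)"
      unfolding norm_vec_sq by (simp add: exp_sum[symmetric] sum_divide_distrib sum_negf)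
    finally show ?thesis .
  qed
  \<comment> \<open>The substitution z = x + \<sigma> y moves \<open>x\<close> from the arbitrary
    function \<psi> into the Gaussian density.\<close>
  have inner: "(\<integral>\<^sup>+y. \<psi> (x + \<sigma> *\<^sub>R y) \<partial>gauss) = (\<integral>\<^sup>+z. ennreal (\<bar>1 / \<sigma>\<bar> ^ CARD('n)) * \<psi> z * ennreal (p ((1 / \<sigma>) *\<^sub>R (z - x))) \<partial>lborel)" for x
  proof -
    have "(\<integral>\<^sup>+y. \<psi> (x + \<sigma> *\<^sub>R y) \<partial>gauss) = (\<integral>\<^sup>+y. ennreal (p y) * \<psi> (x + \<sigma> *\<^sub>R y) \<partial>lborel)"
      unfolding gauss_density p_def by (subst nn_integral_density) (auto simp: prod_ennreal)
    also have "\<dots> = (\<integral>\<^sup>+z. ennreal (\<bar>1 / \<sigma>\<bar> ^ CARD('n)) * (ennreal (p (- (1/\<sigma>) *\<^sub>R x + (1 / \<sigma>) *\<^sub>R z)) * \<psi> (x + \<sigma> *\<^sub>R (- (1/\<sigma>) *\<^sub>R x + (1 / \<sigma>) *\<^sub>R z))) \<partial>lborel)"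
      using \<sigma> by (subst lborel_affine[of "1 / \<sigma>" "- (1/\<sigma>) *\<^sub>R x"], simp)
        (subst nn_integral_density, simp, simp, subst nn_integral_distr, auto)
    also have "\<dots> = (\<integral>\<^sup>+z. ennreal (\<bar>1 / \<sigma>\<bar> ^ CARD('n)) * \<psi> z * ennreal (p ((1 / \<sigma>) *\<^sub>R (z - x))) \<partial>lborel)"
      using \<sigma> by (intro nn_integral_cong) (simp add: scaleR_right_distrib scaleR_right_diff_distrib mult_ac)
    finally show ?thesis .
  qed
  interpret pair_sigma_finite \<mu> lborel
    by (intro pair_sigma_finite.intro) (unfold_locales)
  have "(\<integral>\<^sup>+x. \<integral>\<^sup>+y. \<psi> (x + \<sigma> *\<^sub>R y) \<partial>gauss \<partial>\<mu>) =
    (\<integral>\<^sup>+x. \<integral>\<^sup>+z. ennreal (\<bar>1 / \<sigma>\<bar> ^ CARD('n)) * \<psi> z * ennreal (p ((1 / \<sigma>) *\<^sub>R (z - x))) \<partial>lborel \<partial>\<mu>)"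
    by (simp add: inner)
  also have "\<dots> = (\<integral>\<^sup>+z. \<integral>\<^sup>+x. ennreal (\<bar>1 / \<sigma>\<bar> ^ CARD('n)) * \<psi> z * ennreal (p ((1 / \<sigma>) *\<^sub>R (z - x))) \<partial>\<mu> \<partial>lborel)"
    by (rule Fubini'[symmetric]) measurable
  also have "\<dots> = (\<integral>\<^sup>+z. ennreal (\<bar>1 / \<sigma>\<bar> ^ CARD('n)) * \<psi> z * (\<integral>\<^sup>+x. ennreal (p ((1 / \<sigma>) *\<^sub>R (z - x))) \<partial>\<mu>) \<partial>lborel)"
    by (intro nn_integral_cong nn_integral_cmult) measurable
  also have "\<dots> = (\<integral>\<^sup>+z. ennreal (\<bar>1 / \<sigma>\<bar> ^ CARD('n)) * \<psi> z * ennreal ((1 / sqrt (2 * pi)) ^ CARD('n) *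
      Re (\<integral>y. iex (y \<bullet> z / \<sigma>) * (\<integral>x. iex (((-1 / \<sigma>) *\<^sub>R y) \<bullet> x) \<partial>\<mu>) \<partial>gauss)) \<partial>lborel)"
  proof (intro nn_integral_cong arg_cong2[where f="(*)"] refl)
    fix z :: "real^'n"
    interpret gm: pair_sigma_finite "gauss :: (real^'n) measure" \<mu>
      by (intro pair_sigma_finite.intro) (unfold_locales)
    interpret gmf: finite_measure "(gauss :: (real^'n) measure) \<Otimes>\<^sub>M \<mu>"
      by (intro finite_measure_pair_measure gauss.finite_measure_axioms fin)
    let ?c = "(1 / sqrt (2 * pi)) ^ CARD('n)"
    have b: "p ((1 / \<sigma>) *\<^sub>R (z - x)) \<le> ?c" for x
      unfolding p_eq by (rule mult_left_le) auto
    have "(\<integral>\<^sup>+x. ennreal (p ((1 / \<sigma>) *\<^sub>R (z - x))) \<partial>\<mu>) = ennreal (\<integral>x. p ((1 / \<sigma>) *\<^sub>R (z - x)) \<partial>\<mu>)"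
      by (intro nn_integral_eq_integral m.integrable_const_bound[of _ ?c]) (auto simp: p0 b)
    also have "(\<integral>x. p ((1 / \<sigma>) *\<^sub>R (z - x)) \<partial>\<mu>) = Re (\<integral>x. of_real (p ((1 / \<sigma>) *\<^sub>R (z - x))) \<partial>\<mu>)"
      by (simp add: integral_complex_of_real)
    also have "(\<integral>x. complex_of_real (p ((1 / \<sigma>) *\<^sub>R (z - x))) \<partial>\<mu>)
       = (\<integral>x. of_real ?c * (\<integral>y. iex (y \<bullet> z / \<sigma>) * iex (((-1 / \<sigma>) *\<^sub>R y) \<bullet> x) \<partial>gauss) \<partial>\<mu>)"
    proof (intro Bochner_Integration.integral_cong refl)
      fix x
      have "complex_of_real (p ((1 / \<sigma>) *\<^sub>R (z - x))) = of_real ?c * (\<integral>y. iex (((1 / \<sigma>) *\<^sub>R (z - x)) \<bullet> y) \<partial>gauss)"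
        unfolding cf_gauss p_eq by simp
      also have "(\<integral>y. iex (((1 / \<sigma>) *\<^sub>R (z - x)) \<bullet> y) \<partial>gauss) = (\<integral>y. iex (y \<bullet> z / \<sigma>) * iex (((-1 / \<sigma>) *\<^sub>R y) \<bullet> x) \<partial>gauss)"
      proof (intro Bochner_Integration.integral_cong refl)
        fix y :: "real^'n"
        have "((1 / \<sigma>) *\<^sub>R (z - x)) \<bullet> y = y \<bullet> z / \<sigma> + ((-1 / \<sigma>) *\<^sub>R y) \<bullet> x"
          by (simp add: inner_diff_left inner_commute[of y] diff_divide_distrib)
        then show "iex (((1 / \<sigma>) *\<^sub>R (z - x)) \<bullet> y) = iex (y \<bullet> z / \<sigma>) * iex (((-1 / \<sigma>) *\<^sub>R y) \<bullet> x)"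
          by (simp only: iex_add)
      qed
      finally show "complex_of_real (p ((1 / \<sigma>) *\<^sub>R (z - x))) =
          of_real ?c * (\<integral>y. iex (y \<bullet> z / \<sigma>) * iex (((-1 / \<sigma>) *\<^sub>R y) \<bullet> x) \<partial>gauss)" .
    qed
    also have "\<dots> = of_real ?c * (\<integral>x. (\<integral>y. iex (y \<bullet> z / \<sigma>) * iex (((-1 / \<sigma>) *\<^sub>R y) \<bullet> x) \<partial>gauss) \<partial>\<mu>)"
      by (rule integral_mult_right_zero)
    also have "(\<integral>x. (\<integral>y. iex (y \<bullet> z / \<sigma>) * iex (((-1 / \<sigma>) *\<^sub>R y) \<bullet> x) \<partial>gauss) \<partial>\<mu>)
        = (\<integral>y. (\<integral>x. iex (y \<bullet> z / \<sigma>) * iex (((-1 / \<sigma>) *\<^sub>R y) \<bullet> x) \<partial>\<mu>) \<partial>gauss)"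
      by (rule gm.Fubini_integral, rule gmf.integrable_const_bound[of _ 1]) (auto simp: norm_mult split_beta)
    also have "\<dots> = (\<integral>y. iex (y \<bullet> z / \<sigma>) * (\<integral>x. iex (((-1 / \<sigma>) *\<^sub>R y) \<bullet> x) \<partial>\<mu>) \<partial>gauss)"
      by (intro Bochner_Integration.integral_cong refl integral_mult_right_zero)
    finally show "(\<integral>\<^sup>+x. ennreal (p ((1 / \<sigma>) *\<^sub>R (z - x))) \<partial>\<mu>) = ennreal (?c * Re (\<integral>y. iex (y \<bullet> z / \<sigma>) * (\<integral>x. iex (((-1 / \<sigma>) *\<^sub>R y) \<bullet> x) \<partial>\<mu>) \<partial>gauss))"
      unfolding Re_of_real_mult .
  qed
  finally show ?thesis .
qed

lemma gauss_smoothing_limit: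
  fixes \<mu> :: "(real^'n) measure"
  assumes fin: "finite_measure \<mu>" and s [measurable_cong]: "sets \<mu> = sets borel"
    and c: "continuous_on UNIV \<psi>" and b: "\<And>x. 0 \<le> \<psi> x \<and> \<psi> x \<le> 1"
  shows "(\<lambda>n. \<integral>\<^sup>+x. \<integral>\<^sup>+y. ennreal (\<psi> (x + (1 / real (Suc n)) *\<^sub>R y)) \<partial>gauss \<partial>\<mu>) \<longlonglongrightarrow> (\<integral>\<^sup>+x. ennreal (\<psi> x) \<partial>\<mu>)"
proof -
  interpret m: finite_measure \<mu> by fact
  have [measurable]: "\<psi> \<in> borel_measurable borel" using c by (rule borel_measurable_continuous_onI)
  have 1: "(\<lambda>n. \<integral>\<^sup>+y. ennreal (\<psi> (x + (1 / real (Suc n)) *\<^sub>R y)) \<partial>gauss) \<longlonglongrightarrow> ennreal (\<psi> x)" for x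
  proof -
    have "(\<lambda>n. \<integral>\<^sup>+y. ennreal (\<psi> (x + (1 / real (Suc n)) *\<^sub>R y)) \<partial>gauss) \<longlonglongrightarrow> (\<integral>\<^sup>+y. ennreal (\<psi> x) \<partial>(gauss :: (real^'n) measure))"
    proof (rule nn_integral_dominated_convergence[where w="\<lambda>_. 1"])
      show "AE y in gauss. (\<lambda>n. ennreal (\<psi> (x + (1 / real (Suc n)) *\<^sub>R y))) \<longlonglongrightarrow> ennreal (\<psi> x)"
      proof (intro AE_I2 tendsto_ennrealI)
        fix y :: "real^'n"
        have "(\<lambda>n. x + (1 / real (Suc n)) *\<^sub>R y) \<longlonglongrightarrow> x + 0 *\<^sub>R y"
          by (intro tendsto_intros LIMSEQ_Suc[OF lim_1_over_n])
        moreover have "isCont \<psi> (x + 0 *\<^sub>R y)" using c by (simp add: continuous_on_eq_continuous_at)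
        ultimately have "(\<lambda>n. \<psi> (x + (1 / real (Suc n)) *\<^sub>R y)) \<longlonglongrightarrow> \<psi> (x + 0 *\<^sub>R y)"
          by (rule isCont_tendsto_compose[rotated])
        then show "(\<lambda>n. \<psi> (x + (1 / real (Suc n)) *\<^sub>R y)) \<longlonglongrightarrow> \<psi> x" by simp
      qed
      show "AE y in gauss. ennreal (\<psi> (x + (1 / real (Suc n)) *\<^sub>R y)) \<le> 1" for n
        using b by (intro AE_I2) (simp add: ennreal_le_1)
    qed (auto)
    then show ?thesis by (simp)
  qed
  show ?thesis
  proof (rule nn_integral_dominated_convergence[where w="\<lambda>_. 1"])
    show "AE x in \<mu>. (\<lambda>n. \<integral>\<^sup>+y. ennreal (\<psi> (x + (1 / real (Suc n)) *\<^sub>R y)) \<partial>gauss) \<longlonglongrightarrow> ennreal (\<psi> x)"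
      using 1 by (intro AE_I2)
    show "AE x in \<mu>. (\<integral>\<^sup>+y. ennreal (\<psi> (x + (1 / real (Suc n)) *\<^sub>R y)) \<partial>gauss) \<le> 1" for n
    proof (intro AE_I2)
      fix x
      have "(\<integral>\<^sup>+y. ennreal (\<psi> (x + (1 / real (Suc n)) *\<^sub>R y)) \<partial>gauss) \<le> (\<integral>\<^sup>+y. 1 \<partial>(gauss :: (real^'n) measure))"
        using b by (intro nn_integral_mono) (simp add: ennreal_le_1)
      then show "(\<integral>\<^sup>+y. ennreal (\<psi> (x + (1 / real (Suc n)) *\<^sub>R y)) \<partial>gauss) \<le> 1"
        by (simp)
    qed
    show "(\<integral>\<^sup>+x. 1 \<partial>\<mu>) < \<infinity>" using m.emeasure_finite[of "space \<mu>"] by (simp add: less_top[symmetric])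
  qed measurable
qed

theorem characteristic_function_unique:
  fixes \<mu> \<nu> :: "(real^'n) measure"
  assumes fin: "finite_measure \<mu>" "finite_measure \<nu>"
    and s [measurable_cong]: "sets \<mu> = sets borel" "sets \<nu> = sets borel"
    and eq: "\<And>y. (\<integral>x. iex (y \<bullet> x) \<partial>\<mu>) = (\<integral>x. iex (y \<bullet> x) \<partial>\<nu>)"
  shows "\<mu> = \<nu>"
proof -
  have int: "(\<integral>\<^sup>+x. ennreal (\<psi> x) \<partial>\<mu>) = (\<integral>\<^sup>+x. ennreal (\<psi> x) \<partial>\<nu>)"
    if c: "continuous_on UNIV \<psi>" and b: "\<And>x. 0 \<le> \<psi> x \<and> \<psi> x \<le> 1" for \<psi>
  proof (rule LIMSEQ_unique[OF gauss_smoothing_limit[OF fin(1) s(1) c b]])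
    have [measurable]: "\<psi> \<in> borel_measurable borel" using c by (rule borel_measurable_continuous_onI)
    have "(\<integral>\<^sup>+x. \<integral>\<^sup>+y. ennreal (\<psi> (x + (1 / real (Suc n)) *\<^sub>R y)) \<partial>gauss \<partial>\<mu>) =
        (\<integral>\<^sup>+x. \<integral>\<^sup>+y. ennreal (\<psi> (x + (1 / real (Suc n)) *\<^sub>R y)) \<partial>gauss \<partial>\<nu>)" for n
      using gauss_smoothing[OF fin(1) s(1), of "1 / real (Suc n)" "\<lambda>x. ennreal (\<psi> x)"]
        gauss_smoothing[OF fin(2) s(2), of "1 / real (Suc n)" "\<lambda>x. ennreal (\<psi> x)"]
      unfolding eq by simp
    then show "(\<lambda>n. \<integral>\<^sup>+x. \<integral>\<^sup>+y. ennreal (\<psi> (x + (1 / real (Suc n)) *\<^sub>R y)) \<partial>gauss \<partial>\<mu>) \<longlonglongrightarrow> (\<integral>\<^sup>+x. ennreal (\<psi> x) \<partial>\<nu>)"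
      using gauss_smoothing_limit[OF fin(2) s(2) c b] by simp
  qed
  have closed: "emeasure \<mu> C = emeasure \<nu> C" if C: "closed C" for C
  proof (cases "C = {}")
    \<comment> \<open>The empty set is separated because \<open>infdist\<close> to it is zero by
      convention, so the functions below would not converge to its indicator.\<close>
    case False
    define \<psi> where "\<psi> k x = max 0 (1 - real k * infdist x C)" for k and x :: "real^'n"
    have c: "continuous_on UNIV (\<psi> k)" for k unfolding \<psi>_def by (intro continuous_intros)
    have b: "0 \<le> \<psi> k x \<and> \<psi> k x \<le> 1" for k x unfolding \<psi>_def using infdist_nonneg[of x C] by auto
    have [measurable]: "\<psi> k \<in> borel_measurable borel" for k using c by (rule borel_measurable_continuous_onI)
    have [measurable]: "C \<in> sets borel" using C by (rule borel_closed)
    have lim: "(\<lambda>k. ennreal (\<psi> k x)) \<longlonglongrightarrow> indicator C x" for x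
    proof (cases "x \<in> C")
      case True
      then show ?thesis by (simp add: \<psi>_def)
    next
      case x: False
      have d: "0 < infdist x C" using infdist_pos_not_in_closed[OF C False x] .
      obtain N where N: "1 < real N * infdist x C" using ex_less_of_nat_mult[OF d] by blast
      have "\<psi> k x = 0" if "N \<le> k" for k
      proof -
        have "real N * infdist x C \<le> real k * infdist x C" using that d by (intro mult_right_mono) auto
        then show ?thesis using N by (simp add: \<psi>_def)
      qed
      then have "\<forall>\<^sub>F k in sequentially. ennreal (\<psi> k x) = indicator C x"
        using x by (intro eventually_sequentiallyI[of N]) simp
      then show ?thesis by (rule tendsto_eventually)
    qed
    have "(\<lambda>k. \<integral>\<^sup>+x. ennreal (\<psi> k x) \<partial>M) \<longlonglongrightarrow> emeasure M C"
      if f: "finite_measure M" and [measurable_cong]: "sets M = sets borel" for M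
    proof -
      have C': "C \<in> sets M" using that by simp
      have "(\<lambda>k. \<integral>\<^sup>+x. ennreal (\<psi> k x) \<partial>M) \<longlonglongrightarrow> (\<integral>\<^sup>+x. indicator C x \<partial>M)"
      proof (rule nn_integral_dominated_convergence[where w="\<lambda>_. 1"])
        show "(\<integral>\<^sup>+x. 1 \<partial>M) < \<infinity>"
          using finite_measure.emeasure_finite[OF f, of "space M"] by (simp add: less_top[symmetric])
      qed (use lim b in \<open>auto simp: ennreal_le_1\<close>)
      then show ?thesis using C' by simp
    qed
    from this[OF fin(1) s(1)] this[OF fin(2) s(2)] show ?thesis
      using int[OF c b] LIMSEQ_unique by auto
  qed simp
  show ?thesis
  proof (rule measure_eqI_generator_eq[where E="Collect closed" and \<Omega>=UNIV and A="\<lambda>_. UNIV"])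
    show "sets \<mu> = sigma_sets UNIV (Collect closed)" "sets \<nu> = sigma_sets UNIV (Collect closed)"
      unfolding s borel_eq_closed by auto
    show "emeasure \<mu> UNIV \<noteq> \<infinity>" using finite_measure.emeasure_finite[OF fin(1)] by simp
  qed (auto simp: Int_stable_def closed closed_Int)
qed

lemma talagrand_gauss:
  fixes f :: "real^'n \<Rightarrow> real"
  assumes c: "continuous_on UNIV f" and pos: "\<And>x. 0 < f x"
    and bound: "\<And>x. f x \<le> C * exp ((norm x)\<^sup>2 / 6)" and total: "(\<integral>\<^sup>+x. ennreal (f x) \<partial>gauss) = 1"
  shows "\<exists>T\<in>borel_measurable borel. distr gauss borel T = density gauss (\<lambda>x. ennreal (f x)) \<and>
    (\<integral>\<^sup>+x. ennreal ((norm (T x - x))\<^sup>2) \<partial>gauss) \<le> (\<integral>\<^sup>+x. ennreal (2 * ent (f x)) \<partial>gauss)"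
proof -
  have [measurable]: "f \<in> borel_measurable borel" using c by (rule borel_measurable_continuous_onI)
  define f' where "f' y = f (vec_lambda y)" for y
  have [measurable]: "f' \<in> borel_measurable borel_fun" unfolding f'_def by measurable
  have C: "0 \<le> C" using bound[of 0] pos[of 0] by simp
  have "tame_density UNIV f'"
    unfolding tame_density_def
  proof (intro conjI allI ballI)
    fix x :: "'n \<Rightarrow> real" and j :: 'n
    have "continuous_on UNIV (\<lambda>t. \<chi> i. (x(j := t)) i)"
    proof (rule continuous_on_vec_lambda)
      fix i show "continuous_on UNIV (\<lambda>t. (x(j := t)) i)"
        by (cases "i = j") auto
    qed
    then show "continuous_on UNIV (\<lambda>t. f' (x(j := t)))"
      unfolding f'_def by (intro continuous_on_compose2[OF c]) (auto simp del: fun_upd_apply)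
  next
    fix x
    have "f' y \<le> C * exp (\<Sum>j\<in>UNIV. (y j)\<^sup>2 / 6)" for y
      using bound[of "vec_lambda y"] by (simp add: f'_def norm_vec_sq sum_divide_distrib)
    then show "\<exists>c\<ge>0. \<forall>y. agree UNIV x y \<longrightarrow> f' y \<le> c * exp (\<Sum>j\<in>UNIV. (y j)\<^sup>2 / 6)"
      using C by blast
  qed (auto simp: f'_def pos)
  moreover have "(\<integral>\<^sup>+y. ennreal (f' y) \<partial>\<Gamma>) = 1"
    using total by (simp add: nn_integral_gauss f'_def)
  ultimately obtain T where [measurable]: "T \<in> measurable borel_fun borel_fun"
    and T: "\<And>h. h\<in>borel_measurable borel_fun \<Longrightarrow> (\<integral>\<^sup>+y. h (T y) \<partial>\<Gamma>) = (\<integral>\<^sup>+y. h y * ennreal (f' y) \<partial>\<Gamma>)"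
    "(\<integral>\<^sup>+y. ennreal (\<Sum>j\<in>UNIV. (T y j - y j)\<^sup>2) \<partial>\<Gamma>) \<le> (\<integral>\<^sup>+y. ennreal (2 * ent (f' y)) \<partial>\<Gamma>)"
    using talagrand_PiM[of f'] unfolding Bex_def by blast
  define S where "S x = (vec_lambda (T (vec_nth x)) :: real^'n)" for x
  have [measurable]: "S \<in> borel_measurable borel" unfolding S_def by measurable
  show ?thesis
  proof (intro bexI[of _ S] conjI)
    show "distr gauss borel S = density gauss (\<lambda>x. ennreal (f x))"
    proof (rule measure_eqI)
      fix A assume "A \<in> sets (distr gauss borel S)"
      then have [measurable]: "A \<in> sets borel" by simp
      have "emeasure (distr gauss borel S) A = (\<integral>\<^sup>+x. indicator A (S x) \<partial>gauss)"
        by (simp add: nn_integral_indicator[symmetric] nn_integral_distr del: nn_integral_indicator)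
      also have "\<dots> = (\<integral>\<^sup>+y. indicator A (vec_lambda (T y) :: real^'n) \<partial>\<Gamma>)"
        by (subst nn_integral_gauss) (auto simp: S_def vec_lambda_inverse)
      also have "\<dots> = (\<integral>\<^sup>+y. indicator A (vec_lambda y :: real^'n) * ennreal (f' y) \<partial>\<Gamma>)"
        by (rule T(1)) measurable
      also have "\<dots> = (\<integral>\<^sup>+x. ennreal (f x) * indicator A x \<partial>gauss)"
        by (subst nn_integral_gauss) (auto simp: f'_def mult.commute)
      also have "\<dots> = emeasure (density gauss (\<lambda>x. ennreal (f x))) A"
        by (subst emeasure_density) auto
      finally show "emeasure (distr gauss borel S) A = emeasure (density gauss (\<lambda>x. ennreal (f x))) A" .
    qed simp
    have "(\<integral>\<^sup>+x. ennreal ((norm (S x - x))\<^sup>2) \<partial>gauss) = (\<integral>\<^sup>+y. ennreal (\<Sum>j\<in>UNIV. (T y j - y j)\<^sup>2) \<partial>\<Gamma>)"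
      by (subst nn_integral_gauss) (auto simp: norm_vec_sq S_def vec_lambda_inverse)
    also have "\<dots> \<le> (\<integral>\<^sup>+y. ennreal (2 * ent (f' y)) \<partial>\<Gamma>)" by (rule T(2))
    also have "\<dots> = (\<integral>\<^sup>+x. ennreal (2 * ent (f x)) \<partial>gauss)"
      by (subst nn_integral_gauss) (auto simp: f'_def)
    finally show "(\<integral>\<^sup>+x. ennreal ((norm (S x - x))\<^sup>2) \<partial>gauss) \<le> (\<integral>\<^sup>+x. ennreal (2 * ent (f x)) \<partial>gauss)" .
  qed measurable
qed

subsection \<open>Relative densities of centered Gaussian laws\<close>

lemma has_bochner_integral_gamma1:
  fixes f :: "real \<Rightarrow> 'b::{banach, second_countable_topology}"
  assumes "f \<in> borel_measurable borel"
  shows "has_bochner_integral \<gamma>1 f v \<longleftrightarrow> has_bochner_integral lborel (\<lambda>x. \<phi> x *\<^sub>R f x) v"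
  using assms by (simp add: has_bochner_integral_iff integrable_density integral_density)

text \<open>For d > -1, the density of the centered Gaussian law of variance 1 + d relative to the
  standard one.\<close>

definition rel_density1 :: "real \<Rightarrow> real \<Rightarrow> real" where
  "rel_density1 d t = exp (d / (1 + d) * t\<^sup>2 / 2) / sqrt (1 + d)"

lemma rel_density1_measurable [measurable]: "rel_density1 d \<in> borel_measurable borel"
  unfolding rel_density1_def by measurable

lemma rel_density1_phi:
  assumes "-1 < d" shows "\<phi> t * rel_density1 d t = normal_density 0 (sqrt (1 + d)) t"
proof -
  let ?a = "d / (1 + d) / 2"
  have 1: "1 - 2 * ?a = 1 / (1 + d)" using assms by (simp add: field_simps)
  have a: "?a < 1/2" using assms by (simp add: field_simps)
  have "1 / sqrt (1 - 2 * ?a) = sqrt (1 + d)"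
    unfolding 1 using assms by (simp add: real_sqrt_divide)
  then have "exp (?a * t\<^sup>2) * \<phi> t = sqrt (1 + d) * normal_density 0 (sqrt (1 + d)) t"
    using exp_phi[OF a, of t] by simp
  moreover have "\<phi> t * rel_density1 d t = exp (?a * t\<^sup>2) * \<phi> t / sqrt (1 + d)" by (simp add: rel_density1_def)
  ultimately show ?thesis using assms by simp
qed

text \<open>Squaring doubles the exponent, and completing the square leaves variance (1 + d) / (1 -
  d). This is where d < 1 enters.\<close>

lemma rel_density1_sq_phi:
  assumes "-1 < d" "d < 1"
  shows "\<phi> t * (rel_density1 d t)\<^sup>2 = 1 / sqrt (1 - d\<^sup>2) * normal_density 0 (sqrt ((1 + d) / (1 - d))) t"
proof -
  let ?a = "d / (1 + d)"
  have 1: "1 - 2 * ?a = (1 - d) / (1 + d)" using assms by (simp add: field_simps)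
  have a: "?a < 1/2" using assms by (simp add: field_simps)
  have e: "1 / sqrt (1 - 2 * ?a) = sqrt ((1 + d) / (1 - d))"
    unfolding 1 using assms by (simp add: real_sqrt_divide)
  have "(rel_density1 d t)\<^sup>2 = exp (?a * t\<^sup>2) / (1 + d)"
    unfolding rel_density1_def power_divide using assms by (simp add: exp_double[symmetric] del: times_divide_eq_left)
  then have "\<phi> t * (rel_density1 d t)\<^sup>2 = exp (?a * t\<^sup>2) * \<phi> t / (1 + d)" by simp
  also have "\<dots> = sqrt ((1 + d) / (1 - d)) / (1 + d) * normal_density 0 (sqrt ((1 + d) / (1 - d))) t"
    unfolding exp_phi[OF a] e by simp
  also have "sqrt ((1 + d) / (1 - d)) / (1 + d) = 1 / sqrt (1 - d\<^sup>2)"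
  proof -
    have s: "1 - d\<^sup>2 = (1 + d) * (1 - d)" by (simp add: power2_eq_square algebra_simps)
    have "sqrt (1 + d) / (1 + d) = 1 / sqrt (1 + d)"
      using assms real_div_sqrt[of "1 + d"] by (simp add: field_simps)
    then have "sqrt (1 + d) / (1 + d) / sqrt (1 - d) = 1 / sqrt (1 + d) / sqrt (1 - d)" by simp
    then show ?thesis unfolding s real_sqrt_mult real_sqrt_divide by (simp add: mult.commute)
  qed
  finally show ?thesis .
qed

lemma has_bochner_rel_density1:
  assumes "-1 < d"
  shows "has_bochner_integral \<gamma>1 (rel_density1 d) 1"
    "has_bochner_integral \<gamma>1 (\<lambda>t. rel_density1 d t * t\<^sup>2) (1 + d)"
    "has_bochner_integral \<gamma>1 (\<lambda>t. iex (a * t) * of_real (rel_density1 d t)) (of_real (exp (- (1 + d) * a\<^sup>2 / 2)))"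
proof -
  let ?s = "sqrt (1 + d)"
  have s: "0 < ?s" using assms by simp
  show "has_bochner_integral \<gamma>1 (rel_density1 d) 1"
    unfolding has_bochner_integral_gamma1[OF rel_density1_measurable] real_scaleR_def rel_density1_phi[OF assms]
    using s by (simp add: has_bochner_integral_iff)
  have "has_bochner_integral lborel (\<lambda>t. normal_density 0 ?s t * t\<^sup>2) (1 + d)"
    using normal_moment_even[of ?s 0 1] assms by (simp add: add_divide_distrib)
  then show "has_bochner_integral \<gamma>1 (\<lambda>t. rel_density1 d t * t\<^sup>2) (1 + d)"
    by (subst has_bochner_integral_gamma1)
      (auto simp: mult.assoc[symmetric] rel_density1_phi[OF assms] simp del: rel_density1_def)
  have i: "integrable lborel (\<lambda>t. normal_density 0 ?s t *\<^sub>R iex (a * t))"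
    by (rule Bochner_Integration.integrable_bound[OF integrable_normal_density[OF s]]) auto
  have "(\<integral>t. normal_density 0 ?s t *\<^sub>R iex (a * t) \<partial>lborel) = ?s *\<^sub>R (\<integral>t. normal_density 0 ?s (0 + ?s * t) *\<^sub>R iex (a * (0 + ?s * t)) \<partial>lborel)"
    using s by (subst lborel_integral_real_affine[of ?s _ 0]) auto
  also have "\<dots> = (\<integral>t. ?s *\<^sub>R (normal_density 0 ?s (0 + ?s * t) *\<^sub>R iex (a * (0 + ?s * t))) \<partial>lborel)"
    by (rule integral_scaleR_right[symmetric])
  also have "\<dots> = (\<integral>t. \<phi> t *\<^sub>R iex ((a * ?s) * t) \<partial>lborel)"
  proof (intro Bochner_Integration.integral_cong refl)
    fix t
    have "?s * normal_density 0 ?s (0 + ?s * t) = \<phi> t"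
    proof -
      have n: "normal_density 0 ?s (?s * t) = exp (- (?s * t)\<^sup>2 / (2 * ?s\<^sup>2)) / (sqrt (2 * pi) * ?s)"
        using assms by (simp add: normal_density_def real_sqrt_mult)
      have "(?s * t)\<^sup>2 / (2 * ?s\<^sup>2) = t\<^sup>2 / 2"
        unfolding power_mult_distrib using s by (intro nonzero_mult_divide_mult_cancel_left2) simp
      then have "normal_density 0 ?s (?s * t) = exp (- (t\<^sup>2 / 2)) / (sqrt (2 * pi) * ?s)"
        unfolding n minus_divide_left[symmetric] by (simp only:)
      then show ?thesis using s by (simp add: std_normal_density_def)
    qed
    then show "?s *\<^sub>R (normal_density 0 ?s (0 + ?s * t) *\<^sub>R iex (a * (0 + ?s * t))) = \<phi> t *\<^sub>R iex ((a * ?s) * t)"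
      by (simp add: mult_ac)
  qed
  also have "\<dots> = char std_normal_distribution (a * ?s)"
    unfolding char_def by (subst integral_density) auto
  also have "\<dots> = of_real (exp (- (1 + d) * a\<^sup>2 / 2))"
    unfolding char_std_normal_distribution using assms by (simp add: power_mult_distrib mult.commute) (simp add: algebra_simps)
  finally have v: "(\<integral>t. normal_density 0 ?s t *\<^sub>R iex (a * t) \<partial>lborel) = of_real (exp (- (1 + d) * a\<^sup>2 / 2))" .
  have e: "\<phi> t *\<^sub>R (iex (a * t) * of_real (rel_density1 d t)) = normal_density 0 ?s t *\<^sub>R iex (a * t)" for t
    unfolding rel_density1_phi[OF assms, symmetric] by (simp add: scaleR_conv_of_real mult_ac)
  show "has_bochner_integral \<gamma>1 (\<lambda>t. iex (a * t) * of_real (rel_density1 d t)) (of_real (exp (- (1 + d) * a\<^sup>2 / 2)))"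
    by (subst has_bochner_integral_gamma1, measurable) (simp only: e has_bochner_integral_iff i v)
qed

lemma has_bochner_rel_density1_sq:
  assumes "-1 < d" "d < 1"
  shows "has_bochner_integral \<gamma>1 (\<lambda>t. (rel_density1 d t)\<^sup>2) (1 / sqrt (1 - d\<^sup>2))"
proof -
  have "0 < sqrt ((1 + d) / (1 - d))" using assms by simp
  then show ?thesis
    by (subst has_bochner_integral_gamma1, measurable)
      (simp add: rel_density1_sq_phi[OF assms] has_bochner_integral_iff del: real_sqrt_divide)
qed

text \<open>The polynomial t^2 - 1 is the second Hermite polynomial, of mean 0 and variance 3 - 2 +
  1.\<close>

lemma has_bochner_gamma1_moments:
  "has_bochner_integral \<gamma>1 (\<lambda>t. t\<^sup>2 - 1) 0"
  "has_bochner_integral \<gamma>1 (\<lambda>t. (t\<^sup>2 - 1)\<^sup>2) 2"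
  "has_bochner_integral \<gamma>1 (\<lambda>t. 1::real) 1"
proof -
  have 2: "has_bochner_integral \<gamma>1 (\<lambda>t. t\<^sup>2) 1"
    using std_normal_moment_even[of 1] by (subst has_bochner_integral_gamma1) auto
  have 4: "has_bochner_integral \<gamma>1 (\<lambda>t. t^4) 3"
    using std_normal_moment_even[of 2] by (subst has_bochner_integral_gamma1) (auto simp: fact_numeral)
  show 0: "has_bochner_integral \<gamma>1 (\<lambda>t. 1::real) 1"
    using std_normal_moment_even[of 0] by (subst has_bochner_integral_gamma1) auto
  show "has_bochner_integral \<gamma>1 (\<lambda>t. t\<^sup>2 - 1) 0"
    using has_bochner_integral_diff[OF 2 0] by simp
  have "has_bochner_integral \<gamma>1 (\<lambda>t. t^4 - 2 * t\<^sup>2 + 1) (3 - 2 * 1 + 1)"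
    by (intro has_bochner_integral_add has_bochner_integral_diff has_bochner_integral_mult_right 0 2 4)
  moreover have "(t\<^sup>2 - 1)\<^sup>2 = t^4 - 2 * t\<^sup>2 + 1" for t :: real
    by (simp add: power2_eq_square power4_eq_xxxx algebra_simps)
  ultimately show "has_bochner_integral \<gamma>1 (\<lambda>t. (t\<^sup>2 - 1)\<^sup>2) 2" by simp
qed

lemma has_bochner_gauss_prod:
  fixes f :: "'n::finite \<Rightarrow> real \<Rightarrow> 'b::{real_normed_field,banach,second_countable_topology}"
  assumes "\<And>i. has_bochner_integral \<gamma>1 (f i) (v i)"
  shows "has_bochner_integral gauss (\<lambda>x::real^'n. \<Prod>i\<in>UNIV. f i (x $ i)) (\<Prod>i\<in>UNIV. v i)"
proof -
  have i: "integrable \<gamma>1 (f i)" "integral\<^sup>L \<gamma>1 (f i) = v i" for i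
    using assms[of i] by (auto simp: has_bochner_integral_iff)
  show ?thesis using gauss_prod[of f] i by (simp add: has_bochner_integral_iff)
qed

lemma sqrt_prod: "sqrt (\<Prod>i\<in>I. f i) = (\<Prod>i\<in>I. sqrt (f i))"
  by (induction I rule: infinite_finite_induct) (auto simp: real_sqrt_mult)

lemma prod_single:
  fixes c :: "'b::comm_monoid_mult" and j :: "'n::finite"
  shows "(\<Prod>i\<in>UNIV. if i = j then c else 1) = c"
  by (simp add: prod.delta)

section \<open>Diagonal covariance: product densities and their expansion\<close>

definition rel_density_diag :: "('n::finite \<Rightarrow> real) \<Rightarrow> real^'n \<Rightarrow> real" where
  "rel_density_diag d y = (\<Prod>i\<in>UNIV. rel_density1 (d i) (y $ i))"

definition first_order_diag :: "('n::finite \<Rightarrow> real) \<Rightarrow> real^'n \<Rightarrow> real" where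
  "first_order_diag d y = (\<Sum>i\<in>UNIV. d i / 2 * ((y $ i)\<^sup>2 - 1))"

text \<open>Hermite polynomials in different coordinates are orthogonal, so only the terms d_j^2 /
  4, each times the variance 2, survive.\<close>

lemma has_bochner_first_order_diag_sq:
  fixes d :: "'n::finite \<Rightarrow> real"
  shows "has_bochner_integral gauss (\<lambda>y. (first_order_diag d y)\<^sup>2) ((\<Sum>i\<in>UNIV. (d i)\<^sup>2) / 2)"
proof -
  have 1: "has_bochner_integral gauss (\<lambda>y. ((y $ j)\<^sup>2 - 1) * ((y $ k)\<^sup>2 - 1)) (if j = k then 2 else 0)"
    for j k :: 'n
  proof (cases "j = k")
    case True
    have "has_bochner_integral gauss (\<lambda>y::real^'n. \<Prod>i\<in>UNIV. if i = j then ((y $ i)\<^sup>2 - 1)\<^sup>2 else 1) (\<Prod>i\<in>UNIV. if i = j then 2 else 1)"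
      by (rule has_bochner_gauss_prod[of "\<lambda>i t. if i = j then (t\<^sup>2 - 1)\<^sup>2 else 1"]) (auto simp: has_bochner_gamma1_moments)
    moreover have "(\<Prod>i\<in>UNIV. if i = j then ((y $ i)\<^sup>2 - 1)\<^sup>2 else 1) = ((y $ j)\<^sup>2 - 1)\<^sup>2" for y :: "real^'n"
      by (simp add: prod.delta cong: if_cong)
    ultimately show ?thesis using True by (simp add: power2_eq_square[of "_ - 1"] prod_single)
  next
    case False
    have "has_bochner_integral gauss (\<lambda>y::real^'n. \<Prod>i\<in>UNIV. if i = j \<or> i = k then (y $ i)\<^sup>2 - 1 else 1) (\<Prod>i\<in>UNIV. if i = j \<or> i = k then 0 else 1)"
      by (rule has_bochner_gauss_prod[of "\<lambda>i t. if i = j \<or> i = k then t\<^sup>2 - 1 else 1"]) (auto simp: has_bochner_gamma1_moments)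
    moreover have "(\<Prod>i\<in>UNIV. if i = j \<or> i = k then (y $ i)\<^sup>2 - 1 else 1) = ((y $ j)\<^sup>2 - 1) * ((y $ k)\<^sup>2 - 1)" for y :: "real^'n"
    proof -
      have "(\<Prod>i\<in>UNIV. if i = j \<or> i = k then (y $ i)\<^sup>2 - 1 else 1) = (\<Prod>i\<in>{j,k}. (y $ i)\<^sup>2 - 1)"
        by (rule prod.mono_neutral_cong_right) auto
      then show ?thesis using False by simp
    qed
    moreover have "(\<Prod>i\<in>UNIV. if i = j \<or> i = k then 0 else (1::real)) = 0" by (rule prod_zero) auto
    ultimately show ?thesis using False by simp
  qed
  have "has_bochner_integral gauss (\<lambda>y. \<Sum>j\<in>UNIV. \<Sum>k\<in>UNIV. (d j * d k / 4) * (((y $ j)\<^sup>2 - 1) * ((y $ k)\<^sup>2 - 1)))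
      (\<Sum>j\<in>UNIV. \<Sum>k\<in>UNIV. (d j * d k / 4) * (if j = k then 2 else 0))"
    by (intro has_bochner_integral_sum has_bochner_integral_mult_right 1)
  moreover have "(\<Sum>j\<in>UNIV. \<Sum>k\<in>UNIV. (d j * d k / 4) * (((y $ j)\<^sup>2 - 1) * ((y $ k)\<^sup>2 - 1))) = (first_order_diag d y)\<^sup>2" for y
    unfolding first_order_diag_def power2_eq_square[of "sum _ _"] sum_product
    by (intro sum.cong refl) (simp add: field_simps)
  moreover have "(\<Sum>j\<in>UNIV. \<Sum>k\<in>UNIV. (d j * d k / 4) * (if j = k then 2 else 0)) = (\<Sum>i\<in>UNIV. (d i)\<^sup>2) / 2"
    by (simp add: if_distrib[of "\<lambda>x. _ * x"] sum.delta' power2_eq_square sum_divide_distrib cong: if_cong)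
  ultimately show ?thesis by (simp only:)
qed

lemma has_bochner_first_order_diag:
  fixes d :: "'n::finite \<Rightarrow> real"
  shows "has_bochner_integral gauss (first_order_diag d) 0"
proof -
  have 1: "has_bochner_integral gauss (\<lambda>y. (y $ j)\<^sup>2 - 1) 0" for j :: 'n
  proof -
    have "has_bochner_integral gauss (\<lambda>y::real^'n. \<Prod>i\<in>UNIV. if i = j then (y $ i)\<^sup>2 - 1 else 1) (\<Prod>i\<in>UNIV. if i = j then 0 else 1)"
      by (rule has_bochner_gauss_prod[of "\<lambda>i t. if i = j then t\<^sup>2 - 1 else 1"]) (auto simp: has_bochner_gamma1_moments)
    then show ?thesis by (simp add: prod.delta cong: if_cong)
  qed
  have "has_bochner_integral gauss (\<lambda>y. \<Sum>i\<in>UNIV. d i / 2 * ((y $ i)\<^sup>2 - 1)) (\<Sum>i\<in>UNIV. d i / 2 * 0)"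
    by (intro has_bochner_integral_sum has_bochner_integral_mult_right 1)
  then show ?thesis by (simp add: first_order_diag_def[abs_def])
qed

context
  fixes d :: "'n::finite \<Rightarrow> real"
  assumes d: "\<And>i. \<bar>d i\<bar> \<le> 1/2"
begin

lemma d_bounds: "-1 < d i" "d i < 1" "1/2 \<le> 1 + d i"
  using d[of i] by auto

lemma has_bochner_rel_density_diag: "has_bochner_integral gauss (rel_density_diag d) 1"
  using has_bochner_gauss_prod[of "\<lambda>i. rel_density1 (d i)" "\<lambda>_. 1"] has_bochner_rel_density1(1)[OF d_bounds(1)]
  by (simp add: rel_density_diag_def[abs_def])

lemma has_bochner_rel_density_diag_sq: "has_bochner_integral gauss (\<lambda>y. (rel_density_diag d y)\<^sup>2) (\<Prod>i\<in>UNIV. 1 / sqrt (1 - (d i)\<^sup>2))"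
  using has_bochner_gauss_prod[of "\<lambda>i t. (rel_density1 (d i) t)\<^sup>2", OF has_bochner_rel_density1_sq[OF d_bounds(1,2)]]
  by (simp add: rel_density_diag_def prod_power_distrib)

text \<open>Integrating against the relative density means taking expectations under variances 1 +
  d_i; each coordinate then gives d_i / 2 times (1 + d_i) - 1.\<close>

lemma has_bochner_rel_density_diag_first_order_diag: "has_bochner_integral gauss (\<lambda>y. rel_density_diag d y * first_order_diag d y) ((\<Sum>i\<in>UNIV. (d i)\<^sup>2) / 2)"
proof -
  have 1: "has_bochner_integral gauss (\<lambda>y. rel_density_diag d y * (y $ j)\<^sup>2) (1 + d j)" for j
  proof -
    have "has_bochner_integral gauss (\<lambda>y. \<Prod>i\<in>UNIV. rel_density1 (d i) (y $ i) * (if i = j then (y $ i)\<^sup>2 else 1)) (\<Prod>i\<in>UNIV. if i = j then 1 + d i else 1)"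
    proof (rule has_bochner_gauss_prod[of "\<lambda>i t. rel_density1 (d i) t * (if i = j then t\<^sup>2 else 1)"])
      fix i show "has_bochner_integral \<gamma>1 (\<lambda>t. rel_density1 (d i) t * (if i = j then t\<^sup>2 else 1)) (if i = j then 1 + d i else 1)"
        using has_bochner_rel_density1[OF d_bounds(1)[of i]] by (cases "i = j") auto
    qed
    then show ?thesis by (simp add: rel_density_diag_def prod.distrib prod.delta cong: if_cong)
  qed
  have "has_bochner_integral gauss (\<lambda>y. \<Sum>i\<in>UNIV. d i / 2 * (rel_density_diag d y * (y $ i)\<^sup>2 - rel_density_diag d y)) (\<Sum>i\<in>UNIV. d i / 2 * ((1 + d i) - 1))"
    by (intro has_bochner_integral_sum has_bochner_integral_mult_right has_bochner_integral_diff 1 has_bochner_rel_density_diag)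
  then show ?thesis by (simp add: first_order_diag_def sum_distrib_left sum_divide_distrib algebra_simps power2_eq_square)
qed

lemma has_bochner_rel_density_diag_iex:
  "has_bochner_integral gauss (\<lambda>y. iex (w \<bullet> y) * of_real (rel_density_diag d y)) (of_real (exp (- (\<Sum>i\<in>UNIV. (1 + d i) * (w $ i)\<^sup>2) / 2)))"
proof -
  have "has_bochner_integral gauss (\<lambda>y. \<Prod>i\<in>UNIV. iex (w $ i * y $ i) * of_real (rel_density1 (d i) (y $ i)))
      (\<Prod>i\<in>UNIV. of_real (exp (- (1 + d i) * (w $ i)\<^sup>2 / 2)))"
    by (rule has_bochner_gauss_prod[of "\<lambda>i t. iex (w $ i * t) * of_real (rel_density1 (d i) t)"]) (rule has_bochner_rel_density1(3)[OF d_bounds(1)])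
  moreover have "(\<Prod>i\<in>UNIV. iex (w $ i * y $ i) * of_real (rel_density1 (d i) (y $ i))) = iex (w \<bullet> y) * of_real (rel_density_diag d y)" for y
    by (simp add: prod.distrib inner_vec_eq iex_sum rel_density_diag_def del: of_real_sum)
  moreover have "(\<Prod>i\<in>UNIV. complex_of_real (exp (- (1 + d i) * (w $ i)\<^sup>2 / 2))) = of_real (exp (- (\<Sum>i\<in>UNIV. (1 + d i) * (w $ i)\<^sup>2) / 2))"
    by (simp only: of_real_prod[symmetric] exp_sum[OF finite, symmetric])
      (simp add: sum_divide_distrib sum_negf[symmetric] algebra_simps add_divide_distrib diff_divide_distrib)
  ultimately show ?thesis by simp
qed

lemma rel_density_diag_pos: "0 < rel_density_diag d y"
  unfolding rel_density_diag_def rel_density1_def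
proof (intro prod_pos divide_pos_pos exp_gt_zero)
  fix i show "0 < sqrt (1 + d i)" using d_bounds(1)[of i] by simp
qed

text \<open>For d \<le> 1/2 the factor d / (1 + d) is at most 1/3, which is the origin of the 6 in
  the growth class, and 1 + d \<ge> 1/2 keeps each normalising factor below 2.\<close>

lemma rel_density_diag_bound: "rel_density_diag d y \<le> 2 ^ CARD('n) * exp ((norm y)\<^sup>2 / 6)"
proof -
  have "rel_density_diag d y \<le> (\<Prod>i\<in>UNIV. 2 * exp ((y $ i)\<^sup>2 / 6))"
    unfolding rel_density_diag_def
  proof (rule prod_mono, intro conjI)
    fix i
    have p: "0 < 1 + d i" "1/2 \<le> 1 + d i" using d_bounds[of i] by auto
    then show "0 \<le> rel_density1 (d i) (y $ i)" by (simp add: rel_density1_def)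
    have "d i / (1 + d i) \<le> 1 / 3" using d[of i] p by (simp add: field_simps)
    then have "d i / (1 + d i) * ((y $ i)\<^sup>2 / 2) \<le> 1 / 3 * ((y $ i)\<^sup>2 / 2)" by (intro mult_right_mono) auto
    then have "exp (d i / (1 + d i) * (y $ i)\<^sup>2 / 2) \<le> exp ((y $ i)\<^sup>2 / 6)" by simp
    moreover have "1 / 2 \<le> sqrt (1 + d i)"
      by (rule real_le_rsqrt) (use p in \<open>simp add: power2_eq_square\<close>)
    ultimately have "rel_density1 (d i) (y $ i) \<le> exp ((y $ i)\<^sup>2 / 6) / (1 / 2)"
      unfolding rel_density1_def by (intro frac_le) auto
    then show "rel_density1 (d i) (y $ i) \<le> 2 * exp ((y $ i)\<^sup>2 / 6)" by simp
  qed
  also have "\<dots> = 2 ^ CARD('n) * exp ((norm y)\<^sup>2 / 6)"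
    by (simp add: prod.distrib exp_sum[symmetric] norm_vec_sq sum_divide_distrib)
  finally show ?thesis .
qed

text \<open>Write u for the sum of the squared eigenvalues. Expanding the square and inserting the
  moments gives p - 1 - u/2, where p is the second moment of the density. Weierstrass' product
  inequality gives p \<le> 1 / sqrt (1 - u), whose first-order expansion cancels 1 + u/2.\<close>

lemma has_bochner_remainder_diag:
  assumes u: "(\<Sum>i\<in>UNIV. (d i)\<^sup>2) \<le> 1/4"
  shows "integrable gauss (\<lambda>y. (rel_density_diag d y - 1 - first_order_diag d y)\<^sup>2)"
    "(\<integral>y. (rel_density_diag d y - 1 - first_order_diag d y)\<^sup>2 \<partial>gauss) \<le> (\<Sum>i\<in>UNIV. (d i)\<^sup>2)\<^sup>2 / 2"
proof -
  define u where "u = (\<Sum>i\<in>UNIV. (d i)\<^sup>2)"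
  define p where "p = (\<Prod>i\<in>UNIV. 1 / sqrt (1 - (d i)\<^sup>2))"
  have u4: "u \<le> 1/4" "0 \<le> u" using u by (auto simp: u_def intro!: sum_nonneg)
  have one: "has_bochner_integral gauss (\<lambda>y::real^'n. 1) (1::real)"
    using has_bochner_gauss_prod[of "\<lambda>(i::'n) t. 1::real" "\<lambda>_. 1"] has_bochner_gamma1_moments(3) by simp
  have h: "has_bochner_integral gauss (\<lambda>y. ((rel_density_diag d y)\<^sup>2 - 2 * rel_density_diag d y - 2 * (rel_density_diag d y * first_order_diag d y)) + (1 + 2 * first_order_diag d y + (first_order_diag d y)\<^sup>2))
     ((p - 2 * 1 - 2 * (u / 2)) + (1 + 2 * 0 + u / 2))"
    unfolding p_def u_def
    by (intro has_bochner_integral_add has_bochner_integral_diff has_bochner_integral_mult_right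
      has_bochner_rel_density_diag has_bochner_rel_density_diag_sq has_bochner_rel_density_diag_first_order_diag has_bochner_first_order_diag has_bochner_first_order_diag_sq one)
  have "(rel_density_diag d y - 1 - first_order_diag d y)\<^sup>2 = ((rel_density_diag d y)\<^sup>2 - 2 * rel_density_diag d y - 2 * (rel_density_diag d y * first_order_diag d y)) + (1 + 2 * first_order_diag d y + (first_order_diag d y)\<^sup>2)" for y
    by (simp add: power2_eq_square algebra_simps)
  then have h: "has_bochner_integral gauss (\<lambda>y. (rel_density_diag d y - 1 - first_order_diag d y)\<^sup>2) (p - 1 - u / 2)"
    using h by (simp only:) (simp add: algebra_simps)
  then show "integrable gauss (\<lambda>y. (rel_density_diag d y - 1 - first_order_diag d y)\<^sup>2)" by (simp add: has_bochner_integral_iff)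
  have "1 - u \<le> (\<Prod>i\<in>UNIV. 1 - (d i)\<^sup>2)"
    unfolding u_def
  proof (rule Weierstrass_prod_ineq)
    fix i
    have "(d i)\<^sup>2 \<le> (1/2)\<^sup>2" using d[of i] by (intro power2_le_iff_abs_le[THEN iffD2]) auto
    then show "(d i)\<^sup>2 \<in> {0..1}" by (simp add: power2_eq_square)
  qed
  then have "sqrt (1 - u) \<le> sqrt (\<Prod>i\<in>UNIV. 1 - (d i)\<^sup>2)" by simp
  also have "\<dots> = (\<Prod>i\<in>UNIV. sqrt (1 - (d i)\<^sup>2))" by (rule sqrt_prod)
  finally have "p \<le> 1 / sqrt (1 - u)"
    unfolding p_def prod_dividef using u4 by (simp add: frac_le)
  also have "\<dots> \<le> 1 + u / 2 + u\<^sup>2 / 2"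
  proof -
    have "1 \<le> (1 - u) * (1 + u / 2 + u\<^sup>2 / 2)\<^sup>2"
    proof -
      \<comment> \<open>Squaring reduces the bound on 1 / sqrt (1 - u) to this factorization, whose
        second factor is positive for u \<le> 1/4.\<close>
      have "(1 - u) * (1 + u / 2 + u\<^sup>2 / 2)\<^sup>2 - 1 = u\<^sup>2 / 4 * (1 - 3 * u - u\<^sup>2 - u * u\<^sup>2)"
        by (simp add: power2_eq_square field_simps)
      moreover have "u\<^sup>2 \<le> 1/16" using u4 power_mono[of u "1/4" 2] by (simp add: power2_eq_square)
      moreover have "u * u\<^sup>2 \<le> 1 * (1/16)" using u4 \<open>u\<^sup>2 \<le> 1/16\<close> by (intro mult_mono) auto
      ultimately have "0 \<le> (1 - u) * (1 + u / 2 + u\<^sup>2 / 2)\<^sup>2 - 1"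
        using u4 by (simp only:) (intro mult_nonneg_nonneg, auto)
      then show ?thesis by simp
    qed
    then have "sqrt 1 \<le> sqrt ((1 - u) * (1 + u / 2 + u\<^sup>2 / 2)\<^sup>2)" by (rule real_sqrt_le_mono)
    also have "\<dots> = sqrt (1 - u) * (1 + u / 2 + u\<^sup>2 / 2)" using u4 by (simp add: real_sqrt_mult)
    finally show ?thesis using u4 by (simp add: field_simps)
  qed
  finally have "p - 1 - u / 2 \<le> u\<^sup>2 / 2" by simp
  then show "(\<integral>y. (rel_density_diag d y - 1 - first_order_diag d y)\<^sup>2 \<partial>gauss) \<le> (\<Sum>i\<in>UNIV. (d i)\<^sup>2)\<^sup>2 / 2"
    using h by (simp add: has_bochner_integral_iff u_def)
qed

end

section \<open>Rotation invariance and general covariance\<close>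

lemma gauss_orthogonal:
  assumes P: "orthogonal_matrix (P :: real^'n^'n)"
  shows "distr gauss borel ((*v) P) = gauss"
proof (rule characteristic_function_unique)
  fix y :: "real^'n"
  have "(\<integral>x. iex (y \<bullet> x) \<partial>distr gauss borel ((*v) P)) = (\<integral>x. iex ((transpose P *v y) \<bullet> x) \<partial>gauss)"
    by (subst integral_distr) (auto simp: dot_lmul_matrix[symmetric] inner_commute)
  also have "\<dots> = of_real (exp (- (norm (transpose P *v y))\<^sup>2 / 2))" by (rule cf_gauss)
  also have "norm (transpose P *v y) = norm y"
    using norm_orth[of "transpose P"] P by (simp add: orthogonal_matrix_transpose)
  also have "of_real (exp (- (norm y)\<^sup>2 / 2)) = (\<integral>x. iex (y \<bullet> x) \<partial>gauss)" by (rule cf_gauss[symmetric])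
  finally show "(\<integral>x. iex (y \<bullet> x) \<partial>distr gauss borel ((*v) P)) = (\<integral>x. iex (y \<bullet> x) \<partial>gauss)" .
qed (auto intro!: finite_measure.finite_measure_distr gauss.finite_measure_axioms)

lemma has_bochner_gauss_orthogonal:
  fixes h :: "real^'n \<Rightarrow> 'b::{banach, second_countable_topology}"
  assumes P: "orthogonal_matrix P" and [measurable]: "h \<in> borel_measurable borel"
  shows "has_bochner_integral gauss h v \<longleftrightarrow> has_bochner_integral gauss (\<lambda>y. h (P *v y)) v"
proof -
  have "has_bochner_integral gauss h v \<longleftrightarrow> has_bochner_integral (distr gauss borel ((*v) P)) h v"
    by (simp add: gauss_orthogonal[OF P])
  also have "\<dots> \<longleftrightarrow> has_bochner_integral gauss (\<lambda>y. h (P *v y)) v"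
    by (simp add: has_bochner_integral_iff integrable_distr_eq integral_distr)
  finally show ?thesis .
qed

text \<open>The solution of \<open>A x = b\<close> by Cramer's rule, a form in which measurability in \<open>A\<close> is evident.
  For small symmetric \<open>D\<close>, \<open>rel_density D\<close> is the density of \<open>N(0, I + D)\<close> with respect to \<open>N(0, I)\<close>,
  and \<open>first_order D\<close> is the derivative of the density at \<open>0\<close> in the direction \<open>D\<close>.\<close>

definition sol :: "real^'n^'n \<Rightarrow> real^'n \<Rightarrow> real^'n" where
  "sol A b = (\<chi> k. det (\<chi> i j. if j = k then b $ i else A $ i $ j) / det A)"

definition rel_density :: "real^'n^'n \<Rightarrow> real^'n \<Rightarrow> real" where
  "rel_density D x = exp ((x \<bullet> (x - sol (mat 1 + D) x)) / 2) / sqrt (det (mat 1 + D))"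

definition first_order :: "real^'n^'n \<Rightarrow> real^'n \<Rightarrow> real" where
  "first_order D x = (x \<bullet> (D *v x) - trace D) / 2"

lemma det_measurable [measurable (raw)]:
  fixes f :: "'a \<Rightarrow> real^'n^'n"
  assumes [measurable]: "f \<in> borel_measurable M"
  shows "(\<lambda>x. det (f x)) \<in> borel_measurable M"
  unfolding det_def by measurable

lemma borel_measurable_vec_vec_iff:
  fixes f :: "'a \<Rightarrow> real^'n^'m"
  shows "f \<in> borel_measurable M \<longleftrightarrow> (\<forall>i j. (\<lambda>x. f x $ i $ j) \<in> borel_measurable M)"
proof
  assume *: "\<forall>i j. (\<lambda>x. f x $ i $ j) \<in> borel_measurable M"
  show "f \<in> borel_measurable M"
    unfolding borel_measurable_euclidean_space[of f]
  proof
    fix b :: "real^'n^'m" assume "b \<in> Basis"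
    then obtain i j where "b = axis i (axis j 1)" by (auto simp: Basis_vec_def)
    then have "f x \<bullet> b = f x $ i $ j" for x
      by (simp add: inner_axis cart_eq_inner_axis[symmetric])
    then show "(\<lambda>x. f x \<bullet> b) \<in> borel_measurable M" using * by simp
  qed
qed (auto intro: borel_measurable_vec_nth)

lemma rel_density_measurable [measurable (raw)]:
  fixes f :: "'a \<Rightarrow> real^'n^'n"
  assumes [measurable]: "f \<in> borel_measurable M" "g \<in> borel_measurable M"
  shows "(\<lambda>x. rel_density (f x) (g x)) \<in> borel_measurable M"
proof -
  have [measurable]: "(\<lambda>x. \<chi> i j. if j = k then g x $ i else (mat 1 + f x) $ i $ j) \<in> borel_measurable M" for k :: 'n
  proof (subst borel_measurable_vec_vec_iff, intro allI)
    fix i j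
    show "(\<lambda>x. (\<chi> i j. if j = k then g x $ i else (mat 1 + f x) $ i $ j) $ i $ j) \<in> borel_measurable M"
      by (cases "j = k") auto
  qed
  show ?thesis unfolding rel_density_def sol_def by measurable
qed

lemma first_order_measurable [measurable (raw)]:
  fixes f :: "'a \<Rightarrow> real^'n^'n"
  assumes [measurable]: "f \<in> borel_measurable M" "g \<in> borel_measurable M"
  shows "(\<lambda>x. first_order (f x) (g x)) \<in> borel_measurable M"
  unfolding first_order_def trace_def by measurable

lemma first_order_conjm:
  assumes P: "orthogonal_matrix P" shows "first_order (conjm P d) (P *v y) = first_order_diag d y"
  unfolding first_order_def inner_conjm[OF P] trace_conjm[OF P] first_order_diag_def
  by (simp add: sum_subtractf[symmetric] sum_divide_distrib right_diff_distrib diff_divide_distrib)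

lemma has_bochner_first_order:
  assumes "transpose D = (D :: real^'n^'n)"
  shows "has_bochner_integral gauss (\<lambda>x. (first_order D x)\<^sup>2) ((norm D)\<^sup>2 / 2)"
    "has_bochner_integral gauss (first_order D) 0"
proof -
  obtain P d where P: "orthogonal_matrix P" and D: "D = conjm P d" using spectral_theorem[OF assms] by blast
  show "has_bochner_integral gauss (\<lambda>x. (first_order D x)\<^sup>2) ((norm D)\<^sup>2 / 2)"
    unfolding D norm_conjm[OF P] using has_bochner_first_order_diag_sq
    by (subst has_bochner_gauss_orthogonal[OF P]) (auto simp: first_order_conjm[OF P])
  show "has_bochner_integral gauss (first_order D) 0"
    unfolding D using has_bochner_first_order_diag
    by (subst has_bochner_gauss_orthogonal[OF P]) (auto simp: first_order_conjm[OF P])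
qed

lemma rel_density_conjm:
  assumes P: "orthogonal_matrix P" and d: "\<And>i. \<bar>d i\<bar> \<le> 1/2"
  shows "rel_density (conjm P d) (P *v y) = rel_density_diag d y"
proof -
  have pos: "0 < 1 + d i" for i using d[of i] by auto
  have A: "mat 1 + conjm P d = conjm P (\<lambda>i. 1 + d i)"
    by (simp add: conjm_1[OF P, symmetric] conjm_add[OF P])
  have det: "det (mat 1 + conjm P d) = (\<Prod>i\<in>UNIV. 1 + d i)" unfolding A by (rule det_conjm[OF P])
  have "det (mat 1 + conjm P d) \<noteq> 0" unfolding det using pos by (simp add: less_imp_neq[symmetric])
  \<comment> \<open>The solution is exhibited in the eigenbasis; since the determinant is nonzero,
    Cramer's rule identifies it with \<open>sol\<close>.\<close>
  moreover have "(mat 1 + conjm P d) *v (P *v (\<chi> i. y $ i / (1 + d i))) = P *v y"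
    unfolding A conjm_vec[OF P] using pos[THEN less_imp_neq] by (auto simp: vec_eq_iff intro!: arg_cong[where f="(*v) P"])
  ultimately have sol: "sol (mat 1 + conjm P d) (P *v y) = P *v (\<chi> i. y $ i / (1 + d i))"
    unfolding sol_def by (subst (asm) cramer) auto
  have "(P *v y) \<bullet> (P *v y - sol (mat 1 + conjm P d) (P *v y)) = (\<Sum>i\<in>UNIV. d i / (1 + d i) * (y $ i)\<^sup>2)"
    unfolding sol matrix_vector_mult_diff_distrib[symmetric] inner_orth[OF P]
    unfolding inner_vec_eq
  proof (intro sum.cong refl)
    fix i show "y $ i * (y - (\<chi> i. y $ i / (1 + d i))) $ i = d i / (1 + d i) * (y $ i)\<^sup>2"
      using pos[of i] by (simp add: field_simps power2_eq_square)
  qed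
  then show ?thesis
    unfolding rel_density_def det rel_density_diag_def rel_density1_def
    by (simp add: prod_dividef exp_sum[symmetric] sum_divide_distrib sqrt_prod)
qed

lemma norm_le_diag:
  assumes P: "orthogonal_matrix P" and "norm (conjm P d) \<le> c" shows "\<bar>d i\<bar> \<le> c"
proof -
  have "(d i)\<^sup>2 \<le> (\<Sum>i\<in>UNIV. (d i)\<^sup>2)" by (rule member_le_sum) auto
  also have "\<dots> = (norm (conjm P d))\<^sup>2" by (rule norm_conjm[OF P, symmetric])
  finally have "\<bar>d i\<bar> \<le> norm (conjm P d)" by (metis abs_le_square_iff abs_norm_cancel)
  then show ?thesis using assms(2) by simp
qed

context
  fixes D :: "real^'n^'n"
  assumes sym: "transpose D = D" and small: "norm D \<le> 1/2"
begin

lemma rel_density_diagonalize: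
  obtains P d where "orthogonal_matrix P" "D = conjm P d" "\<And>i. \<bar>d i\<bar> \<le> 1/2"
    "\<And>y. rel_density D (P *v y) = rel_density_diag d y"
proof -
  obtain P d where P: "orthogonal_matrix P" and D: "D = conjm P d" using spectral_theorem[OF sym] by blast
  have d: "\<bar>d i\<bar> \<le> 1/2" for i using norm_le_diag[OF P, of d "1/2"] small unfolding D by simp
  show thesis using that[OF P D d] rel_density_conjm[OF P d] D by simp
qed

lemma rel_density_pos: "0 < rel_density D x"
proof -
  obtain P d where P: "orthogonal_matrix P" "\<And>i. \<bar>d i\<bar> \<le> 1/2" "\<And>y. rel_density D (P *v y) = rel_density_diag d y"
    using rel_density_diagonalize by metis
  obtain y where "x = P *v y" using orth_surj[OF P(1)] by blast
  then show ?thesis using P(3) rel_density_diag_pos[of d, OF P(2)] by simp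
qed

lemma rel_density_bound: "rel_density D x \<le> 2 ^ CARD('n) * exp ((norm x)\<^sup>2 / 6)"
proof -
  obtain P d where P: "orthogonal_matrix P" "\<And>i. \<bar>d i\<bar> \<le> 1/2" "\<And>y. rel_density D (P *v y) = rel_density_diag d y"
    using rel_density_diagonalize by metis
  obtain y where "x = P *v y" using orth_surj[OF P(1)] by blast
  then show ?thesis using P(3) rel_density_diag_bound[of d y, OF P(2)] norm_orth[OF P(1), of y] by simp
qed

lemma rel_density_cont: "continuous_on UNIV (rel_density D)"
proof -
  obtain P d where P: "orthogonal_matrix P" "\<And>i. \<bar>d i\<bar> \<le> 1/2" "\<And>y. rel_density D (P *v y) = rel_density_diag d y"
    using rel_density_diagonalize by metis
  have "rel_density D x = rel_density_diag d (transpose P *v x)" for x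
    unfolding P(3)[symmetric] by (simp add: matrix_vector_mul_assoc PPt[OF P(1)] del: transpose_matrix_vector)
  moreover have "continuous_on UNIV (\<lambda>x. rel_density_diag d (transpose P *v x))"
    unfolding rel_density_diag_def rel_density1_def
  proof (intro continuous_intros matrix_vector_mult_linear_continuous_on ballI)
    fix i
    show "sqrt (1 + d i) \<noteq> 0" using P(2)[of i] by auto
  qed auto
  ultimately show ?thesis by (simp add: fun_eq_iff[symmetric])
qed

lemma has_bochner_rel_density: "has_bochner_integral gauss (rel_density D) 1"
proof -
  obtain P d where P: "orthogonal_matrix P" "\<And>i. \<bar>d i\<bar> \<le> 1/2" "\<And>y. rel_density D (P *v y) = rel_density_diag d y"
    using rel_density_diagonalize by metis
  show ?thesis using has_bochner_rel_density_diag[of d, OF P(2)] by (subst has_bochner_gauss_orthogonal[OF P(1)]) (auto simp: P(3))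
qed

lemma has_bochner_rel_density_iex:
  "has_bochner_integral gauss (\<lambda>x. iex (y \<bullet> x) * of_real (rel_density D x)) (of_real (exp (- (y \<bullet> ((mat 1 + D) *v y)) / 2)))"
proof -
  obtain P d where P: "orthogonal_matrix P" "\<And>i. \<bar>d i\<bar> \<le> 1/2" "\<And>y. rel_density D (P *v y) = rel_density_diag d y"
    and D: "D = conjm P d"
    using rel_density_diagonalize by metis
  obtain w where y: "y = P *v w" using orth_surj[OF P(1)] by blast
  have "mat 1 + D = conjm P (\<lambda>i. 1 + d i)"
    unfolding D by (simp add: conjm_1[OF P(1), symmetric] conjm_add[OF P(1)])
  then have "y \<bullet> ((mat 1 + D) *v y) = (\<Sum>i\<in>UNIV. (1 + d i) * (w $ i)\<^sup>2)"
    unfolding y by (simp only: inner_conjm[OF P(1)])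
  then show ?thesis
    using has_bochner_rel_density_diag_iex[of d, OF P(2)] 
    by (subst has_bochner_gauss_orthogonal[OF P(1)]) (auto simp: P(3) y inner_orth[OF P(1)])
qed

text \<open>In the eigenbasis the Hilbert-Schmidt norm is the Euclidean norm of the eigenvalues, so
  the diagonal estimate transfers without a dimensional factor.\<close>

lemma remainder_bound:
  "integrable gauss (\<lambda>x. (rel_density D x - 1 - first_order D x)\<^sup>2)"
  "(\<integral>x. (rel_density D x - 1 - first_order D x)\<^sup>2 \<partial>gauss) \<le> (norm D) ^ 4 / 2"
proof -
  obtain P d where P: "orthogonal_matrix P" "\<And>i. \<bar>d i\<bar> \<le> 1/2" "\<And>y. rel_density D (P *v y) = rel_density_diag d y"
    and D: "D = conjm P d"
    using rel_density_diagonalize by metis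
  have n: "(\<Sum>i\<in>UNIV. (d i)\<^sup>2) = (norm D)\<^sup>2" unfolding D norm_conjm[OF P(1)] ..
  then have "(\<Sum>i\<in>UNIV. (d i)\<^sup>2) \<le> 1/4" using small power_mono[of "norm D" "1/2" 2] by (simp add: power2_eq_square)
  note r = has_bochner_remainder_diag[of d, OF P(2) this]
  have "has_bochner_integral gauss (\<lambda>y. (rel_density D (P *v y) - 1 - first_order D (P *v y))\<^sup>2) (\<integral>y. (rel_density_diag d y - 1 - first_order_diag d y)\<^sup>2 \<partial>gauss)"
    using r(1) unfolding P(3) unfolding D first_order_conjm[OF P(1)] by (simp add: has_bochner_integral_iff)
  then have h: "has_bochner_integral gauss (\<lambda>x. (rel_density D x - 1 - first_order D x)\<^sup>2) (\<integral>y. (rel_density_diag d y - 1 - first_order_diag d y)\<^sup>2 \<partial>gauss)"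
    by (subst has_bochner_gauss_orthogonal[OF P(1)]) auto
  show "integrable gauss (\<lambda>x. (rel_density D x - 1 - first_order D x)\<^sup>2)" using h by (simp add: has_bochner_integral_iff)
  show "(\<integral>x. (rel_density D x - 1 - first_order D x)\<^sup>2 \<partial>gauss) \<le> (norm D) ^ 4 / 2"
    using h r(2) unfolding n by (simp add: has_bochner_integral_iff power_mult[symmetric])
qed

end

subsection \<open>Conditionally Gaussian vectors with covariance close to the identity\<close>

lemma (in prob_space) square_integral_le:
  fixes f :: "'a \<Rightarrow> real"
  assumes "integrable M f" "integrable M (\<lambda>x. (f x)\<^sup>2)"
  shows "(\<integral>x. f x \<partial>M)\<^sup>2 \<le> (\<integral>x. (f x)\<^sup>2 \<partial>M)"
proof -
  have "0 \<le> variance f" by simp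
  also have "variance f = (\<integral>x. (f x)\<^sup>2 \<partial>M) - (\<integral>x. f x \<partial>M)\<^sup>2"
    using assms by (rule variance_eq)
  finally show ?thesis by simp
qed

text \<open>Minkowski's inequality from (u + v)^2 \<le> (1 + b/a) u^2 + (1 + a/b) v^2. The weights
  require positive a and b, so both are enlarged by e/2 before e tends to zero.\<close>

lemma (in prob_space) l2_triangle:
  fixes u v :: "'a \<Rightarrow> real"
  assumes [measurable]: "u \<in> borel_measurable M" "v \<in> borel_measurable M"
    and u: "integrable M (\<lambda>x. (u x)\<^sup>2)" "(\<integral>x. (u x)\<^sup>2 \<partial>M) \<le> a\<^sup>2"
    and v: "integrable M (\<lambda>x. (v x)\<^sup>2)" "(\<integral>x. (v x)\<^sup>2 \<partial>M) \<le> b\<^sup>2" and ab: "0 \<le> a" "0 \<le> b"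
  shows "integrable M (\<lambda>x. (u x + v x)\<^sup>2)" "(\<integral>x. (u x + v x)\<^sup>2 \<partial>M) \<le> (a + b)\<^sup>2"
proof -
  have "integrable M (\<lambda>x. 2 * (u x)\<^sup>2 + 2 * (v x)\<^sup>2)" using u v by auto
  then show i: "integrable M (\<lambda>x. (u x + v x)\<^sup>2)"
  proof (rule Bochner_Integration.integrable_bound)
    have "(u x + v x)\<^sup>2 \<le> 2 * (u x)\<^sup>2 + 2 * (v x)\<^sup>2" for x
      using zero_le_power2[of "u x - v x"] by (simp add: power2_eq_square algebra_simps)
    then show "AE x in M. norm ((u x + v x)\<^sup>2) \<le> norm (2 * (u x)\<^sup>2 + 2 * (v x)\<^sup>2)"
      by (intro AE_I2) (simp add: abs_of_nonneg)
  qed simp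
  have pos: "(\<integral>x. (u x + v x)\<^sup>2 \<partial>M) \<le> (a' + b')\<^sup>2" if "0 < a'" "0 < b'" "a \<le> a'" "b \<le> b'" for a' b'
  proof -
    have "(\<integral>x. (u x + v x)\<^sup>2 \<partial>M) \<le> (\<integral>x. (1 + b'/a') * (u x)\<^sup>2 + (1 + a'/b') * (v x)\<^sup>2 \<partial>M)"
    proof (rule integral_mono[OF i])
      fix x
      have "0 \<le> (b' / a') * (u x - a' / b' * v x)\<^sup>2" using that by simp
      also have "(b' / a') * (u x - a' / b' * v x)\<^sup>2 = b'/a' * (u x)\<^sup>2 - 2 * u x * v x + a'/b' * (v x)\<^sup>2"
        using that by (simp add: power2_eq_square field_simps)
      finally show "(u x + v x)\<^sup>2 \<le> (1 + b'/a') * (u x)\<^sup>2 + (1 + a'/b') * (v x)\<^sup>2"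
        by (simp add: power2_eq_square algebra_simps)
    qed (use u v in auto)
    also have "\<dots> = (1 + b'/a') * (\<integral>x. (u x)\<^sup>2 \<partial>M) + (1 + a'/b') * (\<integral>x. (v x)\<^sup>2 \<partial>M)"
      using u v by simp
    also have "\<dots> \<le> (1 + b'/a') * a'\<^sup>2 + (1 + a'/b') * b'\<^sup>2"
      using that ab order_trans[OF u(2) power_mono[of a a' 2]] order_trans[OF v(2) power_mono[of b b' 2]]
      by (intro add_mono mult_left_mono) auto
    also have "\<dots> = (a' + b')\<^sup>2" using that by (simp add: power2_eq_square field_simps)
    finally show ?thesis .
  qed
  have "sqrt (\<integral>x. (u x + v x)\<^sup>2 \<partial>M) \<le> a + b + e" if e: "0 < e" for e
  proof -
    have "(\<integral>x. (u x + v x)\<^sup>2 \<partial>M) \<le> ((a + e/2) + (b + e/2))\<^sup>2"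
      using e ab by (intro pos) auto
    then have "sqrt (\<integral>x. (u x + v x)\<^sup>2 \<partial>M) \<le> (a + e/2) + (b + e/2)"
      using e ab by (intro real_le_lsqrt) auto
    then show ?thesis by simp
  qed
  then have "sqrt (\<integral>x. (u x + v x)\<^sup>2 \<partial>M) \<le> a + b" by (rule field_le_epsilon)
  then show "(\<integral>x. (u x + v x)\<^sup>2 \<partial>M) \<le> (a + b)\<^sup>2"
    by (rule sqrt_le_D)
qed

lemma transpose_linear: "bounded_linear (transpose :: real^'n^'m \<Rightarrow> real^'m^'n)"
  by (intro linear_conv_bounded_linear[THEN iffD1] linearI) (auto simp: transpose_def vec_eq_iff)

lemma first_order_linear: "bounded_linear (\<lambda>D. first_order D x)"
  by (intro linear_conv_bounded_linear[THEN iffD1] linearI)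
    (auto simp: first_order_def trace_def matrix_vector_mult_add_rdistrib inner_add_right sum.distrib
      scaleR_matrix_vector_assoc[symmetric] sum_distrib_left field_simps)

lemma has_bochner_gauss_coord:
  fixes f :: "real \<Rightarrow> real"
  assumes "has_bochner_integral \<gamma>1 f v"
  shows "has_bochner_integral gauss (\<lambda>y::real^'n. f (y $ j)) v"
proof -
  have "has_bochner_integral gauss (\<lambda>y::real^'n. \<Prod>i\<in>UNIV. if i = j then f (y $ i) else 1) (\<Prod>i\<in>UNIV. if i = j then v else 1)"
    using assms has_bochner_gamma1_moments(3)
    by (intro has_bochner_gauss_prod[of "\<lambda>i t. if i = j then f t else 1"]) auto
  then show ?thesis by (simp add: prod.delta cong: if_cong)
qed

text \<open>The expected cost of an independent Gaussian partner for a vector frozen at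
  \<open>x\<close>.\<close>

lemma gauss_dist_sq: "(\<integral>\<^sup>+y. ennreal ((norm (x - y))\<^sup>2) \<partial>gauss) = ennreal ((norm (x::real^'n))\<^sup>2 + real CARD('n))"
proof -
  have t: "has_bochner_integral \<gamma>1 (\<lambda>t. t) 0" "has_bochner_integral \<gamma>1 (\<lambda>t. t\<^sup>2) 1"
    using std_normal_moment_odd[of 0] std_normal_moment_even[of 1]
    by (auto simp: has_bochner_integral_gamma1)
  have "has_bochner_integral \<gamma>1 (\<lambda>t. (a\<^sup>2 * 1 - (2 * a) * t) + t\<^sup>2) ((a\<^sup>2 * 1 - (2 * a) * 0) + 1)" for a :: real
    by (intro has_bochner_integral_add has_bochner_integral_diff has_bochner_integral_mult_right t has_bochner_gamma1_moments)
  then have "has_bochner_integral \<gamma>1 (\<lambda>t. (a - t)\<^sup>2) (a\<^sup>2 + 1)" for a :: real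
    by (simp add: power2_diff add_diff_eq diff_add_eq)
  then have "has_bochner_integral gauss (\<lambda>y. \<Sum>i\<in>UNIV. (x $ i - y $ i)\<^sup>2) (\<Sum>i\<in>UNIV. (x $ i)\<^sup>2 + 1)"
    by (intro has_bochner_integral_sum has_bochner_gauss_coord[of "\<lambda>t. (x $ _ - t)\<^sup>2"])
  then have h: "has_bochner_integral gauss (\<lambda>y. (norm (x - y))\<^sup>2) ((norm x)\<^sup>2 + real CARD('n))"
    by (simp add: norm_vec_sq sum.distrib)
  then show ?thesis
    by (subst nn_integral_eq_integral) (auto simp: has_bochner_integral_iff)
qed

text \<open>The standardised problem, in which the target is \<open>gauss\<close>. It is applied to
  the covariance \<open>S ** A ** S\<close>, where \<open>S\<close> is the inverse square root of
  \<open>K\<close>.\<close>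

locale conditional_gaussian = prob_space M for M :: "'a measure" +
  fixes \<F> :: "'a measure" and B :: "'a \<Rightarrow> real^'n^'n" and X :: "'a \<Rightarrow> real^'n"
  assumes sub: "subalgebra M \<F>" and X_meas [measurable]: "X \<in> borel_measurable M"
    and B_F: "B \<in> borel_measurable \<F>" and psd: "\<And>\<omega>. \<omega> \<in> space M \<Longrightarrow> positive_semidefinite (B \<omega>)"
    and cond_cf: "\<And>y. AE \<omega> in M. complex_cond_exp M \<F> (\<lambda>x. iex (y \<bullet> X x)) \<omega> = of_real (exp (- (y \<bullet> (B \<omega> *v y)) / 2))"
    and moment4: "integrable M (\<lambda>\<omega>. norm (B \<omega> - mat 1) ^ 4)"
begin

sublocale subalg: sigma_finite_subalgebra M \<F>
  by (rule finite_measure_subalgebra_is_sigma_finite) (unfold_locales, rule sub)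

lemma B_meas [measurable]: "B \<in> borel_measurable M"
  using B_F sub by (rule measurable_from_subalg[rotated])

lemma F_sets: "E \<in> sets \<F> \<Longrightarrow> E \<in> sets M"
  using sub by (auto simp: subalgebra_def)

definition "D \<omega> = B \<omega> - mat 1"

lemma D_meas [measurable]: "D \<in> borel_measurable M"
  unfolding D_def[abs_def] by measurable

lemma D_sym: "\<omega> \<in> space M \<Longrightarrow> transpose (D \<omega>) = D \<omega>"
  using psd[of \<omega>] by (simp add: D_def positive_semidefinite_def transpose_def vec_eq_iff mat_def)

lemma cov_nonneg: "\<omega> \<in> space M \<Longrightarrow> 0 \<le> y \<bullet> (B \<omega> *v y)"
  using psd by (simp add: positive_semidefinite_def)

text \<open>Membership of the event in \<F> allows the indicator to pass through the conditional
  expectation. Real and imaginary parts are treated separately, and the imaginary part of the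
  conditional characteristic function is zero.\<close>

lemma restricted_cf:
  assumes E: "E \<in> sets \<F>"
  shows "(\<integral>\<omega>. indicator E \<omega> *\<^sub>R iex (y \<bullet> X \<omega>) \<partial>M) = of_real (\<integral>\<omega>. indicator E \<omega> * exp (- (y \<bullet> (B \<omega> *v y)) / 2) \<partial>M)"
proof -
  have [measurable]: "E \<in> sets M" using E by (rule F_sets)
  have i: "integrable M (\<lambda>\<omega>. Re (iex (y \<bullet> X \<omega>)))" "integrable M (\<lambda>\<omega>. Im (iex (y \<bullet> X \<omega>)))"
    by (rule integrable_const_bound[of _ 1], auto simp: Re_exp Im_exp)+
  have iE: "integrable M (\<lambda>\<omega>. indicator E \<omega> *\<^sub>R iex (y \<bullet> X \<omega>))"
    by (rule integrable_const_bound[of _ 1]) (auto simp: indicator_def)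
  have c: "AE \<omega> in M. real_cond_exp M \<F> (\<lambda>\<omega>. Re (iex (y \<bullet> X \<omega>))) \<omega> = exp (- (y \<bullet> (B \<omega> *v y)) / 2)"
    "AE \<omega> in M. real_cond_exp M \<F> (\<lambda>\<omega>. Im (iex (y \<bullet> X \<omega>))) \<omega> = 0"
    using cond_cf[of y] by (auto simp: complex_cond_exp_def complex_eq_iff)
  have "(\<integral>\<omega>. indicator E \<omega> * Re (iex (y \<bullet> X \<omega>)) \<partial>M) = (\<integral>\<omega>. indicator E \<omega> * real_cond_exp M \<F> (\<lambda>\<omega>. Re (iex (y \<bullet> X \<omega>))) \<omega> \<partial>M)"
    using subalg.real_cond_exp_intA[OF i(1) E] by (simp add: set_lebesgue_integral_def)
  also have "\<dots> = (\<integral>\<omega>. indicator E \<omega> * exp (- (y \<bullet> (B \<omega> *v y)) / 2) \<partial>M)"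
    using c(1) by (intro integral_cong_AE) auto
  finally have re: "(\<integral>\<omega>. indicator E \<omega> * Re (iex (y \<bullet> X \<omega>)) \<partial>M) = (\<integral>\<omega>. indicator E \<omega> * exp (- (y \<bullet> (B \<omega> *v y)) / 2) \<partial>M)" .
  have "(\<integral>\<omega>. indicator E \<omega> * Im (iex (y \<bullet> X \<omega>)) \<partial>M) = (\<integral>\<omega>. indicator E \<omega> * real_cond_exp M \<F> (\<lambda>\<omega>. Im (iex (y \<bullet> X \<omega>))) \<omega> \<partial>M)"
    using subalg.real_cond_exp_intA[OF i(2) E] by (simp add: set_lebesgue_integral_def)
  also have "\<dots> = (\<integral>\<omega>. 0 \<partial>M)"
    using c(2) by (intro integral_cong_AE) auto
  finally have im: "(\<integral>\<omega>. indicator E \<omega> * Im (iex (y \<bullet> X \<omega>)) \<partial>M) = 0" by simp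
  show ?thesis
    using re im integral_Re[OF iE] integral_Im[OF iE] by (simp add: complex_eq_iff)
qed

definition "E = {\<omega> \<in> space M. norm (D \<omega>) \<le> 1/2}"

lemma E_F: "E \<in> sets \<F>"
proof -
  have s: "space M = space \<F>" using sub by (simp add: subalgebra_def)
  have [measurable]: "D \<in> borel_measurable \<F>" unfolding D_def[abs_def] using B_F by measurable
  show ?thesis unfolding E_def s by measurable
qed

lemma E_meas [measurable]: "E \<in> sets M" using E_F by (rule F_sets)

lemma E_D: "\<omega> \<in> E \<Longrightarrow> transpose (D \<omega>) = D \<omega>" "\<omega> \<in> E \<Longrightarrow> norm (D \<omega>) \<le> 1/2"
  using D_sym by (auto simp: E_def)

text \<open>The conditional density of \<open>X\<close> given \<F>, set to zero off
  \<open>E\<close>, where \<open>rel_density\<close> need not be a density.\<close>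

definition "w \<omega> x = indicator E \<omega> * rel_density (D \<omega>) x"

lemma w_meas [measurable]: "(\<lambda>z. w (fst z) (snd z)) \<in> borel_measurable (M \<Otimes>\<^sub>M borel)"
  "(\<lambda>\<omega>. w \<omega> x) \<in> borel_measurable M"
  unfolding w_def[abs_def] by measurable

lemma w_nonneg: "0 \<le> w \<omega> x"
  unfolding w_def using rel_density_pos[OF E_D] by (auto simp: indicator_def less_imp_le)

lemma w_bound: "w \<omega> x \<le> 2 ^ CARD('n) * exp ((norm x)\<^sup>2 / 6)"
  unfolding w_def using rel_density_bound[OF E_D] by (auto simp: indicator_def)

lemma int_w: "integrable M (\<lambda>\<omega>. w \<omega> x)"
  using w_nonneg w_bound by (intro integrable_const_bound[of _ "2 ^ CARD('n) * exp ((norm x)\<^sup>2 / 6)"]) auto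

text \<open>The density, relative to \<open>gauss\<close>, of the law of \<open>X\<close> restricted
  to \<open>E\<close>; its mass is \<open>prob E\<close> rather than one.\<close>

definition "p x = (\<integral>\<omega>. w \<omega> x \<partial>M)"

lemma p_nonneg: "0 \<le> p x" unfolding p_def by (intro Bochner_Integration.integral_nonneg w_nonneg)

lemma p_bound: "p x \<le> 2 ^ CARD('n) * exp ((norm x)\<^sup>2 / 6)"
proof -
  have "p x \<le> (\<integral>\<omega>. 2 ^ CARD('n) * exp ((norm x)\<^sup>2 / 6) \<partial>M)"
    unfolding p_def using w_bound by (intro integral_mono int_w) auto
  then show ?thesis by (simp add: prob_space)
qed

lemma p_cont: "continuous_on UNIV p"
  unfolding continuous_on_sequentially comp_def
proof (intro allI ballI impI)
  fix u :: "nat \<Rightarrow> real^'n" and a assume "(\<forall>n. u n \<in> UNIV) \<and> u \<longlonglongrightarrow> a"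
  then have u: "u \<longlonglongrightarrow> a" by simp
  obtain b where b: "\<And>n. norm (u n) \<le> b" using convergent_imp_Bseq[OF convergentI[OF u]] by (auto simp: Bseq_def)
  show "(\<lambda>n. p (u n)) \<longlonglongrightarrow> p a"
    unfolding p_def
  proof (rule integral_dominated_convergence[where w="\<lambda>_. 2 ^ CARD('n) * exp (b\<^sup>2 / 6)"])
    show "AE \<omega> in M. (\<lambda>n. w \<omega> (u n)) \<longlonglongrightarrow> w \<omega> a"
    proof (intro AE_I2)
      fix \<omega>
      show "(\<lambda>n. w \<omega> (u n)) \<longlonglongrightarrow> w \<omega> a"
      proof (cases "\<omega> \<in> E")
        case True
        have "isCont (rel_density (D \<omega>)) a" using rel_density_cont[OF E_D[OF True]] by (simp add: continuous_on_eq_continuous_at)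
        then have "(\<lambda>n. rel_density (D \<omega>) (u n)) \<longlonglongrightarrow> rel_density (D \<omega>) a" using u by (rule isCont_tendsto_compose)
        then show ?thesis using True by (simp add: w_def)
      qed (simp add: w_def)
    qed
    show "AE \<omega> in M. norm (w \<omega> (u n)) \<le> 2 ^ CARD('n) * exp (b\<^sup>2 / 6)" for n
    proof (intro AE_I2)
      fix \<omega>
      have "w \<omega> (u n) \<le> 2 ^ CARD('n) * exp ((norm (u n))\<^sup>2 / 6)" by (rule w_bound)
      also have "\<dots> \<le> 2 ^ CARD('n) * exp (b\<^sup>2 / 6)" using b[of n] by (simp add: power_mono)
      finally show "norm (w \<omega> (u n)) \<le> 2 ^ CARD('n) * exp (b\<^sup>2 / 6)" using w_nonneg by simp
    qed
  qed auto
qed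

lemma p_meas [measurable]: "p \<in> borel_measurable borel"
  using p_cont by (rule borel_measurable_continuous_onI)

sublocale Mg: pair_prob_space M "gauss :: (real^'n) measure"
  by unfold_locales

lemma nn_integral_w: "(\<integral>\<^sup>+x. ennreal (w \<omega> x) \<partial>gauss) = indicator E \<omega>"
proof (cases "\<omega> \<in> E")
  case True
  have "(\<integral>\<^sup>+x. ennreal (w \<omega> x) \<partial>gauss) = (\<integral>\<^sup>+x. ennreal (rel_density (D \<omega>) x) \<partial>gauss)" using True by (simp add: w_def)
  also have "\<dots> = 1"
    using has_bochner_rel_density[OF E_D[OF True]] rel_density_pos[OF E_D[OF True]]
    by (subst nn_integral_eq_integral) (auto simp: has_bochner_integral_iff less_imp_le)
  finally show ?thesis using True by simp
qed (simp add: w_def)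

lemma int_w_pair: "integrable (M \<Otimes>\<^sub>M gauss) (\<lambda>(\<omega>, x). w \<omega> x)"
proof (rule integrableI_nonneg)
  have "(\<integral>\<^sup>+z. ennreal (case z of (\<omega>, x) \<Rightarrow> w \<omega> x) \<partial>(M \<Otimes>\<^sub>M gauss)) = (\<integral>\<^sup>+\<omega>. \<integral>\<^sup>+x. ennreal (w \<omega> x) \<partial>gauss \<partial>M)"
    by (subst gauss.nn_integral_fst[symmetric]) (auto simp: split_beta')
  also have "\<dots> < \<infinity>" by (simp add: nn_integral_w less_top[symmetric])
  finally show "(\<integral>\<^sup>+z. ennreal (case z of (\<omega>, x) \<Rightarrow> w \<omega> x) \<partial>(M \<Otimes>\<^sub>M gauss)) < \<infinity>" .
qed (auto simp: w_nonneg split_beta')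

lemma nn_integral_p: "(\<integral>\<^sup>+x. ennreal (p x) \<partial>gauss) = emeasure M E"
proof -
  have "ennreal (p x) = (\<integral>\<^sup>+\<omega>. ennreal (w \<omega> x) \<partial>M)" for x
    unfolding p_def by (rule nn_integral_eq_integral[symmetric]) (auto simp: int_w w_nonneg)
  then have "(\<integral>\<^sup>+x. ennreal (p x) \<partial>gauss) = (\<integral>\<^sup>+x. \<integral>\<^sup>+\<omega>. ennreal (w \<omega> x) \<partial>M \<partial>gauss)" by simp
  also have "\<dots> = (\<integral>\<^sup>+\<omega>. \<integral>\<^sup>+x. ennreal (w \<omega> x) \<partial>gauss \<partial>M)"
    by (rule Mg.Fubini') (auto simp: split_beta')
  finally show ?thesis by (simp add: nn_integral_w)
qed

text \<open>Both sides have the same characteristic function: by \<open>restricted_cf\<close> the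
  left one averages Gaussian characteristic functions over \<open>E\<close>, each is an integral
  against \<open>w\<close>, and Fubini exchanges the two averages.\<close>

lemma law_E: "distr (density M (indicator E)) borel X = density gauss (\<lambda>x. ennreal (p x))"
proof (rule characteristic_function_unique)
  have "emeasure (density M (indicator E)) (space M) < \<infinity>"
    by (subst emeasure_density) (auto simp: less_top[symmetric])
  then have "finite_measure (density M (indicator E))" by (intro finite_measureI) auto
  then show "finite_measure (distr (density M (indicator E)) borel X)"
    by (rule finite_measure.finite_measure_distr) auto
  show "finite_measure (density (gauss :: (real^'n) measure) (\<lambda>x. ennreal (p x)))"
    by (rule finite_measureI) (simp add: emeasure_density nn_integral_p)
  fix y :: "real^'n"
  have "(\<integral>x. iex (y \<bullet> x) \<partial>distr (density M (indicator E)) borel X) = (\<integral>\<omega>. iex (y \<bullet> X \<omega>) \<partial>density M (\<lambda>\<omega>. ennreal (indicator E \<omega>)))"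
    by (subst integral_distr) (auto simp: ennreal_indicator)
  also have "\<dots> = (\<integral>\<omega>. indicator E \<omega> *\<^sub>R iex (y \<bullet> X \<omega>) \<partial>M)"
    by (subst integral_density) auto
  also have "\<dots> = of_real (\<integral>\<omega>. indicator E \<omega> * exp (- (y \<bullet> (B \<omega> *v y)) / 2) \<partial>M)"
    by (rule restricted_cf[OF E_F])
  also have "\<dots> = (\<integral>\<omega>. of_real (indicator E \<omega> * exp (- (y \<bullet> (B \<omega> *v y)) / 2)) \<partial>M)"
    by (rule integral_complex_of_real[symmetric])
  also have "\<dots> = (\<integral>\<omega>. \<integral>x. w \<omega> x *\<^sub>R iex (y \<bullet> x) \<partial>gauss \<partial>M)"
  proof (rule Bochner_Integration.integral_cong[OF refl])
    fix \<omega>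
    show "of_real (indicator E \<omega> * exp (- (y \<bullet> (B \<omega> *v y)) / 2)) = (\<integral>x. w \<omega> x *\<^sub>R iex (y \<bullet> x) \<partial>gauss)"
    proof (cases "\<omega> \<in> E")
      case True
      have "mat 1 + D \<omega> = B \<omega>" by (simp add: D_def)
      then show ?thesis using has_bochner_rel_density_iex[OF E_D[OF True], of y] True
        by (simp add: w_def has_bochner_integral_iff scaleR_conv_of_real mult.commute)
    qed (simp add: w_def)
  qed
  also have "\<dots> = (\<integral>x. \<integral>\<omega>. w \<omega> x *\<^sub>R iex (y \<bullet> x) \<partial>M \<partial>gauss)"
  proof (rule Mg.Fubini_integral[symmetric])
    show "integrable (M \<Otimes>\<^sub>M gauss) (\<lambda>(\<omega>, x). w \<omega> x *\<^sub>R iex (y \<bullet> x))"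
      by (rule Bochner_Integration.integrable_bound[OF int_w_pair]) (auto simp: split_beta')
  qed
  also have "\<dots> = (\<integral>x. p x *\<^sub>R iex (y \<bullet> x) \<partial>gauss)"
    unfolding p_def by (intro Bochner_Integration.integral_cong refl integral_scaleR_left int_w)
  also have "\<dots> = (\<integral>x. iex (y \<bullet> x) \<partial>density gauss (\<lambda>x. ennreal (p x)))"
    by (subst integral_density) (auto simp: p_nonneg)
  finally show "(\<integral>x. iex (y \<bullet> x) \<partial>distr (density M (indicator E)) borel X) = (\<integral>x. iex (y \<bullet> x) \<partial>density gauss (\<lambda>x. ennreal (p x)))" .
qed auto

section \<open>Error moments, the remainder and the total variation bound\<close>

definition "M4 = (\<integral>\<omega>. norm (D \<omega>) ^ 4 \<partial>M)"
definition "M2 = (\<integral>\<omega>. (norm (D \<omega>))\<^sup>2 \<partial>M)"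
definition "\<delta> = prob (space M - E)"

lemma int_D4: "integrable M (\<lambda>\<omega>. norm (D \<omega>) ^ 4)"
  using moment4 by (simp add: D_def)

lemma int_D2: "integrable M (\<lambda>\<omega>. (norm (D \<omega>))\<^sup>2)"
proof (rule Bochner_Integration.integrable_bound)
  show "integrable M (\<lambda>\<omega>. 1 + norm (D \<omega>) ^ 4)" using int_D4 by simp
  have "t\<^sup>2 \<le> 1 + t ^ 4" for t :: real
  proof -
    have "2 * t\<^sup>2 \<le> t ^ 4 + 1" using zero_le_power2[of "t\<^sup>2 - 1"] by (simp add: power2_diff)
    then show ?thesis using zero_le_power2[of t] by linarith
  qed
  then show "AE \<omega> in M. norm ((norm (D \<omega>))\<^sup>2) \<le> norm (1 + norm (D \<omega>) ^ 4)"
    by (intro AE_I2) (simp add: abs_of_nonneg)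
qed simp

lemma int_D: "integrable M D"
proof (rule Bochner_Integration.integrable_bound)
  show "integrable M (\<lambda>\<omega>. 1 + (norm (D \<omega>))\<^sup>2)" using int_D2 by simp
  have "t \<le> 1 + t\<^sup>2" for t :: real
  proof -
    have "2 * t \<le> t\<^sup>2 + 1" using zero_le_power2[of "t - 1"] by (simp add: power2_diff)
    then show ?thesis using zero_le_power2[of t] by (cases "0 \<le> t") linarith+
  qed
  then show "AE \<omega> in M. norm (D \<omega>) \<le> norm (1 + (norm (D \<omega>))\<^sup>2)"
    by (intro AE_I2) (simp add: abs_of_nonneg)
qed simp

lemma M2_sq_le: "M2\<^sup>2 \<le> M4"
  using square_integral_le[of "\<lambda>\<omega>. (norm (D \<omega>))\<^sup>2"] int_D2 int_D4
  by (simp add: M2_def M4_def power_mult[symmetric])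

lemma M4_nonneg: "0 \<le> M4" and M2_nonneg: "0 \<le> M2"
  unfolding M4_def M2_def by simp_all

lemma outside_E: "\<omega> \<in> space M - E \<Longrightarrow> 1/2 < norm (D \<omega>)"
  by (auto simp: E_def)

text \<open>Markov's inequality at the threshold 1/2. The second moment serves the total variation
  bound, the fourth the case of a large exceptional event in the coupling.\<close>

lemma delta_le: "\<delta> \<le> 4 * M2" "\<delta> \<le> 16 * M4"
proof -
  have i: "\<delta> = (\<integral>\<omega>. indicator (space M - E) \<omega> \<partial>M)" by (simp add: \<delta>_def)
  have "(\<integral>\<omega>. indicator (space M - E) \<omega> \<partial>M) \<le> (\<integral>\<omega>. 4 * (norm (D \<omega>))\<^sup>2 \<partial>M)"
  proof (rule integral_mono)
    fix \<omega> assume "\<omega> \<in> space M"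
    have "1 \<le> 4 * (norm (D \<omega>))\<^sup>2" if "\<omega> \<in> space M - E"
      using power_mono[of "1/2" "norm (D \<omega>)" 2] outside_E[OF that] by (simp add: power2_eq_square)
    then show "indicator (space M - E) \<omega> \<le> 4 * (norm (D \<omega>))\<^sup>2" by (auto simp: indicator_def)
  qed (auto simp: int_D2 less_top[symmetric])
  then show "\<delta> \<le> 4 * M2" by (simp add: i M2_def)
  have "(\<integral>\<omega>. indicator (space M - E) \<omega> \<partial>M) \<le> (\<integral>\<omega>. 16 * norm (D \<omega>) ^ 4 \<partial>M)"
  proof (rule integral_mono)
    fix \<omega> assume "\<omega> \<in> space M"
    have "1 \<le> 16 * norm (D \<omega>) ^ 4" if "\<omega> \<in> space M - E"
      using power_mono[of "1/2" "norm (D \<omega>)" 4] outside_E[OF that] by (simp add: power_divide)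
    then show "indicator (space M - E) \<omega> \<le> 16 * norm (D \<omega>) ^ 4" by (auto simp: indicator_def)
  qed (auto simp: int_D4 less_top[symmetric])
  then show "\<delta> \<le> 16 * M4" by (simp add: i M4_def)
qed

definition "m = (\<integral>\<omega>. indicator E \<omega> *\<^sub>R D \<omega> \<partial>M)"

lemma int_ED: "integrable M (\<lambda>\<omega>. indicator E \<omega> *\<^sub>R D \<omega>)"
  using int_D by (intro integrable_mult_indicator) auto

lemma m_sym: "transpose m = m"
proof -
  have "transpose m = (\<integral>\<omega>. transpose (indicator E \<omega> *\<^sub>R D \<omega>) \<partial>M)"
    unfolding m_def by (rule integral_bounded_linear[OF transpose_linear int_ED, symmetric])
  also have "\<dots> = m" unfolding m_def
  proof (rule Bochner_Integration.integral_cong[OF refl])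
    fix \<omega>
    show "transpose (indicator E \<omega> *\<^sub>R D \<omega>) = indicator E \<omega> *\<^sub>R D \<omega>"
      using E_D(1)[of \<omega>] by (auto simp: indicator_def transpose_def vec_eq_iff)
  qed
  finally show ?thesis .
qed

text \<open>Off \<open>E\<close> the norm exceeds 1/2, so |D| \<le> 2 |D|^2 there: dropping the
  exceptional event changes the mean of D only by a quadratic error.\<close>

lemma m_bound: "norm m \<le> norm (\<integral>\<omega>. D \<omega> \<partial>M) + 2 * M2"
proof -
  let ?C = "space M - E"
  have iC: "integrable M (\<lambda>\<omega>. indicator ?C \<omega> *\<^sub>R D \<omega>)"
    using int_D by (intro integrable_mult_indicator) auto
  have "m = (\<integral>\<omega>. D \<omega> - indicator ?C \<omega> *\<^sub>R D \<omega> \<partial>M)"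
    unfolding m_def by (rule Bochner_Integration.integral_cong) (auto simp: indicator_def)
  also have "\<dots> = (\<integral>\<omega>. D \<omega> \<partial>M) - (\<integral>\<omega>. indicator ?C \<omega> *\<^sub>R D \<omega> \<partial>M)"
    by (rule Bochner_Integration.integral_diff[OF int_D iC])
  finally have "norm m \<le> norm (\<integral>\<omega>. D \<omega> \<partial>M) + norm (\<integral>\<omega>. indicator ?C \<omega> *\<^sub>R D \<omega> \<partial>M)"
    by (simp add: norm_triangle_ineq4)
  also have "norm (\<integral>\<omega>. indicator ?C \<omega> *\<^sub>R D \<omega> \<partial>M) \<le> (\<integral>\<omega>. norm (indicator ?C \<omega> *\<^sub>R D \<omega>) \<partial>M)"
    by (rule integral_norm_bound)
  also have "\<dots> \<le> (\<integral>\<omega>. 2 * (norm (D \<omega>))\<^sup>2 \<partial>M)"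
  proof (rule integral_mono)
    fix \<omega> assume "\<omega> \<in> space M"
    have "norm (D \<omega>) \<le> 2 * (norm (D \<omega>))\<^sup>2" if "\<omega> \<in> ?C"
      using mult_right_mono[of "1/2" "norm (D \<omega>)" "norm (D \<omega>)"] outside_E[OF that] by (simp add: power2_eq_square)
    then show "norm (indicator ?C \<omega> *\<^sub>R D \<omega>) \<le> 2 * (norm (D \<omega>))\<^sup>2" by (auto simp: indicator_def)
  qed (use integrable_norm[OF iC] int_D2 in auto)
  finally show ?thesis by (simp add: M2_def)
qed

text \<open>The signed difference between the restricted law and \<open>gauss\<close> scaled to the
  same mass; its squared integral is the unnormalised chi-square divergence.\<close>

definition "g x = p x - prob E"
definition "rem \<omega> x = indicator E \<omega> * (rel_density (D \<omega>) x - 1 - first_order (D \<omega>) x)"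
definition "r x = (\<integral>\<omega>. rem \<omega> x \<partial>M)"

lemma rem_meas [measurable]: "(\<lambda>z. rem (fst z) (snd z)) \<in> borel_measurable (M \<Otimes>\<^sub>M borel)"
  "(\<lambda>\<omega>. rem \<omega> x) \<in> borel_measurable M"
  unfolding rem_def[abs_def] by measurable

lemma int_first_order: "integrable M (\<lambda>\<omega>. indicator E \<omega> * first_order (D \<omega>) x)"
  "(\<integral>\<omega>. indicator E \<omega> * first_order (D \<omega>) x \<partial>M) = first_order m x"
proof -
  have e: "indicator E \<omega> * first_order (D \<omega>) x = first_order (indicator E \<omega> *\<^sub>R D \<omega>) x" for \<omega>
    using linear_scale[OF bounded_linear.linear[OF first_order_linear], where b="D \<omega>"] by simp
  show "integrable M (\<lambda>\<omega>. indicator E \<omega> * first_order (D \<omega>) x)"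
    unfolding e by (rule integrable_bounded_linear[OF first_order_linear int_ED])
  show "(\<integral>\<omega>. indicator E \<omega> * first_order (D \<omega>) x \<partial>M) = first_order m x"
    unfolding e m_def by (rule integral_bounded_linear[OF first_order_linear int_ED])
qed

lemma rem_eq: "rem \<omega> x = w \<omega> x - indicator E \<omega> - indicator E \<omega> * first_order (D \<omega>) x"
  by (simp add: rem_def w_def algebra_simps)

lemma int_rem: "integrable M (\<lambda>\<omega>. rem \<omega> x)"
  unfolding rem_eq by (intro Bochner_Integration.integrable_diff int_w int_first_order) (simp add: less_top[symmetric])

lemma g_eq: "g x = first_order m x + r x"
proof -
  have "r x = p x - prob E - first_order m x"
    unfolding r_def rem_eq p_def
    by (subst Bochner_Integration.integral_diff Bochner_Integration.integral_diff[OF int_w],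
        auto intro!: int_w int_first_order simp: int_first_order less_top[symmetric])+
  then show ?thesis by (simp add: g_def)
qed

lemma g_meas [measurable]: "g \<in> borel_measurable borel"
  unfolding g_def[abs_def] by measurable

lemma r_meas [measurable]: "r \<in> borel_measurable borel"
proof -
  have "r = (\<lambda>x. g x - first_order m x)" by (auto simp: g_eq)
  then show ?thesis by simp
qed

text \<open>The square of an average is at most the average of the squares; Fubini then makes
  \<open>remainder_bound\<close> applicable for each fixed \<omega>.\<close>

lemma r_sq: "integrable gauss (\<lambda>x. (r x)\<^sup>2)" "(\<integral>x. (r x)\<^sup>2 \<partial>gauss) \<le> M4 / 2"
proof -
  have "(\<integral>\<^sup>+x. ennreal ((r x)\<^sup>2) \<partial>gauss) \<le> (\<integral>\<^sup>+x. \<integral>\<^sup>+\<omega>. ennreal ((rem \<omega> x)\<^sup>2) \<partial>M \<partial>gauss)"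
  proof (rule nn_integral_mono)
    fix x
    show "ennreal ((r x)\<^sup>2) \<le> (\<integral>\<^sup>+\<omega>. ennreal ((rem \<omega> x)\<^sup>2) \<partial>M)"
    \<comment> \<open>If the squared remainder is not integrable at this \<open>x\<close>, the
      right-hand side is infinite.\<close>
    proof (cases "integrable M (\<lambda>\<omega>. (rem \<omega> x)\<^sup>2)")
      case True
      then have "(r x)\<^sup>2 \<le> (\<integral>\<omega>. (rem \<omega> x)\<^sup>2 \<partial>M)"
        unfolding r_def by (intro square_integral_le int_rem)
      then show ?thesis using True by (subst nn_integral_eq_integral) (auto intro: ennreal_leI)
    next
      case False
      then have "(\<integral>\<^sup>+\<omega>. ennreal ((rem \<omega> x)\<^sup>2) \<partial>M) = \<infinity>"
        by (auto simp: integrable_iff_bounded less_top[symmetric])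
      then show ?thesis by simp
    qed
  qed
  also have "\<dots> = (\<integral>\<^sup>+\<omega>. \<integral>\<^sup>+x. ennreal ((rem \<omega> x)\<^sup>2) \<partial>gauss \<partial>M)"
    by (rule Mg.Fubini') (auto simp: split_beta')
  also have "\<dots> \<le> (\<integral>\<^sup>+\<omega>. ennreal (norm (D \<omega>) ^ 4 / 2) \<partial>M)"
  proof (rule nn_integral_mono)
    fix \<omega>
    show "(\<integral>\<^sup>+x. ennreal ((rem \<omega> x)\<^sup>2) \<partial>gauss) \<le> ennreal (norm (D \<omega>) ^ 4 / 2)"
    proof (cases "\<omega> \<in> E")
      case True
      show ?thesis using remainder_bound[OF E_D[OF True]] True
        by (subst nn_integral_eq_integral) (auto simp: rem_def intro!: ennreal_leI)
    qed (simp add: rem_def)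
  qed
  also have "\<dots> = ennreal (M4 / 2)"
    using int_D4 by (subst nn_integral_eq_integral) (auto simp: M4_def)
  finally have le: "(\<integral>\<^sup>+x. ennreal ((r x)\<^sup>2) \<partial>gauss) \<le> ennreal (M4 / 2)" .
  show i: "integrable gauss (\<lambda>x. (r x)\<^sup>2)"
    by (rule integrableI_bounded) (use le in \<open>auto intro: order_le_less_trans\<close>)
  show "(\<integral>x. (r x)\<^sup>2 \<partial>gauss) \<le> M4 / 2"
    using le M4_nonneg by (subst (asm) nn_integral_eq_integral[OF i]) auto
qed

text \<open>An upper bound for the L2 norm of \<open>g\<close>: the first-order part has norm |m| /
  sqrt 2, bounded by \<open>m_bound\<close>, and the remainder at most sqrt (M4 / 2).\<close>

definition "\<eta> = (norm (\<integral>\<omega>. D \<omega> \<partial>M) + 2 * M2) / sqrt 2 + sqrt (M4 / 2)"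

lemma eta_nonneg: "0 \<le> \<eta>"
  unfolding \<eta>_def using M4_nonneg M2_nonneg by simp

lemma g_sq: "integrable gauss (\<lambda>x. (g x)\<^sup>2)" "(\<integral>x. (g x)\<^sup>2 \<partial>gauss) \<le> \<eta>\<^sup>2"
proof -
  have l: "integrable gauss (\<lambda>x. (first_order m x)\<^sup>2)" "(\<integral>x. (first_order m x)\<^sup>2 \<partial>gauss) \<le> ((norm (\<integral>\<omega>. D \<omega> \<partial>M) + 2 * M2) / sqrt 2)\<^sup>2"
  proof -
    have "(norm m)\<^sup>2 / 2 \<le> (norm (\<integral>\<omega>. D \<omega> \<partial>M) + 2 * M2)\<^sup>2 / 2"
      using m_bound by (simp add: power_mono)
    then show "integrable gauss (\<lambda>x. (first_order m x)\<^sup>2)" "(\<integral>x. (first_order m x)\<^sup>2 \<partial>gauss) \<le> ((norm (\<integral>\<omega>. D \<omega> \<partial>M) + 2 * M2) / sqrt 2)\<^sup>2"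
      using has_bochner_first_order(1)[OF m_sym] by (auto simp: has_bochner_integral_iff power_divide)
  qed
  have r: "(\<integral>x. (r x)\<^sup>2 \<partial>gauss) \<le> (sqrt (M4 / 2))\<^sup>2" using r_sq(2) M4_nonneg by simp
  note t = gauss.l2_triangle[OF _ _ l r_sq(1) r]
  show "integrable gauss (\<lambda>x. (g x)\<^sup>2)" "(\<integral>x. (g x)\<^sup>2 \<partial>gauss) \<le> \<eta>\<^sup>2"
    unfolding g_eq \<eta>_def using M4_nonneg M2_nonneg by (intro t; simp)+
qed

lemma prob_X_split:
  assumes [measurable]: "C \<in> sets borel"
  shows "measure (distr M borel X) C = (\<integral>x. indicator C x * p x \<partial>gauss) + prob (X -` C \<inter> (space M - E))"
proof -
  have "emeasure M (X -` C \<inter> E) = emeasure (distr (density M (indicator E)) borel X) C"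
  proof -
    have "X -` C \<inter> E = E \<inter> (X -` C \<inter> space M)" using sets.sets_into_space[OF E_meas] by auto
    then show ?thesis
      by (subst emeasure_distr, simp, simp, subst emeasure_density)
        (auto simp: indicator_inter_arith[symmetric])
  qed
  also have "\<dots> = (\<integral>\<^sup>+x. ennreal (indicator C x * p x) \<partial>gauss)"
    unfolding law_E by (subst emeasure_density) (auto intro!: nn_integral_cong split: split_indicator)
  finally have *: "(\<integral>\<^sup>+x. ennreal (indicator C x * p x) \<partial>gauss) = ennreal (prob (X -` C \<inter> E))"
    by (simp add: emeasure_eq_measure)
  have "prob (X -` C \<inter> E) = (\<integral>x. indicator C x * p x \<partial>gauss)"
    using * p_nonneg by (subst integral_eq_nn_integral) auto
  moreover have "prob (X -` C \<inter> space M) = prob (X -` C \<inter> E) + prob (X -` C \<inter> (space M - E))"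
  proof -
    have "X -` C \<inter> space M = (X -` C \<inter> E) \<union> (X -` C \<inter> (space M - E))" by (auto simp: E_def)
    moreover have "X -` C \<inter> E = (X -` C \<inter> space M) \<inter> E" by (auto simp: E_def)
    moreover have "X -` C \<inter> (space M - E) = (X -` C \<inter> space M) \<inter> (space M - E)" by auto
    ultimately show ?thesis
      by (subst finite_measure_Union[symmetric]) auto
  qed
  ultimately show ?thesis by (simp add: measure_distr)
qed

lemma tv_bound:
  assumes [measurable]: "C \<in> sets borel"
  shows "\<bar>measure (distr M borel X) C - measure gauss C\<bar> \<le> \<eta> + \<delta>"
proof -
  have ig: "integrable gauss g"
    using g_sq(1) by (rule gauss.square_integrable_imp_integrable[rotated]) simp
  have iC: "integrable gauss (\<lambda>x. indicator C x * g x)"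
    using integrable_mult_indicator[OF _ ig, of C] by simp
  have "\<bar>\<integral>x. indicator C x * g x \<partial>gauss\<bar> \<le> (\<integral>x. \<bar>g x\<bar> \<partial>gauss)"
  proof -
    have "norm (\<integral>x. indicator C x * g x \<partial>gauss) \<le> (\<integral>x. norm (indicator C x * g x) \<partial>gauss)"
      by (rule integral_norm_bound)
    also have "\<dots> \<le> (\<integral>x. \<bar>g x\<bar> \<partial>gauss)"
      using ig iC by (intro integral_mono) (auto simp: indicator_def)
    finally show ?thesis by simp
  qed
  also have "\<dots> \<le> \<eta>"
  proof (rule power2_le_imp_le[OF _ eta_nonneg])
    have "(\<integral>x. \<bar>g x\<bar> \<partial>gauss)\<^sup>2 \<le> (\<integral>x. \<bar>g x\<bar>\<^sup>2 \<partial>gauss)"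
      using ig g_sq by (intro gauss.square_integral_le) auto
    then show "(\<integral>x. \<bar>g x\<bar> \<partial>gauss)\<^sup>2 \<le> \<eta>\<^sup>2" using g_sq(2) by simp
  qed
  finally have 1: "\<bar>\<integral>x. indicator C x * g x \<partial>gauss\<bar> \<le> \<eta>" .
  have "(\<integral>x. indicator C x * p x \<partial>gauss) = (\<integral>x. indicator C x * g x + prob E * indicator C x \<partial>gauss)"
    by (rule Bochner_Integration.integral_cong) (auto simp: g_def algebra_simps)
  also have "\<dots> = (\<integral>x. indicator C x * g x \<partial>gauss) + prob E * measure gauss C"
    using iC by (subst Bochner_Integration.integral_add) (auto simp: less_top[symmetric])
  finally have 2: "(\<integral>x. indicator C x * p x \<partial>gauss) = (\<integral>x. indicator C x * g x \<partial>gauss) + prob E * measure gauss C" .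
  have pE: "prob E = 1 - \<delta>" unfolding \<delta>_def by (simp add: prob_compl)
  have X: "0 \<le> prob (X -` C \<inter> (space M - E))" "prob (X -` C \<inter> (space M - E)) \<le> \<delta>"
    unfolding \<delta>_def by (auto intro!: finite_measure_mono)
  have G: "0 \<le> \<delta> * measure gauss C" "\<delta> * measure gauss C \<le> \<delta>"
    using gauss.prob_le_1[of C] measure_nonneg[of M "space M - E"] by (auto simp: \<delta>_def mult_left_le)
  \<comment> \<open>Both terms in the last bracket lie in [0, \<delta>], so their difference costs
    \<delta> and not twice that.\<close>
  have "measure (distr M borel X) C - measure gauss C =
      (\<integral>x. indicator C x * g x \<partial>gauss) + (prob (X -` C \<inter> (space M - E)) - \<delta> * measure gauss C)"
    unfolding prob_X_split[OF assms] 2 pE by (simp add: algebra_simps)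
  then show ?thesis using 1 X G by linarith
qed

end

subsection \<open>Couplings\<close>

text \<open>With 1 - cos 2x = 2 (sin x)^2 this is the square of the difference quotient of sin at
  zero. The expressions are bounded functions of t, whose expectations can be read off a
  characteristic function.\<close>

lemma cos_second_order_limit: "(\<lambda>k. 2 * (real (Suc k))\<^sup>2 * (1 - cos (t / real (Suc k)))) \<longlonglongrightarrow> t\<^sup>2"
proof -
  define h where "h k = 1 / (2 * real (Suc k))" for k
  have "((\<lambda>x. sin (t * x)) has_real_derivative t) (at 0)"
    by (auto intro!: derivative_eq_intros)
  then have d: "((\<lambda>x. sin (t * x) / x) \<longlongrightarrow> t) (at 0)" by (simp add: DERIV_def)
  have "h \<longlonglongrightarrow> 0"
    unfolding h_def by real_asymp
  then have "filterlim h (at 0) sequentially"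
    by (rule filterlim_atI) (simp add: h_def)
  from filterlim_compose[OF d this] have "(\<lambda>k. sin (t * h k) / h k) \<longlonglongrightarrow> t" .
  then have "(\<lambda>k. (sin (t * h k) / h k)\<^sup>2) \<longlonglongrightarrow> t\<^sup>2" by (rule tendsto_power)
  moreover have "(sin (t * h k) / h k)\<^sup>2 = 2 * (real (Suc k))\<^sup>2 * (1 - cos (t / real (Suc k)))" for k
  proof -
    have "t / real (Suc k) = 2 * (t * h k)" unfolding h_def by (simp del: of_nat_Suc)
    then have "1 - cos (t / real (Suc k)) = 2 * (sin (t * h k))\<^sup>2"
      by (simp only: cos_double_sin)
    then show ?thesis by (simp add: h_def power_mult_distrib del: of_nat_Suc)
  qed
  ultimately show ?thesis by simp
qed

lemma trace_eq_inner: "trace (D :: real^'n^'n) = mat 1 \<bullet> D"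
  by (simp add: trace_def inner_vec_def mat_def if_distrib[of "\<lambda>x. x * _"] sum.delta cong: if_cong)

lemma trace_le_norm: "trace (D :: real^'n^'n) \<le> sqrt (real CARD('n)) * norm D"
proof -
  have "(norm (mat 1 :: real^'n^'n))\<^sup>2 = real CARD('n)"
    unfolding power2_norm_eq_inner trace_eq_inner[symmetric] by (simp add: trace_def mat_def)
  then have "norm (mat 1 :: real^'n^'n) = sqrt (real CARD('n))"
    by (metis norm_ge_zero real_sqrt_unique)
  then show ?thesis unfolding trace_eq_inner by (metis norm_cauchy_schwarz)
qed

lemma ent_le_square: "0 < u \<Longrightarrow> ent u \<le> (u - 1)\<^sup>2"
proof -
  assume u: "0 < u"
  have "u * ln u \<le> u * (u - 1)" using u ln_le_minus_one[OF u] by (intro mult_left_mono) auto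
  then show ?thesis by (simp add: ent_def power2_eq_square algebra_simps)
qed

context conditional_gaussian
begin

text \<open>The second moment of \<open>X\<close> is extracted from its characteristic function. The
  expectation of n^2 times 2 - 2 cos (X_i / n) is that of the same expression with exp (- B_ii / (2
  n^2)) for the cosine, hence at most that of B_ii because 1 - exp (-x) \<le> x. Fatou's lemma
  passes to the limit.\<close>

lemma second_moment_coord:
  assumes C: "C \<in> sets \<F>"
  shows "(\<integral>\<^sup>+\<omega>. indicator C \<omega> * ennreal ((X \<omega> $ i)\<^sup>2) \<partial>M) \<le> (\<integral>\<^sup>+\<omega>. indicator C \<omega> * ennreal (B \<omega> $ i $ i) \<partial>M)"
proof -
  have [measurable]: "C \<in> sets M" using C by (rule F_sets)
  define f where "f k t = 2 * (real (Suc k))\<^sup>2 * (1 - cos (t / real (Suc k)))" for k t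
  have f0: "0 \<le> f k t" for k t unfolding f_def by simp
  have bii: "axis i c \<bullet> (B \<omega> *v axis i c) = c\<^sup>2 * B \<omega> $ i $ i" for \<omega> c
    by (simp add: inner_axis' matrix_vector_mul_component inner_axis power2_eq_square mult_ac)
  have pos: "0 \<le> B \<omega> $ i $ i" if "\<omega> \<in> space M" for \<omega>
    using cov_nonneg[OF that, of "axis i 1"] unfolding bii by simp
  have le: "(\<integral>\<^sup>+\<omega>. indicator C \<omega> * ennreal (f k (X \<omega> $ i)) \<partial>M) \<le> (\<integral>\<^sup>+\<omega>. indicator C \<omega> * ennreal (B \<omega> $ i $ i) \<partial>M)" for k
  proof -
    let ?n = "real (Suc k)"
    let ?y = "axis i (1 / ?n) :: real^'n"
    have "integrable M (\<lambda>\<omega>. indicator C \<omega> *\<^sub>R iex (?y \<bullet> X \<omega>))"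
      by (rule integrable_const_bound[of _ 1]) (auto simp: indicator_def)
    then have "Re (\<integral>\<omega>. indicator C \<omega> *\<^sub>R iex (?y \<bullet> X \<omega>) \<partial>M) = (\<integral>\<omega>. Re (indicator C \<omega> *\<^sub>R iex (?y \<bullet> X \<omega>)) \<partial>M)"
      by (rule integral_Re[symmetric])
    also have "\<dots> = (\<integral>\<omega>. indicator C \<omega> * cos (X \<omega> $ i / ?n) \<partial>M)"
      by (intro Bochner_Integration.integral_cong refl) (simp add: Re_exp inner_axis')
    finally have cf: "(\<integral>\<omega>. indicator C \<omega> * cos (X \<omega> $ i / ?n) \<partial>M) = (\<integral>\<omega>. indicator C \<omega> * exp (- (?y \<bullet> (B \<omega> *v ?y)) / 2) \<partial>M)"
      unfolding restricted_cf[OF C] by simp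
    have ic: "integrable M (\<lambda>\<omega>. indicator C \<omega> * cos (X \<omega> $ i / ?n))"
      by (rule integrable_const_bound[of _ 1]) (auto simp: indicator_def)
    have ie: "integrable M (\<lambda>\<omega>. indicator C \<omega> * exp (- (?y \<bullet> (B \<omega> *v ?y)) / 2))"
      by (rule integrable_const_bound[of _ 1]) (auto simp: indicator_def cov_nonneg)
    have i1: "integrable M (\<lambda>\<omega>. indicator C \<omega> :: real)" by (simp add: less_top[symmetric])
    have idf: "integrable M (\<lambda>\<omega>. 2 * ?n\<^sup>2 * (indicator C \<omega> - indicator C \<omega> * cos (X \<omega> $ i / ?n)))"
      using i1 ic by (intro integrable_mult_right Bochner_Integration.integrable_diff)
    have "(\<integral>\<^sup>+\<omega>. indicator C \<omega> * ennreal (f k (X \<omega> $ i)) \<partial>M) = (\<integral>\<^sup>+\<omega>. ennreal (2 * ?n\<^sup>2 * (indicator C \<omega> - indicator C \<omega> * cos (X \<omega> $ i / ?n))) \<partial>M)"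
      by (intro nn_integral_cong) (simp add: f_def split: split_indicator)
    also have "\<dots> = ennreal (\<integral>\<omega>. 2 * ?n\<^sup>2 * (indicator C \<omega> - indicator C \<omega> * cos (X \<omega> $ i / ?n)) \<partial>M)"
      by (intro nn_integral_eq_integral idf) (auto split: split_indicator)
    also have "(\<integral>\<omega>. 2 * ?n\<^sup>2 * (indicator C \<omega> - indicator C \<omega> * cos (X \<omega> $ i / ?n)) \<partial>M)
        = 2 * ?n\<^sup>2 * ((\<integral>\<omega>. indicator C \<omega> \<partial>M) - (\<integral>\<omega>. indicator C \<omega> * exp (- (?y \<bullet> (B \<omega> *v ?y)) / 2) \<partial>M))"
      unfolding integral_mult_right_zero Bochner_Integration.integral_diff[OF i1 ic] cf ..
    also have "\<dots> = (\<integral>\<omega>. 2 * ?n\<^sup>2 * (indicator C \<omega> - indicator C \<omega> * exp (- (?y \<bullet> (B \<omega> *v ?y)) / 2)) \<partial>M)"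
      unfolding integral_mult_right_zero Bochner_Integration.integral_diff[OF i1 ie] ..
    also have "ennreal \<dots> = (\<integral>\<^sup>+\<omega>. ennreal (2 * ?n\<^sup>2 * (indicator C \<omega> - indicator C \<omega> * exp (- (?y \<bullet> (B \<omega> *v ?y)) / 2))) \<partial>M)"
      by (intro nn_integral_eq_integral[symmetric] integrable_mult_right Bochner_Integration.integrable_diff i1 ie)
        (auto simp: cov_nonneg split: split_indicator)
    also have "\<dots> \<le> (\<integral>\<^sup>+\<omega>. indicator C \<omega> * ennreal (B \<omega> $ i $ i) \<partial>M)"
    proof (rule nn_integral_mono)
      fix \<omega>
      define b where "b = B \<omega> $ i $ i"
      have "1 - exp (- ((1 / ?n)\<^sup>2 * b) / 2) \<le> (1 / ?n)\<^sup>2 * b / 2"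
        using exp_ge_add_one_self[of "- ((1 / ?n)\<^sup>2 * b) / 2"] by simp
      then have "2 * ?n\<^sup>2 * (1 - exp (- ((1 / ?n)\<^sup>2 * b) / 2)) \<le> 2 * ?n\<^sup>2 * ((1 / ?n)\<^sup>2 * b / 2)"
        by (intro mult_left_mono) auto
      also have "\<dots> = b" by (simp add: power_divide)
      finally show "ennreal (2 * ?n\<^sup>2 * (indicator C \<omega> - indicator C \<omega> * exp (- (?y \<bullet> (B \<omega> *v ?y)) / 2))) \<le> indicator C \<omega> * ennreal (B \<omega> $ i $ i)"
        unfolding bii b_def[symmetric] by (auto intro: ennreal_leI split: split_indicator)
    qed
    finally show ?thesis .
  qed
  have "(\<integral>\<^sup>+\<omega>. indicator C \<omega> * ennreal ((X \<omega> $ i)\<^sup>2) \<partial>M) = (\<integral>\<^sup>+\<omega>. liminf (\<lambda>k. indicator C \<omega> * ennreal (f k (X \<omega> $ i))) \<partial>M)"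
  proof (intro nn_integral_cong)
    fix \<omega>
    have "(\<lambda>k. indicator C \<omega> * ennreal (f k (X \<omega> $ i))) \<longlonglongrightarrow> indicator C \<omega> * ennreal ((X \<omega> $ i)\<^sup>2)"
      using tendsto_ennrealI[OF cos_second_order_limit[of "X \<omega> $ i"]] by (auto simp: f_def split: split_indicator)
    then show "indicator C \<omega> * ennreal ((X \<omega> $ i)\<^sup>2) = liminf (\<lambda>k. indicator C \<omega> * ennreal (f k (X \<omega> $ i)))"
      by (intro lim_imp_Liminf[symmetric]) auto
  qed
  also have "\<dots> \<le> liminf (\<lambda>k. \<integral>\<^sup>+\<omega>. indicator C \<omega> * ennreal (f k (X \<omega> $ i)) \<partial>M)"
    by (rule nn_integral_liminf) (simp add: f_def)
  also have "\<dots> \<le> liminf (\<lambda>k::nat. \<integral>\<^sup>+\<omega>. indicator C \<omega> * ennreal (B \<omega> $ i $ i) \<partial>M)"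
    using le by (intro Liminf_mono always_eventually) auto
  finally show ?thesis by (simp add: Liminf_const)
qed

lemma second_moment:
  assumes C: "C \<in> sets \<F>"
  shows "(\<integral>\<^sup>+\<omega>. indicator C \<omega> * ennreal ((norm (X \<omega>))\<^sup>2) \<partial>M) \<le> (\<integral>\<^sup>+\<omega>. indicator C \<omega> * ennreal (real CARD('n) + sqrt (real CARD('n)) * norm (D \<omega>)) \<partial>M)"
proof -
  have [measurable]: "C \<in> sets M" using C by (rule F_sets)
  have pos: "0 \<le> B \<omega> $ i $ i" if "\<omega> \<in> space M" for \<omega> i
    using cov_nonneg[OF that, of "axis i 1"] by (simp add: inner_axis' matrix_vector_mul_component inner_axis)
  have "(\<integral>\<^sup>+\<omega>. indicator C \<omega> * ennreal ((norm (X \<omega>))\<^sup>2) \<partial>M) = (\<integral>\<^sup>+\<omega>. (\<Sum>i\<in>UNIV. indicator C \<omega> * ennreal ((X \<omega> $ i)\<^sup>2)) \<partial>M)"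
    by (intro nn_integral_cong) (simp add: norm_vec_sq sum_distrib_left[symmetric])
  also have "\<dots> = (\<Sum>i\<in>UNIV. \<integral>\<^sup>+\<omega>. indicator C \<omega> * ennreal ((X \<omega> $ i)\<^sup>2) \<partial>M)"
    by (rule nn_integral_sum) simp
  also have "\<dots> \<le> (\<Sum>i\<in>UNIV. \<integral>\<^sup>+\<omega>. indicator C \<omega> * ennreal (B \<omega> $ i $ i) \<partial>M)"
    by (intro sum_mono second_moment_coord C)
  also have "\<dots> = (\<integral>\<^sup>+\<omega>. (\<Sum>i\<in>UNIV. indicator C \<omega> * ennreal (B \<omega> $ i $ i)) \<partial>M)"
    by (rule nn_integral_sum[symmetric]) simp
  also have "\<dots> \<le> (\<integral>\<^sup>+\<omega>. indicator C \<omega> * ennreal (real CARD('n) + sqrt (real CARD('n)) * norm (D \<omega>)) \<partial>M)"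
  proof (rule nn_integral_mono)
    fix \<omega> assume w: "\<omega> \<in> space M"
    have "trace (B \<omega>) = real CARD('n) + trace (D \<omega>)"
      by (simp add: D_def trace_def mat_def sum_subtractf)
    then have "(\<Sum>i\<in>UNIV. B \<omega> $ i $ i) \<le> real CARD('n) + sqrt (real CARD('n)) * norm (D \<omega>)"
      using trace_le_norm[of "D \<omega>"] by (simp add: trace_def)
    then have "ennreal (\<Sum>i\<in>UNIV. B \<omega> $ i $ i) \<le> ennreal (real CARD('n) + sqrt (real CARD('n)) * norm (D \<omega>))"
      by (rule ennreal_leI)
    then show "(\<Sum>i\<in>UNIV. indicator C \<omega> * ennreal (B \<omega> $ i $ i)) \<le> indicator C \<omega> * ennreal (real CARD('n) + sqrt (real CARD('n)) * norm (D \<omega>))"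
      using pos[OF w] by (simp add: sum_distrib_left[symmetric] sum_ennreal split: split_indicator)
  qed
  finally show ?thesis .
qed

text \<open>The additional \<open>CARD('n)\<close> is the second moment of the independent Gaussian
  partner, see \<open>gauss_dist_sq\<close>.\<close>

lemma second_moment':
  assumes C: "C \<in> sets \<F>"
  shows "(\<integral>\<^sup>+\<omega>. indicator C \<omega> * ennreal ((norm (X \<omega>))\<^sup>2 + real CARD('n)) \<partial>M) \<le> (\<integral>\<^sup>+\<omega>. indicator C \<omega> * ennreal (2 * real CARD('n) + sqrt (real CARD('n)) * norm (D \<omega>)) \<partial>M)"
proof -
  have [measurable]: "C \<in> sets M" using C by (rule F_sets)
  have "(\<integral>\<^sup>+\<omega>. indicator C \<omega> * ennreal ((norm (X \<omega>))\<^sup>2 + real CARD('n)) \<partial>M)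
     = (\<integral>\<^sup>+\<omega>. indicator C \<omega> * ennreal ((norm (X \<omega>))\<^sup>2) + indicator C \<omega> * ennreal (real CARD('n)) \<partial>M)"
    by (intro nn_integral_cong) (auto split: split_indicator)
  also have "\<dots> = (\<integral>\<^sup>+\<omega>. indicator C \<omega> * ennreal ((norm (X \<omega>))\<^sup>2) \<partial>M) + (\<integral>\<^sup>+\<omega>. indicator C \<omega> * ennreal (real CARD('n)) \<partial>M)"
    by (rule nn_integral_add) auto
  also have "\<dots> \<le> (\<integral>\<^sup>+\<omega>. indicator C \<omega> * ennreal (real CARD('n) + sqrt (real CARD('n)) * norm (D \<omega>)) \<partial>M) + (\<integral>\<^sup>+\<omega>. indicator C \<omega> * ennreal (real CARD('n)) \<partial>M)"
    by (intro add_right_mono second_moment C)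
  also have "\<dots> = (\<integral>\<^sup>+\<omega>. indicator C \<omega> * ennreal (real CARD('n) + sqrt (real CARD('n)) * norm (D \<omega>)) + indicator C \<omega> * ennreal (real CARD('n)) \<partial>M)"
    by (rule nn_integral_add[symmetric]) auto
  also have "\<dots> = (\<integral>\<^sup>+\<omega>. indicator C \<omega> * ennreal (2 * real CARD('n) + sqrt (real CARD('n)) * norm (D \<omega>)) \<partial>M)"
    by (intro nn_integral_cong) (auto simp: ennreal_plus[symmetric] simp del: ennreal_plus split: split_indicator)
  finally show ?thesis .
qed

text \<open>The first component is transported by \<open>T\<close> from an independent standard Gaussian vector on the event
  \<open>A\<close>, and it is independent of that vector outside \<open>A\<close>.\<close>

lemma mixed_coupling:
  assumes [measurable]: "A \<in> sets M" "T \<in> borel_measurable borel"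
    and law: "\<And>C. C \<in> sets borel \<Longrightarrow> emeasure M (X -` C \<inter> A) = emeasure M A * emeasure gauss (T -` C)"
  shows "\<exists>\<pi>\<in>couplings (distr M borel X) gauss.
    (\<integral>\<^sup>+z. ennreal ((norm (fst z - snd z))\<^sup>2) \<partial>\<pi>) =
      emeasure M A * (\<integral>\<^sup>+x. ennreal ((norm (T x - x))\<^sup>2) \<partial>gauss)
      + (\<integral>\<^sup>+\<omega>. indicator (space M - A) \<omega> * ennreal ((norm (X \<omega>))\<^sup>2 + real CARD('n)) \<partial>M)"
proof -
  define h where "h z = (if fst z \<in> A then T (snd z) else X (fst z), snd z)" for z
  have [measurable]: "Measurable.pred (M \<Otimes>\<^sub>M gauss) (\<lambda>z. fst z \<in> A)"
    by (rule measurable_compose[OF measurable_fst]) measurable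
  have h_meas [measurable]: "h \<in> measurable (M \<Otimes>\<^sub>M gauss) (borel \<Otimes>\<^sub>M borel)"
    unfolding h_def by measurable
  define \<pi> where "\<pi> = distr (M \<Otimes>\<^sub>M gauss) (borel \<Otimes>\<^sub>M borel) h"
  have int: "(\<integral>\<^sup>+z. f (h z) \<partial>(M \<Otimes>\<^sub>M gauss)) = emeasure M A * (\<integral>\<^sup>+x. f (T x, x) \<partial>gauss)
      + (\<integral>\<^sup>+\<omega>. indicator (space M - A) \<omega> * (\<integral>\<^sup>+x. f (X \<omega>, x) \<partial>gauss) \<partial>M)"
    if [measurable]: "f \<in> borel_measurable (borel \<Otimes>\<^sub>M borel)" for f :: "(real^'n) \<times> (real^'n) \<Rightarrow> ennreal"
  proof -
    have "(\<integral>\<^sup>+z. f (h z) \<partial>(M \<Otimes>\<^sub>M gauss)) = (\<integral>\<^sup>+\<omega>. \<integral>\<^sup>+x. f (h (\<omega>, x)) \<partial>gauss \<partial>M)"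
      by (rule gauss.nn_integral_fst[symmetric]) measurable
    also have "\<dots> = (\<integral>\<^sup>+\<omega>. indicator A \<omega> * (\<integral>\<^sup>+x. f (T x, x) \<partial>gauss) + indicator (space M - A) \<omega> * (\<integral>\<^sup>+x. f (X \<omega>, x) \<partial>gauss) \<partial>M)"
      by (intro nn_integral_cong) (simp add: h_def split: split_indicator)
    also have "\<dots> = (\<integral>\<^sup>+\<omega>. indicator A \<omega> * (\<integral>\<^sup>+x. f (T x, x) \<partial>gauss) \<partial>M) + (\<integral>\<^sup>+\<omega>. indicator (space M - A) \<omega> * (\<integral>\<^sup>+x. f (X \<omega>, x) \<partial>gauss) \<partial>M)"
      by (rule nn_integral_add) measurable
    also have "(\<integral>\<^sup>+\<omega>. indicator A \<omega> * (\<integral>\<^sup>+x. f (T x, x) \<partial>gauss) \<partial>M) = emeasure M A * (\<integral>\<^sup>+x. f (T x, x) \<partial>gauss)"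
      by (subst nn_integral_multc) auto
    finally show ?thesis .
  qed
  have "\<pi> \<in> couplings (distr M borel X) gauss"
    unfolding couplings_def
  proof (intro CollectI conjI)
    show "prob_space \<pi>" unfolding \<pi>_def by (intro Mg.prob_space_distr h_meas)
    show "sets \<pi> = sets (borel \<Otimes>\<^sub>M borel)" by (simp add: \<pi>_def)
    show "distr \<pi> borel fst = distr M borel X"
    proof (rule measure_eqI)
      fix C assume "C \<in> sets (distr \<pi> borel fst)"
      then have [measurable]: "C \<in> sets borel" by simp
      have "emeasure (distr \<pi> borel fst) C = (\<integral>\<^sup>+z. indicator C (fst (h z)) \<partial>(M \<Otimes>\<^sub>M gauss))"
        unfolding \<pi>_def
        by (subst distr_distr) (auto simp: comp_def nn_integral_distr nn_integral_indicator[symmetric] simp del: nn_integral_indicator)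
      also have "\<dots> = emeasure M A * (\<integral>\<^sup>+x. indicator C (T x) \<partial>gauss) + (\<integral>\<^sup>+\<omega>. indicator (space M - A) \<omega> * indicator C (X \<omega>) \<partial>M)"
        using int[of "\<lambda>z. indicator C (fst z)"] by simp
      also have "(\<integral>\<^sup>+x. indicator C (T x) \<partial>gauss) = emeasure gauss (T -` C)"
      proof -
        have [measurable]: "T -` C \<in> sets borel" using measurable_sets[OF assms(2), of C] by simp
        have "(\<integral>\<^sup>+x. indicator C (T x) \<partial>gauss) = (\<integral>\<^sup>+x. indicator (T -` C) x \<partial>gauss)"
          by (intro nn_integral_cong) (auto split: split_indicator)
        then show ?thesis by simp
      qed
      \<comment> \<open>This is where the hypothesis on the law is used: given the event,
        \<open>X\<close> has the law of \<open>T\<close> applied to a standard Gaussian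
        vector.\<close>
      also have "emeasure M A * emeasure gauss (T -` C) = (\<integral>\<^sup>+\<omega>. indicator A \<omega> * indicator C (X \<omega>) \<partial>M)"
      proof -
        have "X -` C \<inter> A = A \<inter> (X -` C \<inter> space M)" using sets.sets_into_space[OF assms(1)] by auto
        then have [measurable]: "X -` C \<inter> A \<in> sets M" by simp
        have "(\<integral>\<^sup>+\<omega>. indicator A \<omega> * indicator C (X \<omega>) \<partial>M) = (\<integral>\<^sup>+\<omega>. indicator (X -` C \<inter> A) \<omega> \<partial>M)"
          by (intro nn_integral_cong) (auto split: split_indicator)
        then show ?thesis using law[of C] by simp
      qed
      also have "(\<integral>\<^sup>+\<omega>. indicator A \<omega> * indicator C (X \<omega>) \<partial>M) + (\<integral>\<^sup>+\<omega>. indicator (space M - A) \<omega> * indicator C (X \<omega>) \<partial>M)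
          = (\<integral>\<^sup>+\<omega>. indicator C (X \<omega>) \<partial>M)"
        by (subst nn_integral_add[symmetric]) (auto intro!: nn_integral_cong split: split_indicator)
      also have "\<dots> = emeasure (distr M borel X) C"
        by (simp add: nn_integral_distr nn_integral_indicator[symmetric] del: nn_integral_indicator)
      finally show "emeasure (distr \<pi> borel fst) C = emeasure (distr M borel X) C" .
    qed simp
    show "distr \<pi> borel snd = gauss"
    proof (rule measure_eqI)
      fix C assume "C \<in> sets (distr \<pi> borel snd)"
      then have [measurable]: "C \<in> sets borel" by simp
      have "emeasure (distr \<pi> borel snd) C = (\<integral>\<^sup>+z. indicator C (snd (h z)) \<partial>(M \<Otimes>\<^sub>M gauss))"
        unfolding \<pi>_def
        by (subst distr_distr) (auto simp: comp_def nn_integral_distr nn_integral_indicator[symmetric] simp del: nn_integral_indicator)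
      also have "\<dots> = (\<integral>\<^sup>+\<omega>. \<integral>\<^sup>+x. indicator C x \<partial>gauss \<partial>M)"
        by (subst gauss.nn_integral_fst[symmetric]) (auto simp: h_def)
      also have "\<dots> = emeasure gauss C" by (simp add: emeasure_space_1)
      finally show "emeasure (distr \<pi> borel snd) C = emeasure gauss C" .
    qed simp
  qed
  moreover have "(\<integral>\<^sup>+z. ennreal ((norm (fst z - snd z))\<^sup>2) \<partial>\<pi>) = emeasure M A * (\<integral>\<^sup>+x. ennreal ((norm (T x - x))\<^sup>2) \<partial>gauss)
      + (\<integral>\<^sup>+\<omega>. indicator (space M - A) \<omega> * ennreal ((norm (X \<omega>))\<^sup>2 + real CARD('n)) \<partial>M)"
    unfolding \<pi>_def using int[of "\<lambda>z. ennreal ((norm (fst z - snd z))\<^sup>2)"]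
    by (subst nn_integral_distr, measurable) (simp add: gauss_dist_sq del: ennreal_plus)
  ultimately show ?thesis by blast
qed

lemma coupling_small_delta:
  assumes "\<delta> \<le> 1/2"
  shows "\<exists>\<pi>\<in>couplings (distr M borel X) gauss.
    (\<integral>\<^sup>+z. ennreal ((norm (fst z - snd z))\<^sup>2) \<partial>\<pi>) \<le> ennreal (4 * \<eta>\<^sup>2 + 40 * real CARD('n) * M4)"
proof -
  have pE: "1/2 \<le> prob E" using assms by (simp add: \<delta>_def prob_compl)
  \<comment> \<open>Talagrand's inequality is available for positive densities; here positivity
    holds because \<open>E\<close> has positive probability and every \<open>rel_density\<close> on
    it is positive.\<close>
  have p_pos: "0 < p x" for x
  proof (rule ccontr)
    assume "\<not> 0 < p x"
    then have "p x = 0" using p_nonneg[of x] by simp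
    then have "AE \<omega> in M. w \<omega> x = 0"
      unfolding p_def by (subst (asm) integral_nonneg_eq_0_iff_AE) (auto simp: int_w w_nonneg)
    then have "AE \<omega> in M. \<omega> \<notin> E"
    proof eventually_elim
      case (elim \<omega>)
      show ?case
      proof
        assume "\<omega> \<in> E"
        then show False using elim rel_density_pos[OF E_D[of \<omega>], of x] by (simp add: w_def)
      qed
    qed
    then have "prob E = 0" by (simp add: prob_eq_0)
    then show False using pE by simp
  qed
  define f where "f x = p x / prob E" for x
  have [measurable]: "f \<in> borel_measurable borel" unfolding f_def by measurable
  have f_pos: "0 < f x" for x unfolding f_def using p_pos pE by simp
  have p_f: "ennreal (p x) = ennreal (prob E) * ennreal (f x)" for x
    using pE f_pos[of x] by (subst ennreal_mult[symmetric]) (auto simp: f_def less_imp_le)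
  have "continuous_on UNIV f" unfolding f_def using pE by (intro continuous_intros p_cont) auto
  moreover have "f x \<le> (2 ^ CARD('n) / prob E) * exp ((norm x)\<^sup>2 / 6)" for x
    unfolding f_def using p_bound[of x] pE by (simp add: divide_right_mono)
  moreover have "(\<integral>\<^sup>+x. ennreal (f x) \<partial>gauss) = 1"
  proof -
    have "ennreal (prob E) * (\<integral>\<^sup>+x. ennreal (f x) \<partial>gauss) = ennreal (prob E) * 1"
      using nn_integral_p unfolding p_f by (subst (asm) nn_integral_cmult) (auto simp: emeasure_eq_measure)
    then show ?thesis using pE by (subst (asm) ennreal_mult_cancel_left) (auto simp: ennreal_eq_0_iff)
  qed
  ultimately obtain T where [measurable]: "T \<in> borel_measurable borel"
    and T: "distr gauss borel T = density gauss (\<lambda>x. ennreal (f x))"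
    and cost: "(\<integral>\<^sup>+x. ennreal ((norm (T x - x))\<^sup>2) \<partial>gauss) \<le> (\<integral>\<^sup>+x. ennreal (2 * ent (f x)) \<partial>gauss)"
    using talagrand_gauss[of f "2 ^ CARD('n) / prob E"] f_pos by blast
  have law: "emeasure M (X -` C \<inter> E) = emeasure M E * emeasure gauss (T -` C)" if [measurable]: "C \<in> sets borel" for C
  proof -
    have "X -` C \<inter> E = E \<inter> (X -` C \<inter> space M)" using sets.sets_into_space[OF E_meas] by auto
    then have "emeasure M (X -` C \<inter> E) = emeasure (distr (density M (indicator E)) borel X) C"
      by (subst emeasure_distr, simp, simp, subst emeasure_density) (auto simp: indicator_inter_arith[symmetric])
    also have "\<dots> = (\<integral>\<^sup>+x. ennreal (p x) * indicator C x \<partial>gauss)"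
      unfolding law_E by (subst emeasure_density) auto
    also have "\<dots> = ennreal (prob E) * (\<integral>\<^sup>+x. ennreal (f x) * indicator C x \<partial>gauss)"
      unfolding p_f mult.assoc by (rule nn_integral_cmult) measurable
    also have "(\<integral>\<^sup>+x. ennreal (f x) * indicator C x \<partial>gauss) = emeasure (distr gauss borel T) C"
      unfolding T by (subst emeasure_density) auto
    also have "\<dots> = emeasure gauss (T -` C)" by (subst emeasure_distr) auto
    finally show ?thesis by (simp add: emeasure_eq_measure)
  qed
  obtain \<pi> where \<pi>: "\<pi> \<in> couplings (distr M borel X) gauss"
    and c: "(\<integral>\<^sup>+z. ennreal ((norm (fst z - snd z))\<^sup>2) \<partial>\<pi>) =
      emeasure M E * (\<integral>\<^sup>+x. ennreal ((norm (T x - x))\<^sup>2) \<partial>gauss)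
      + (\<integral>\<^sup>+\<omega>. indicator (space M - E) \<omega> * ennreal ((norm (X \<omega>))\<^sup>2 + real CARD('n)) \<partial>M)"
    using mixed_coupling[OF E_meas _ law] by auto
  have "emeasure M E * (\<integral>\<^sup>+x. ennreal ((norm (T x - x))\<^sup>2) \<partial>gauss) \<le> ennreal (prob E) * (\<integral>\<^sup>+x. ennreal (2 * ent (f x)) \<partial>gauss)"
    using cost by (simp add: emeasure_eq_measure mult_left_mono)
  also have "\<dots> = (\<integral>\<^sup>+x. ennreal (prob E) * ennreal (2 * ent (f x)) \<partial>gauss)"
    by (rule nn_integral_cmult[symmetric]) measurable
  also have "\<dots> \<le> (\<integral>\<^sup>+x. ennreal (4 * (g x)\<^sup>2) \<partial>gauss)"
  proof (rule nn_integral_mono)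
    fix x
    \<comment> \<open>The entropy is replaced by the chi-square integrand. As f - 1 = g /
      \<open>prob E\<close>, one power of \<open>prob E\<close> is left in the denominator, and
      \<open>prob E\<close> \<ge> 1/2 turns 2 into 4.\<close>
    have "prob E * (2 * ent (f x)) \<le> prob E * (2 * (f x - 1)\<^sup>2)"
      using ent_le_square[OF f_pos] by (intro mult_left_mono) auto
    also have "f x - 1 = g x / prob E" using pE by (simp add: f_def g_def field_simps)
    also have "prob E * (2 * (g x / prob E)\<^sup>2) = (2 / prob E) * (g x)\<^sup>2"
      using pE by (simp add: power2_eq_square field_simps)
    also have "\<dots> \<le> 4 * (g x)\<^sup>2" using pE by (intro mult_right_mono) (auto simp: field_simps)
    finally show "ennreal (prob E) * ennreal (2 * ent (f x)) \<le> ennreal (4 * (g x)\<^sup>2)"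
      by (subst ennreal_mult'[symmetric]) (auto intro: ennreal_leI)
  qed
  also have "\<dots> = ennreal (4 * (\<integral>x. (g x)\<^sup>2 \<partial>gauss))"
    using g_sq(1) by (subst nn_integral_eq_integral) auto
  also have "\<dots> \<le> ennreal (4 * \<eta>\<^sup>2)" using g_sq(2) by (intro ennreal_leI) simp
  finally have 1: "emeasure M E * (\<integral>\<^sup>+x. ennreal ((norm (T x - x))\<^sup>2) \<partial>gauss) \<le> ennreal (4 * \<eta>\<^sup>2)" .
  have "space M - E \<in> sets \<F>"
    using E_F sub by (metis sets.compl_sets subalgebra_def)
  then have "(\<integral>\<^sup>+\<omega>. indicator (space M - E) \<omega> * ennreal ((norm (X \<omega>))\<^sup>2 + real CARD('n)) \<partial>M)
      \<le> (\<integral>\<^sup>+\<omega>. indicator (space M - E) \<omega> * ennreal (2 * real CARD('n) + sqrt (real CARD('n)) * norm (D \<omega>)) \<partial>M)"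
    by (rule second_moment')
  also have "\<dots> \<le> (\<integral>\<^sup>+\<omega>. ennreal (40 * real CARD('n) * norm (D \<omega>) ^ 4) \<partial>M)"
  proof (rule nn_integral_mono)
    fix \<omega>
    \<comment> \<open>For t > 1/2 one has 1 \<le> 16 t^4 and t \<le> 8 t^4; the constant is 2 * 16 +
      8 = 40.\<close>
    have "2 * real CARD('n) + sqrt (real CARD('n)) * norm (D \<omega>) \<le> 40 * real CARD('n) * norm (D \<omega>) ^ 4"
      if "\<omega> \<in> space M - E"
    proof -
      define t where "t = norm (D \<omega>)"
      have t: "1/2 < t" using outside_E[OF that] by (simp add: t_def)
      have t3: "1 \<le> 8 * t ^ 3" using power_mono[of "1/2" t 3] t by (simp add: power_divide)
      have t4: "1 \<le> 16 * t ^ 4" using power_mono[of "1/2" t 4] t by (simp add: power_divide)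
      have d: "1 \<le> real CARD('n)" by (simp add: Suc_leI)
      have "sqrt (real CARD('n)) * t \<le> real CARD('n) * (8 * t ^ 4)"
      proof (rule mult_mono)
        show "sqrt (real CARD('n)) \<le> real CARD('n)"
          using d by (intro real_le_lsqrt) (auto simp: power2_eq_square)
        show "t \<le> 8 * t ^ 4" using mult_left_mono[OF t3, of t] t by (simp add: power_numeral_reduce)
      qed (use t in auto)
      moreover have "real CARD('n) * 1 \<le> real CARD('n) * (16 * t ^ 4)" using t4 by (intro mult_left_mono) auto
      ultimately have "2 * real CARD('n) + sqrt (real CARD('n)) * t \<le> 40 * real CARD('n) * t ^ 4"
        by linarith
      then show ?thesis by (simp add: t_def)
    qed
    then show "indicator (space M - E) \<omega> * ennreal (2 * real CARD('n) + sqrt (real CARD('n)) * norm (D \<omega>)) \<le> ennreal (40 * real CARD('n) * norm (D \<omega>) ^ 4)"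
      by (auto intro: ennreal_leI simp del: ennreal_plus split: split_indicator)
  qed
  also have "\<dots> = ennreal (40 * real CARD('n) * M4)"
    using int_D4 by (subst nn_integral_eq_integral) (auto simp: M4_def)
  finally have "(\<integral>\<^sup>+z. ennreal ((norm (fst z - snd z))\<^sup>2) \<partial>\<pi>) \<le> ennreal (4 * \<eta>\<^sup>2) + ennreal (40 * real CARD('n) * M4)"
    unfolding c using 1 by (intro add_mono)
  also have "\<dots> = ennreal (4 * \<eta>\<^sup>2 + 40 * real CARD('n) * M4)"
    using M4_nonneg by (subst ennreal_plus) auto
  finally show ?thesis using \<pi> by blast
qed

text \<open>The independent coupling, obtained from \<open>mixed_coupling\<close> with the empty
  event. Its cost is not small, but neither is M4, because \<delta> > 1/2 forces 1 \<le> 32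
  M4.\<close>

lemma coupling_large_delta:
  assumes "1/2 < \<delta>"
  shows "\<exists>\<pi>\<in>couplings (distr M borel X) gauss.
    (\<integral>\<^sup>+z. ennreal ((norm (fst z - snd z))\<^sup>2) \<partial>\<pi>) \<le> ennreal (88 * real CARD('n) * M4)"
proof -
  obtain \<pi> where \<pi>: "\<pi> \<in> couplings (distr M borel X) gauss"
    and c: "(\<integral>\<^sup>+z. ennreal ((norm (fst z - snd z))\<^sup>2) \<partial>\<pi>) =
      emeasure M {} * (\<integral>\<^sup>+x. ennreal ((norm (x - x))\<^sup>2) \<partial>(gauss :: (real^'n) measure))
      + (\<integral>\<^sup>+\<omega>. indicator (space M - {}) \<omega> * ennreal ((norm (X \<omega>))\<^sup>2 + real CARD('n)) \<partial>M)"
    using mixed_coupling[of "{}" "\<lambda>x. x"] by auto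
  have d: "1 \<le> real CARD('n)" by (simp add: Suc_leI)
  have m4: "1 \<le> 32 * M4" using delta_le(2) assms by simp
  have "space M \<in> sets \<F>" using sub by (metis sets.top subalgebra_def)
  from second_moment'[OF this] have "(\<integral>\<^sup>+\<omega>. indicator (space M - {}) \<omega> * ennreal ((norm (X \<omega>))\<^sup>2 + real CARD('n)) \<partial>M)
     \<le> (\<integral>\<^sup>+\<omega>. indicator (space M) \<omega> * ennreal (2 * real CARD('n) + sqrt (real CARD('n)) * norm (D \<omega>)) \<partial>M)"
    by simp
  also have "\<dots> \<le> (\<integral>\<^sup>+\<omega>. ennreal (real CARD('n) * (5/2 + 8 * norm (D \<omega>) ^ 4)) \<partial>M)"
  proof (rule nn_integral_mono)
    fix \<omega>
    define t where "t = norm (D \<omega>)"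
    have t0: "0 \<le> t" by (simp add: t_def)
    have "t \<le> 1/2 + 8 * t ^ 4"
    proof (cases "t \<le> 1/2")
      case False
      then have t3: "1 \<le> 8 * t ^ 3" using power_mono[of "1/2" t 3] by (simp add: power_divide)
      show ?thesis using mult_left_mono[OF t3, of t] t0 by (simp add: power_numeral_reduce)
    qed (use t0 in \<open>auto intro: add_increasing2\<close>)
    moreover have "sqrt (real CARD('n)) \<le> real CARD('n)"
      using d by (intro real_le_lsqrt) (auto simp: power2_eq_square)
    ultimately have "sqrt (real CARD('n)) * t \<le> real CARD('n) * (1/2 + 8 * t ^ 4)"
      using t0 by (intro mult_mono) auto
    then have "2 * real CARD('n) + sqrt (real CARD('n)) * t \<le> real CARD('n) * (5/2 + 8 * t ^ 4)"
      by (simp add: algebra_simps)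
    then show "indicator (space M) \<omega> * ennreal (2 * real CARD('n) + sqrt (real CARD('n)) * norm (D \<omega>))
        \<le> ennreal (real CARD('n) * (5/2 + 8 * norm (D \<omega>) ^ 4))"
      by (auto intro: ennreal_leI simp: t_def simp del: ennreal_plus split: split_indicator)
  qed
  also have "\<dots> = ennreal (\<integral>\<omega>. real CARD('n) * (5/2 + 8 * norm (D \<omega>) ^ 4) \<partial>M)"
    using int_D4 by (intro nn_integral_eq_integral) auto
  also have "(\<integral>\<omega>. real CARD('n) * (5/2 + 8 * norm (D \<omega>) ^ 4) \<partial>M) = real CARD('n) * (5/2 + 8 * M4)"
    using int_D4 by (simp add: M4_def prob_space)
  \<comment> \<open>By 1 \<le> 32 M4 the constant 5/2 is at most 80 M4.\<close>
  also have "ennreal (real CARD('n) * (5/2 + 8 * M4)) \<le> ennreal (real CARD('n) * (88 * M4))"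
    using m4 by (intro ennreal_leI mult_left_mono) auto
  finally have "(\<integral>\<^sup>+z. ennreal ((norm (fst z - snd z))\<^sup>2) \<partial>\<pi>) \<le> ennreal (88 * real CARD('n) * M4)"
    unfolding c by (simp add: mult_ac del: ennreal_plus)
  then show ?thesis using \<pi> by blast
qed

definition "e = norm (\<integral>\<omega>. D \<omega> \<partial>M)"

lemma M2_le: "M2 \<le> sqrt M4"
  using M2_sq_le by (rule real_le_rsqrt)

text \<open>The terms with sqrt M4 add up to 3/2 + 1 from \<eta> and 4 from \<delta>, which is below
  the 8 in \<open>b1\<close>.\<close>

lemma tv_bound':
  assumes "C \<in> sets borel"
  shows "\<bar>measure (distr M borel X) C - measure gauss C\<bar> \<le> e / sqrt 2 + 8 * sqrt M4"
proof -
  have s2: "1 \<le> sqrt 2" "sqrt 2 \<le> 3/2" by (simp, rule real_le_lsqrt) (auto simp: power2_eq_square)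
  have "\<eta> = e / sqrt 2 + M2 * (2 / sqrt 2) + sqrt M4 / sqrt 2"
    unfolding \<eta>_def e_def by (simp add: add_divide_distrib real_sqrt_divide mult.commute)
  also have "2 / sqrt 2 = sqrt 2" by (simp add: real_div_sqrt)
  also have "e / sqrt 2 + M2 * sqrt 2 + sqrt M4 / sqrt 2 \<le> e / sqrt 2 + sqrt M4 * (3/2) + sqrt M4 / 1"
    using s2 M2_le M2_nonneg M4_nonneg by (intro add_mono mult_mono divide_left_mono order_refl) auto
  finally have "\<eta> + \<delta> \<le> e / sqrt 2 + 8 * sqrt M4"
    using delta_le(1) M2_le M2_nonneg by simp
  then show ?thesis using tv_bound[OF assms] by simp
qed

text \<open>The cost is given as a square c^2 so that c is directly a Wasserstein bound. The numbers
  96 and 66 are lower bounds for terms under the root in \<open>b2\<close>, after the powers of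
  \<lambda>(K) are taken out.\<close>

lemma coupling_bound:
  "\<exists>\<pi>\<in>couplings (distr M borel X) gauss. \<exists>c. 0 \<le> c \<and>
    (\<integral>\<^sup>+z. ennreal ((norm (fst z - snd z))\<^sup>2) \<partial>\<pi>) \<le> ennreal (c\<^sup>2) \<and>
    c \<le> sqrt 2 * e + sqrt (96 + 66 * (real CARD('n))\<^sup>2) * sqrt M4"
proof -
  define d where "d = real CARD('n)"
  have d: "1 \<le> d" by (simp add: d_def Suc_leI)
  have e: "0 \<le> e" by (simp add: e_def)
  have s4: "0 \<le> sqrt M4" using M4_nonneg by simp
  show ?thesis
  proof (cases "\<delta> \<le> 1/2")
    case True
    obtain \<pi> where \<pi>: "\<pi>\<in>couplings (distr M borel X) gauss"
      "(\<integral>\<^sup>+z. ennreal ((norm (fst z - snd z))\<^sup>2) \<partial>\<pi>) \<le> ennreal (4 * \<eta>\<^sup>2 + 40 * d * M4)"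
      using coupling_small_delta[OF True] by (auto simp: d_def)
    let ?c = "sqrt (4 * \<eta>\<^sup>2 + 40 * d * M4)"
    have "2 * \<eta> = e * (2 / sqrt 2) + 2 * M2 * (2 / sqrt 2) + sqrt M4 * (2 / sqrt 2)"
      unfolding \<eta>_def e_def by (simp add: add_divide_distrib real_sqrt_divide mult.commute)
    also have "2 / sqrt 2 = sqrt 2" by (simp add: real_div_sqrt)
    also have "e * sqrt 2 + 2 * M2 * sqrt 2 + sqrt M4 * sqrt 2 \<le> e * sqrt 2 + 2 * sqrt M4 * sqrt 2 + sqrt M4 * sqrt 2"
      using M2_le by (intro add_mono mult_mono) (auto simp: s4 M2_nonneg M4_nonneg e)
    finally have eta: "2 * \<eta> \<le> e * sqrt 2 + 2 * sqrt M4 * sqrt 2 + sqrt M4 * sqrt 2" .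
    have "?c \<le> sqrt (4 * \<eta>\<^sup>2) + sqrt (40 * d * M4)"
      using d M4_nonneg by (intro sqrt_add_le_add_sqrt) auto
    also have "\<dots> = 2 * \<eta> + sqrt (40 * d) * sqrt M4"
      using eta_nonneg by (simp add: real_sqrt_mult)
    also have "\<dots> \<le> sqrt 2 * e + (3 * sqrt 2 + sqrt (40 * d)) * sqrt M4"
      using eta by (simp add: algebra_simps)
    also have "\<dots> \<le> sqrt 2 * e + sqrt (96 + 66 * d\<^sup>2) * sqrt M4"
    proof (intro add_left_mono mult_right_mono s4 real_le_rsqrt)
      \<comment> \<open>The mixed term of the square is made linear in d by sqrt d \<le> (1 + d) /
        2; what remains is 45 + 67 d, to be compared with 96 + 66 d^2.\<close>
      have "sqrt 80 * sqrt d \<le> 9 * ((1 + d) / 2)"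
      proof (rule mult_mono)
        show "sqrt 80 \<le> 9" by (rule real_le_lsqrt) auto
        have "0 \<le> (sqrt d - 1)\<^sup>2" by simp
        then show "sqrt d \<le> (1 + d) / 2" using d by (simp add: power2_diff)
      qed (use d in auto)
      then have x: "6 * (sqrt 2 * sqrt (40 * d)) \<le> 27 * (1 + d)"
        by (simp add: real_sqrt_mult[symmetric] mult_ac)
      have "(3 * sqrt 2 + sqrt (40 * d))\<^sup>2 = 18 + 6 * (sqrt 2 * sqrt (40 * d)) + 40 * d"
        using d by (simp add: power2_sum power_mult_distrib)
      also have "\<dots> \<le> 45 + 67 * d" using x by simp
      also have "\<dots> \<le> 96 + 66 * d\<^sup>2"
      proof -
        have "66 * (1 * d) \<le> 66 * (d * d)" using d by (intro mult_left_mono mult_right_mono) auto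
        moreover have "0 \<le> (d - 1)\<^sup>2" by simp
        ultimately show ?thesis using d by (simp add: power2_eq_square algebra_simps) 
      qed
      finally show "(3 * sqrt 2 + sqrt (40 * d))\<^sup>2 \<le> 96 + 66 * d\<^sup>2" .
    qed
    finally have c: "?c \<le> sqrt 2 * e + sqrt (96 + 66 * d\<^sup>2) * sqrt M4" .
    have sq: "?c\<^sup>2 = 4 * \<eta>\<^sup>2 + 40 * d * M4" using d M4_nonneg by simp
    show ?thesis
    proof (rule bexI[OF _ \<pi>(1)], rule exI[of _ ?c], intro conjI)
      show "0 \<le> ?c" using d M4_nonneg by simp
      show "(\<integral>\<^sup>+z. ennreal ((norm (fst z - snd z))\<^sup>2) \<partial>\<pi>) \<le> ennreal (?c\<^sup>2)"
        using \<pi>(2) unfolding sq .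
      show "?c \<le> sqrt 2 * e + sqrt (96 + 66 * (real CARD('n))\<^sup>2) * sqrt M4" using c unfolding d_def .
    qed
  next
    case False
    obtain \<pi> where \<pi>: "\<pi>\<in>couplings (distr M borel X) gauss"
      "(\<integral>\<^sup>+z. ennreal ((norm (fst z - snd z))\<^sup>2) \<partial>\<pi>) \<le> ennreal (88 * d * M4)"
      using coupling_large_delta False by (auto simp: d_def)
    let ?c = "sqrt (88 * d * M4)"
    have "?c = sqrt (88 * d) * sqrt M4" by (rule real_sqrt_mult)
    also have "\<dots> \<le> sqrt (96 + 66 * d\<^sup>2) * sqrt M4"
    proof (intro mult_right_mono s4 real_sqrt_le_mono)
      \<comment> \<open>Completing the square in 66 d^2 - 88 d, scaled by 66.\<close>
      have "0 \<le> (66 * d - 44)\<^sup>2" by simp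
      then show "88 * d \<le> 96 + 66 * d\<^sup>2" by (simp add: power2_eq_square algebra_simps)
    qed
    also have "\<dots> \<le> sqrt 2 * e + sqrt (96 + 66 * d\<^sup>2) * sqrt M4" using e by simp
    finally have c: "?c \<le> sqrt 2 * e + sqrt (96 + 66 * d\<^sup>2) * sqrt M4" .
    have sq: "?c\<^sup>2 = 88 * d * M4" using d M4_nonneg by simp
    show ?thesis
    proof (rule bexI[OF _ \<pi>(1)], rule exI[of _ ?c], intro conjI)
      show "0 \<le> ?c" using d M4_nonneg by simp
      show "(\<integral>\<^sup>+z. ennreal ((norm (fst z - snd z))\<^sup>2) \<partial>\<pi>) \<le> ennreal (?c\<^sup>2)"
        using \<pi>(2) unfolding sq .
      show "?c \<le> sqrt 2 * e + sqrt (96 + 66 * (real CARD('n))\<^sup>2) * sqrt M4" using c unfolding d_def .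
    qed
  qed
qed

end

subsection \<open>Constants and the main theorem\<close>

lemma S_const_ge: "1 \<le> n \<Longrightarrow> 12 \<le> S_const n"
proof -
  assume n: "1 \<le> n"
  have "2.4 \<le> sqrt (6::real)" "1.4 \<le> sqrt (2::real)" by (rule real_le_rsqrt, simp add: power2_eq_square)+
  moreover have "1 \<le> sqrt (real n)" using n by simp
  ultimately show ?thesis unfolding S_const_def by linarith
qed

lemma c0_ge: "33 \<le> c0"
proof -
  have "3.1 \<le> sqrt (10::real)" "5.4 \<le> sqrt (30::real)" "3.8 \<le> sqrt (15::real)" "2.2 \<le> sqrt (5::real)" "0 \<le> sqrt (3::real)"
    by (rule real_le_rsqrt, simp add: power2_eq_square)+
  then show ?thesis unfolding c0_def by linarith
qed

lemma sqrt_ratio_ge: "6/5 \<le> sqrt 3 / sqrt (2::real)" "4/5 \<le> sqrt 2 / sqrt (3::real)"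
  unfolding real_sqrt_divide[symmetric] by (rule real_le_rsqrt, simp add: power2_eq_square)+

lemma M_const_nonneg: "0 \<le> M_const K"
  unfolding M_const_def by (intro max.coboundedI1) simp

context
  fixes K :: "real^'n^'n"
  assumes K: "positive_semidefinite K" "invertible K"
begin

lemma S_const_ge': "12 \<le> S_const CARD('n)"
  by (rule S_const_ge) (simp add: Suc_leI)

text \<open>The square root has radicand at least 12 * (6/5) / 24 = 3/5, which exceeds the 1/2
  required by the first-order term.\<close>

lemma a1_ge: "1 / sqrt 2 / min_eigenvalue K \<le> a1 K"
proof -
  have "1 / 2 \<le> 1 / 24 * (6/5) * (12::real)" by simp
  also have "\<dots> \<le> 1 / 24 * (sqrt 3 / sqrt 2) * S_const CARD('n)"
    using sqrt_ratio_ge S_const_ge' by (intro mult_mono) auto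
  finally have "sqrt (1 / 2) \<le> sqrt (sqrt 3 / (24 * sqrt 2) * S_const CARD('n))" by simp
  then have "sqrt (1 / 2) * (1 / min_eigenvalue K) \<le> a1 K"
    unfolding a1_def using norm_inv_ge[OF K] min_eigenvalue_pos[OF K] S_const_ge' by (intro mult_mono) auto
  then show ?thesis by (simp add: real_sqrt_divide)
qed

lemma a2_ge: "sqrt (op_norm K) * (sqrt 2 / min_eigenvalue K) \<le> a2 K"
proof -
  have "2 \<le> 1 / 6 * (6/5) * (12::real)" by simp
  also have "\<dots> \<le> 1 / 6 * (sqrt 3 / sqrt 2) * S_const CARD('n)"
    using sqrt_ratio_ge S_const_ge' by (intro mult_mono) auto
  finally have "sqrt 2 \<le> sqrt (sqrt 3 / (6 * sqrt 2) * S_const CARD('n))" by simp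
  then have "sqrt 2 * (1 / min_eigenvalue K) \<le> sqrt (sqrt 3 / (6 * sqrt 2) * S_const CARD('n)) * norm (matrix_inv K)"
    using norm_inv_ge[OF K] min_eigenvalue_pos[OF K] S_const_ge' by (intro mult_mono) auto
  then have "sqrt (op_norm K) * (sqrt 2 * (1 / min_eigenvalue K)) \<le> sqrt (op_norm K) * (sqrt (sqrt 3 / (6 * sqrt 2) * S_const CARD('n)) * norm (matrix_inv K))"
    using min_eigenvalue_pos[OF K] min_eigenvalue_le_op_norm[OF K] by (intro mult_left_mono) auto
  then show ?thesis by (simp add: a2_def mult.assoc)
qed

text \<open>Both factors are estimated through \<lambda>(K): the inverse has norm at least 1 /
  \<lambda>(K) and K has norm at least \<lambda>(K), whence 1 + 4.\<close>

lemma inv_norm_product_ge: "5 \<le> (norm (matrix_inv K))\<^sup>2 * ((min_eigenvalue K)\<^sup>2 + 4 * (norm K)\<^sup>2)"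
proof -
  let ?l = "min_eigenvalue K"
  have l: "0 < ?l" by (rule min_eigenvalue_pos[OF K])
  have "1 * ?l \<le> sqrt (real CARD('n)) * ?l" using l by (intro mult_right_mono) (auto simp: Suc_leI)
  also have "\<dots> \<le> norm K" by (rule norm_ge_min_eigenvalue[OF K])
  finally have nk: "?l\<^sup>2 \<le> (norm K)\<^sup>2" using l by (intro power_mono) auto
  have "5 = (1 / ?l)\<^sup>2 * (?l\<^sup>2 + 4 * ?l\<^sup>2)" using l by (simp add: power_divide)
  also have "\<dots> \<le> (norm (matrix_inv K))\<^sup>2 * (?l\<^sup>2 + 4 * (norm K)\<^sup>2)"
    using norm_inv_ge[OF K] nk l by (intro mult_mono power_mono add_mono) auto
  finally show ?thesis .
qed

text \<open>The bound of \<open>tv_bound'\<close> is matched by the summand outside the root; the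
  three terms under the root are nonnegative.\<close>

lemma b1_ge: "8 / (min_eigenvalue K)\<^sup>2 \<le> b1 K"
proof -
  have "0 \<le> sqrt 2 / (2 * sqrt 3 * min_eigenvalue K ^ 4) * S_const CARD('n) * (norm (matrix_inv K))\<^sup>2
             * ((min_eigenvalue K)\<^sup>2 + 4 * (norm K)\<^sup>2)"
    using S_const_ge' min_eigenvalue_pos[OF K] by (intro mult_nonneg_nonneg) auto
  moreover have "0 \<le> sqrt 70 * (real CARD('n))\<^sup>2 / (2 * min_eigenvalue K ^ 4) * (M_const K / 2 + (sqrt 2 + 1) * real CARD('n) / 4)"
    using M_const_nonneg[of K] min_eigenvalue_pos[OF K] by (intro mult_nonneg_nonneg add_nonneg_nonneg) auto
  moreover have "0 \<le> c0 * (real CARD('n))\<^sup>2 / (2 * min_eigenvalue K ^ 4)"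
    using c0_ge min_eigenvalue_pos[OF K] by (intro divide_nonneg_nonneg mult_nonneg_nonneg) auto
  ultimately show ?thesis unfolding b1_def Let_def by simp
qed

text \<open>Under the root the first term gives 2 * (4/5) * 12 * 5 = 96 and the last gives 2 * 33 =
  66 times d^2, by the numerical bounds on the two constants.\<close>

lemma b2_ge: "sqrt (op_norm K) * (sqrt (96 + 66 * (real CARD('n))\<^sup>2) / (min_eigenvalue K)\<^sup>2) \<le> b2 K"
proof -
  let ?l = "min_eigenvalue K" and ?d = "real CARD('n)"
  have l: "0 < ?l" by (rule min_eigenvalue_pos[OF K])
  have "96 / ?l ^ 4 = 2 * (4/5) / ?l ^ 4 * 12 * 5" by simp
  also have "\<dots> \<le> 2 * (sqrt 2 / sqrt 3) / ?l ^ 4 * S_const CARD('n) * ((norm (matrix_inv K))\<^sup>2 * (?l\<^sup>2 + 4 * (norm K)\<^sup>2))"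
    using sqrt_ratio_ge(2) S_const_ge' inv_norm_product_ge l
    by (intro mult_mono divide_right_mono) auto
  finally have 1: "96 / ?l ^ 4 \<le> 2 * sqrt 2 / (sqrt 3 * ?l ^ 4) * S_const CARD('n) * (norm (matrix_inv K))\<^sup>2 * (?l\<^sup>2 + 4 * (norm K)\<^sup>2)"
    by (simp add: mult.assoc)
  have 2: "0 \<le> 2 * sqrt 70 * ?d\<^sup>2 / ?l ^ 4 * (M_const K / 2 + (sqrt 2 + 1) * ?d / 4)"
    using M_const_nonneg[of K] l by (intro mult_nonneg_nonneg add_nonneg_nonneg) auto
  have 3: "66 * ?d\<^sup>2 / ?l ^ 4 \<le> 2 * c0 * ?d\<^sup>2 / ?l ^ 4"
    using c0_ge l by (intro divide_right_mono mult_right_mono) auto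
  have "sqrt ((96 + 66 * ?d\<^sup>2) / ?l ^ 4) \<le> sqrt (2 * sqrt 2 / (sqrt 3 * ?l ^ 4) * S_const CARD('n) * (norm (matrix_inv K))\<^sup>2
             * (?l\<^sup>2 + 4 * (norm K)\<^sup>2)
           + 2 * sqrt 70 * ?d\<^sup>2 / ?l ^ 4 * (M_const K / 2 + (sqrt 2 + 1) * ?d / 4)
           + 2 * c0 * ?d\<^sup>2 / ?l ^ 4)" (is "_ \<le> ?r")
    using 1 2 3 unfolding add_divide_distrib by (intro real_sqrt_le_mono) linarith
  moreover have "sqrt ((96 + 66 * ?d\<^sup>2) / ?l ^ 4) = sqrt (96 + 66 * ?d\<^sup>2) / ?l\<^sup>2"
  proof -
    have "sqrt (?l ^ 4) = ?l\<^sup>2" using l by (intro real_sqrt_unique) auto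
    then show ?thesis by (simp add: real_sqrt_divide)
  qed
  ultimately have "sqrt (op_norm K) * (sqrt (96 + 66 * ?d\<^sup>2) / ?l\<^sup>2) \<le> sqrt (op_norm K) * ?r"
    using l min_eigenvalue_le_op_norm[OF K] by (intro mult_left_mono) auto
  also have "\<dots> \<le> b2 K" unfolding b2_def Let_def by simp
  finally show ?thesis .
qed

end

section \<open>Change of variables and reduction to the standardised problem\<close>

lemma matrix_matrix_mult_measurable [measurable (raw)]:
  fixes f :: "'a \<Rightarrow> real^'n^'m" and g :: "'a \<Rightarrow> real^'k^'n"
  assumes [measurable]: "f \<in> borel_measurable M" "g \<in> borel_measurable M"
  shows "(\<lambda>x. f x ** g x) \<in> borel_measurable M"
  by (simp add: borel_measurable_vec_vec_iff matrix_matrix_mult_def)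

lemma sandwich_linear: "bounded_linear (\<lambda>A. S ** A ** (S :: real^'n^'n))"
  by (intro linear_conv_bounded_linear[THEN iffD1] linearI)
    (auto simp: matrix_matrix_mult_def vec_eq_iff sum_distrib_left sum_distrib_right sum.distrib algebra_simps)

text \<open>Transposition preserves the Hilbert-Schmidt norm and moves the right factor to the left,
  so the one-sided bound can be used twice.\<close>

lemma norm_sandwich_le:
  fixes S :: "real^'n^'n"
  assumes sym: "transpose S = S" and bound: "\<And>v. norm (S *v v) \<le> c * norm v" and c: "0 \<le> c"
  shows "norm (S ** A ** S) \<le> c\<^sup>2 * norm A"
proof -
  have "norm (S ** (A ** S)) \<le> c * norm (A ** S)" by (rule norm_matrix_mult_le[OF bound c])
  also have "norm (A ** S) = norm (S ** transpose A)"
    by (metis sym norm_transpose matrix_transpose_mul)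
  also have "c * norm (S ** transpose A) \<le> c * (c * norm (transpose A))"
    by (intro mult_left_mono norm_matrix_mult_le[OF bound c] c)
  finally show ?thesis by (simp add: norm_transpose matrix_mul_assoc power2_eq_square)
qed

lemma inner_symmetric:
  fixes S :: "real^'n^'n"
  assumes "transpose S = S" shows "(S *v x) \<bullet> y = x \<bullet> (S *v y)"
  by (metis assms dot_lmul_matrix vector_transpose_matrix)

lemma wasserstein2_le:
  assumes "\<pi> \<in> couplings \<mu> \<nu>" "(\<integral>\<^sup>+z. ennreal ((norm (fst z - snd z))\<^sup>2) \<partial>\<pi>) \<le> ennreal (c\<^sup>2)" "0 \<le> c"
  shows "wasserstein2 \<mu> \<nu> \<le> ennreal c"
proof -
  let ?I = "\<integral>\<^sup>+z. ennreal ((norm (fst z - snd z))\<^sup>2) \<partial>\<pi>"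
  have "wasserstein2 \<mu> \<nu> \<le> ennreal_sqrt ?I"
    unfolding wasserstein2_def by (rule INF_lower[OF assms(1)])
  also have "\<dots> \<le> ennreal c"
  proof -
    have "?I \<noteq> \<infinity>" using assms(2) by (auto simp: top_unique)
    moreover have "enn2real ?I \<le> c\<^sup>2" by (rule enn2real_leI[OF _ assms(2)]) simp
    then have "sqrt (enn2real ?I) \<le> c" using assms(3) by (rule real_le_lsqrt[rotated])
    ultimately show ?thesis by (simp add: ennreal_sqrt_def ennreal_leI)
  qed
  finally show ?thesis .
qed

text \<open>Applying the linear map to both components preserves the coupling property and
  multiplies the root of the cost by at most the Lipschitz constant sqrt k.\<close>

lemma couplings_map:
  fixes R :: "real^'n^'n"
  assumes \<pi>: "\<pi> \<in> couplings \<mu> \<nu>"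
    and cost: "(\<integral>\<^sup>+z. ennreal ((norm (fst z - snd z))\<^sup>2) \<partial>\<pi>) \<le> ennreal (c\<^sup>2)"
    and R: "\<And>x. (norm (R *v x))\<^sup>2 \<le> k * (norm x)\<^sup>2" and k: "0 \<le> k"
  shows "\<exists>\<pi>'\<in>couplings (distr \<mu> borel ((*v) R)) (distr \<nu> borel ((*v) R)).
    (\<integral>\<^sup>+z. ennreal ((norm (fst z - snd z))\<^sup>2) \<partial>\<pi>') \<le> ennreal ((sqrt k * c)\<^sup>2)"
proof -
  have p: "prob_space \<pi>" and [measurable_cong]: "sets \<pi> = sets (borel \<Otimes>\<^sub>M borel)"
    and marg: "distr \<pi> borel fst = \<mu>" "distr \<pi> borel snd = \<nu>"
    using \<pi> by (auto simp: couplings_def)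
  let ?h = "\<lambda>z. (R *v fst z, R *v snd z)"
  have [measurable]: "?h \<in> measurable \<pi> (borel \<Otimes>\<^sub>M borel)" by measurable
  let ?\<pi> = "distr \<pi> (borel \<Otimes>\<^sub>M borel) ?h"
  have "?\<pi> \<in> couplings (distr \<mu> borel ((*v) R)) (distr \<nu> borel ((*v) R))"
    unfolding couplings_def marg[symmetric]
    by (auto intro!: prob_space.prob_space_distr p simp: distr_distr comp_def)
  moreover have "(\<integral>\<^sup>+z. ennreal ((norm (fst z - snd z))\<^sup>2) \<partial>?\<pi>) \<le> ennreal ((sqrt k * c)\<^sup>2)"
  proof -
    have "(\<integral>\<^sup>+z. ennreal ((norm (fst z - snd z))\<^sup>2) \<partial>?\<pi>) = (\<integral>\<^sup>+z. ennreal ((norm (R *v (fst z - snd z)))\<^sup>2) \<partial>\<pi>)"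
      by (subst nn_integral_distr) (auto simp: matrix_vector_mult_diff_distrib)
    also have "\<dots> \<le> (\<integral>\<^sup>+z. ennreal k * ennreal ((norm (fst z - snd z))\<^sup>2) \<partial>\<pi>)"
      using k by (intro nn_integral_mono) (auto simp: ennreal_mult[symmetric] intro!: ennreal_leI R)
    also have "\<dots> = ennreal k * (\<integral>\<^sup>+z. ennreal ((norm (fst z - snd z))\<^sup>2) \<partial>\<pi>)"
      by (rule nn_integral_cmult) measurable
    also have "\<dots> \<le> ennreal k * ennreal (c\<^sup>2)" using cost by (rule mult_left_mono) simp
    also have "\<dots> = ennreal ((sqrt k * c)\<^sup>2)" using k by (simp add: ennreal_mult[symmetric] power_mult_distrib)
    finally show ?thesis .
  qed
  ultimately show ?thesis by blast
qed

theorem theorem3: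
  fixes M \<F> :: "'a measure"
    and K :: "real^'n^'n"
    and A :: "'a \<Rightarrow> real^'n^'n"
    and F G :: "'a \<Rightarrow> real^'n"
  assumes "prob_space M"
    and "positive_semidefinite K" and "invertible K"
    and "G \<in> borel_measurable M" and "gaussian_law 0 K (distr M borel G)"
    and "conditionally_gaussian M \<F> A F"
    and "integrable M (\<lambda>\<omega>. hs_norm (A \<omega>) ^ 8)"
  shows "d_TV M F G
           \<le> a1 K * hs_norm (integral\<^sup>L M A - K)
             + b1 K * (integral\<^sup>L M (\<lambda>\<omega>. hs_norm (A \<omega> - K) ^ 8)) powr (1/4)
         \<and> W2 M F G
           \<le> ennreal (a2 K * hs_norm (integral\<^sup>L M A - K)
             + b2 K * (integral\<^sup>L M (\<lambda>\<omega>. hs_norm (A \<omega> - K) ^ 8)) powr (1/4))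
         \<and> max (ennreal (d_TV M F G)) (W2 M F G)
           \<le> ennreal (C3 K * hs_norm (integral\<^sup>L M A - K)
             + C4 K * (integral\<^sup>L M (\<lambda>\<omega>. hs_norm (A \<omega> - K) ^ 8)) powr (1/4))"
proof -
  interpret prob_space M by fact
  note K = assms(2,3)
  have [measurable]: "G \<in> borel_measurable M" by fact
  have cg: "subalgebra M \<F>" "integrable M F" "A \<in> borel_measurable \<F>"
    "\<And>\<omega>. \<omega> \<in> space M \<Longrightarrow> positive_semidefinite (A \<omega>)"
    "\<And>y. AE \<omega> in M. complex_cond_exp M \<F> (\<lambda>x. iex (y \<bullet> F x)) \<omega> = of_real (exp (- (y \<bullet> (A \<omega> *v y)) / 2))"
    using assms(6) unfolding conditionally_gaussian_def by auto
  have F_meas [measurable]: "F \<in> borel_measurable M" using cg(2) by (rule borel_measurable_integrable)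
  have A_meas [measurable]: "A \<in> borel_measurable M" using cg(3,1) by (rule measurable_from_subalg[rotated])
  define l where "l = min_eigenvalue K"
  define k where "k = op_norm K"
  have l: "0 < l" unfolding l_def by (rule min_eigenvalue_pos[OF K])
  have k: "0 \<le> k" using min_eigenvalue_le_op_norm[OF K] l by (simp add: k_def l_def)
  obtain R S :: "real^'n^'n" where symS: "transpose S = S" and RS: "R ** S = mat 1" and SKS: "S ** K ** S = mat 1"
    and symR: "transpose R = R" and SR: "S ** R = mat 1"
    and R_bound: "\<And>x. (norm (R *v x))\<^sup>2 \<le> k * (norm x)\<^sup>2"
    and S_bound: "\<And>x. (norm (S *v x))\<^sup>2 \<le> (norm x)\<^sup>2 / l"
    using covariance_root[OF K] unfolding k_def l_def by metis
  have S_bound': "norm (S *v v) \<le> 1 / sqrt l * norm v" for v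
  proof (rule power2_le_imp_le)
    show "(norm (S *v v))\<^sup>2 \<le> (1 / sqrt l * norm v)\<^sup>2"
      using S_bound[of v] l by (simp add: power_mult_distrib power_divide)
  qed (use l in simp)
  have sandwich: "norm (S ** H ** S) \<le> norm H / l" for H
    using norm_sandwich_le[OF symS S_bound', of H] l by (simp add: power_divide)
  have RR: "R ** R = K"
  proof -
    have "R ** R = R ** (S ** K ** S) ** R" by (simp add: SKS)
    also have "\<dots> = (R ** S) ** K ** (S ** R)" by (simp add: matrix_mul_assoc)
    finally show ?thesis by (simp add: RS SR)
  qed
  define X where "X \<omega> = S *v F \<omega>" for \<omega>
  define B where "B \<omega> = S ** A \<omega> ** S" for \<omega>
  have F_X: "F \<omega> = R *v X \<omega>" for \<omega> by (simp add: X_def matrix_vector_mul_assoc RS)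
  have BD: "B \<omega> - mat 1 = S ** (A \<omega> - K) ** S" for \<omega>
    using linear_diff[OF bounded_linear.linear[OF sandwich_linear], of S "A \<omega>" K] by (simp add: B_def SKS)
  have int8: "integrable M (\<lambda>\<omega>. norm (A \<omega> - K) ^ 8)"
  proof (rule Bochner_Integration.integrable_bound)
    show "integrable M (\<lambda>\<omega>. 256 * (norm (A \<omega>) ^ 8 + norm K ^ 8))" using assms(7) by simp
    have "norm (A \<omega> - K) ^ 8 \<le> 256 * (norm (A \<omega>) ^ 8 + norm K ^ 8)" for \<omega>
    proof -
      have "norm (A \<omega> - K) \<le> 2 * max (norm (A \<omega>)) (norm K)"
        using norm_triangle_ineq4[of "A \<omega>" K] by (simp add: max_def)
      then have "norm (A \<omega> - K) ^ 8 \<le> (2 * max (norm (A \<omega>)) (norm K)) ^ 8" by (intro power_mono) auto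
      also have "\<dots> = 256 * max (norm (A \<omega>)) (norm K) ^ 8" by (simp add: power_mult_distrib)
      also have "\<dots> \<le> 256 * (norm (A \<omega>) ^ 8 + norm K ^ 8)"
        by (intro mult_left_mono) (auto simp: max_def)
      finally show ?thesis .
    qed
    then show "AE \<omega> in M. norm (norm (A \<omega> - K) ^ 8) \<le> norm (256 * (norm (A \<omega>) ^ 8 + norm K ^ 8))"
      by (intro AE_I2) (simp add: abs_of_nonneg)
  qed simp
  have int4: "integrable M (\<lambda>\<omega>. norm (A \<omega> - K) ^ 4)"
  proof (rule Bochner_Integration.integrable_bound)
    show "integrable M (\<lambda>\<omega>. 1 + norm (A \<omega> - K) ^ 8)" using int8 by simp
    have "t ^ 4 \<le> 1 + t ^ 8" for t :: real
    proof -
      have "2 * t ^ 4 \<le> t ^ 8 + 1" using zero_le_power2[of "t ^ 4 - 1"] by (simp add: power2_diff power_mult[symmetric])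
      moreover have "0 \<le> t ^ 4" by simp
      ultimately show ?thesis by linarith
    qed
    then show "AE \<omega> in M. norm (norm (A \<omega> - K) ^ 4) \<le> norm (1 + norm (A \<omega> - K) ^ 8)"
      by (intro AE_I2) (simp add: abs_of_nonneg)
  qed simp
  interpret Y: conditional_gaussian M \<F> B X
  proof
    show "subalgebra M \<F>" by fact
    show "X \<in> borel_measurable M" unfolding X_def[abs_def] by measurable
    note [measurable] = cg(3)
    show "B \<in> borel_measurable \<F>" unfolding B_def[abs_def] by measurable
    show "positive_semidefinite (B \<omega>)" if "\<omega> \<in> space M" for \<omega>
    proof -
      have "transpose (B \<omega>) = B \<omega>"
        using cg(4)[OF that] by (simp add: B_def matrix_transpose_mul symS matrix_mul_assoc positive_semidefinite_def)
      moreover have "0 \<le> y \<bullet> (B \<omega> *v y)" for y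
      proof -
        have "y \<bullet> (B \<omega> *v y) = (S *v y) \<bullet> (A \<omega> *v (S *v y))"
          unfolding inner_symmetric[OF symS] by (simp add: B_def matrix_vector_mul_assoc matrix_mul_assoc)
        then show ?thesis using cg(4)[OF that] by (simp add: positive_semidefinite_def)
      qed
      ultimately show ?thesis by (simp add: positive_semidefinite_def)
    qed
    show "AE \<omega> in M. complex_cond_exp M \<F> (\<lambda>x. iex (y \<bullet> X x)) \<omega> = of_real (exp (- (y \<bullet> (B \<omega> *v y)) / 2))" for y
    proof -
      have "y \<bullet> (B \<omega> *v y) = (S *v y) \<bullet> (A \<omega> *v (S *v y))" for \<omega>
        unfolding inner_symmetric[OF symS] by (simp add: B_def matrix_vector_mul_assoc matrix_mul_assoc)
      moreover have "y \<bullet> X x = (S *v y) \<bullet> F x" for x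
        unfolding inner_symmetric[OF symS] X_def ..
      ultimately show ?thesis using cg(5)[of "S *v y"] by (simp only:)
    qed
    show "integrable M (\<lambda>\<omega>. norm (B \<omega> - mat 1) ^ 4)"
    proof (rule Bochner_Integration.integrable_bound)
      show "integrable M (\<lambda>\<omega>. norm (A \<omega> - K) ^ 4 / l ^ 4)" using int4 by simp
      have "norm (B \<omega> - mat 1) ^ 4 \<le> norm (A \<omega> - K) ^ 4 / l ^ 4" for \<omega>
        using power_mono[OF sandwich[of "A \<omega> - K"], of 4] by (simp add: BD power_divide)
      then show "AE \<omega> in M. norm (norm (B \<omega> - mat 1) ^ 4) \<le> norm (norm (A \<omega> - K) ^ 4 / l ^ 4)"
        using l by (intro AE_I2) (simp add: abs_of_nonneg)
      show "(\<lambda>\<omega>. norm (B \<omega> - mat 1) ^ 4) \<in> borel_measurable M" unfolding B_def[abs_def] by measurable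
    qed
  qed
  define s where "s = (integral\<^sup>L M (\<lambda>\<omega>. norm (A \<omega> - K) ^ 8)) powr (1/4)"
  define a where "a = norm (integral\<^sup>L M A - K)"
  have s0: "0 \<le> s" by (simp add: s_def)
  have a0: "0 \<le> a" by (simp add: a_def)
  have D_eq: "Y.D \<omega> = S ** (A \<omega> - K) ** S" for \<omega> unfolding Y.D_def by (rule BD)
  \<comment> \<open>The sandwich contributes 1 / l^4. Cauchy-Schwarz bounds the fourth moment of A -
    K by the root of the eighth, which is s^2, and the outer root leaves s / l^2.\<close>
  have M4: "sqrt Y.M4 \<le> s / l\<^sup>2"
  proof -
    let ?I = "\<integral>\<omega>. norm (A \<omega> - K) ^ 4 \<partial>M" and ?J = "\<integral>\<omega>. norm (A \<omega> - K) ^ 8 \<partial>M"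
    have "Y.M4 \<le> (\<integral>\<omega>. norm (A \<omega> - K) ^ 4 / l ^ 4 \<partial>M)"
      unfolding Y.M4_def
    proof (rule integral_mono[OF Y.int_D4])
      fix \<omega> show "norm (Y.D \<omega>) ^ 4 \<le> norm (A \<omega> - K) ^ 4 / l ^ 4"
        using power_mono[OF sandwich[of "A \<omega> - K"], of 4] by (simp add: D_eq power_divide)
    qed (use int4 in simp)
    then have "Y.M4 \<le> ?I / l ^ 4" by simp
    moreover have "?I \<le> sqrt ?J"
    proof (rule real_le_rsqrt)
      show "?I\<^sup>2 \<le> ?J"
        using square_integral_le[OF int4] int8 by (simp add: power_mult[symmetric])
    qed
    moreover have "sqrt ?J = s\<^sup>2"
    proof -
      have J: "0 \<le> ?J" by simp
      have "s\<^sup>2 = ?J powr (1/4 + 1/4)" unfolding s_def power2_eq_square powr_add ..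
      then show ?thesis using J by (simp add: powr_half_sqrt)
    qed
    ultimately have "Y.M4 \<le> ?I / l ^ 4" "?I / l ^ 4 \<le> s\<^sup>2 / l ^ 4"
      using l by (auto intro: divide_right_mono)
    then have "Y.M4 \<le> s\<^sup>2 / l ^ 4" by (rule order_trans)
    then have "sqrt Y.M4 \<le> sqrt ((s / l\<^sup>2)\<^sup>2)"
      by (intro real_sqrt_le_mono) (simp add: power_divide power_mult[symmetric])
    then show ?thesis using s0 by simp
  qed
  \<comment> \<open>The mean commutes with the linear sandwich, so the bias of the standardised
    covariance is the sandwich of the bias of A.\<close>
  have e: "Y.e \<le> a / l"
  proof -
    have int1: "integrable M (\<lambda>\<omega>. A \<omega> - K)"
    proof (rule Bochner_Integration.integrable_bound)
      show "integrable M (\<lambda>\<omega>. 1 + norm (A \<omega> - K) ^ 4)" using int4 by simp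
      have "t \<le> 1 + t ^ 4" for t :: real
      proof -
        have "2 * t \<le> t\<^sup>2 + 1" using zero_le_power2[of "t - 1"] by (simp add: power2_diff)
        moreover have "2 * t\<^sup>2 \<le> t ^ 4 + 1" using zero_le_power2[of "t\<^sup>2 - 1"] by (simp add: power2_diff)
        moreover have "0 \<le> t ^ 4" by simp
        ultimately show ?thesis by linarith
      qed
      then show "AE \<omega> in M. norm (A \<omega> - K) \<le> norm (1 + norm (A \<omega> - K) ^ 4)"
        by (intro AE_I2) (simp add: abs_of_nonneg)
    qed simp
    then have "integrable M (\<lambda>\<omega>. (A \<omega> - K) + K)" by (intro Bochner_Integration.integrable_add) auto
    then have intA: "integrable M A" by simp
    have "(\<integral>\<omega>. Y.D \<omega> \<partial>M) = S ** (\<integral>\<omega>. A \<omega> - K \<partial>M) ** S"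
      unfolding D_eq by (rule integral_bounded_linear[OF sandwich_linear int1])
    also have "(\<integral>\<omega>. A \<omega> - K \<partial>M) = integral\<^sup>L M A - K"
      using intA by (simp add: prob_space)
    finally show ?thesis unfolding Y.e_def a_def using sandwich by simp
  qed
  have lawF: "distr M borel F = distr (distr M borel X) borel ((*v) R)"
    by (subst distr_distr) (auto simp: comp_def F_X[symmetric])
  \<comment> \<open>G itself need not be related to the Gaussian coordinates; its law is identified
    by |R y|^2 = y \<bullet> (K y).\<close>
  have lawG: "distr M borel G = distr gauss borel ((*v) R)"
  proof (rule characteristic_function_unique)
    show "finite_measure (distr M borel G)" by (rule finite_measure_distr) simp
    show "finite_measure (distr gauss borel ((*v) R))"
      by (rule gauss.finite_measure_distr) simp
    fix y :: "real^'n"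
    have "(\<integral>x. iex (y \<bullet> x) \<partial>distr gauss borel ((*v) R)) = (\<integral>x. iex ((R *v y) \<bullet> x) \<partial>gauss)"
      by (subst integral_distr) (auto simp: inner_symmetric[OF symR])
    also have "\<dots> = of_real (exp (- (norm (R *v y))\<^sup>2 / 2))" by (rule cf_gauss)
    also have "(norm (R *v y))\<^sup>2 = y \<bullet> (K *v y)"
      unfolding power2_norm_eq_inner inner_symmetric[OF symR] by (simp add: matrix_vector_mul_assoc RR)
    also have "complex_of_real (exp (- (y \<bullet> (K *v y)) / 2)) = (\<integral>x. iex (y \<bullet> x) \<partial>distr M borel G)"
      using assms(5) by (simp add: gaussian_law_def exp_of_real[symmetric])
    finally show "(\<integral>x. iex (y \<bullet> x) \<partial>distr M borel G) = (\<integral>x. iex (y \<bullet> x) \<partial>distr gauss borel ((*v) R))" by simp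
  qed auto
  have TV: "d_TV M F G \<le> a1 K * a + b1 K * s"
    unfolding d_TV_def tv_dist_def
  proof (rule cSUP_least)
    fix C :: "(real^'n) set" assume [measurable]: "C \<in> sets borel"
    \<comment> \<open>Total variation transfers through preimages: the estimate for the standardised
      laws is applied to the preimage of C under \<open>R\<close>.\<close>
    have m: "(*v) R \<in> measurable borel borel" by measurable
    have RC: "(*v) R -` C \<in> sets borel" using measurable_sets[OF m, of C] by simp
    have "\<bar>measure (distr M borel F) C - measure (distr M borel G) C\<bar>
        = \<bar>measure (distr M borel X) ((*v) R -` C) - measure gauss ((*v) R -` C)\<bar>"
      unfolding lawF lawG by (subst (1 2) measure_distr) auto
    also have "\<dots> \<le> Y.e / sqrt 2 + 8 * sqrt Y.M4" by (rule Y.tv_bound'[OF RC])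
    also have "\<dots> \<le> (a / l) / sqrt 2 + 8 * (s / l\<^sup>2)"
      using e M4 by (intro add_mono divide_right_mono mult_left_mono) auto
    also have "\<dots> = 1 / sqrt 2 / l * a + 8 / l\<^sup>2 * s" by simp
    also have "\<dots> \<le> a1 K * a + b1 K * s"
      using a1_ge[OF K] b1_ge[OF K] a0 s0 by (intro add_mono mult_right_mono) (auto simp: l_def)
    finally show "\<bar>measure (distr M borel F) C - measure (distr M borel G) C\<bar> \<le> a1 K * a + b1 K * s" .
  qed auto
  have W: "W2 M F G \<le> ennreal (a2 K * a + b2 K * s)"
  proof -
    obtain \<pi> c where \<pi>: "\<pi> \<in> couplings (distr M borel X) gauss" "0 \<le> c"
      "(\<integral>\<^sup>+z. ennreal ((norm (fst z - snd z))\<^sup>2) \<partial>\<pi>) \<le> ennreal (c\<^sup>2)"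
      and c: "c \<le> sqrt 2 * Y.e + sqrt (96 + 66 * (real CARD('n))\<^sup>2) * sqrt Y.M4"
      using Y.coupling_bound by blast
    obtain \<pi>' where \<pi>': "\<pi>' \<in> couplings (distr M borel F) (distr M borel G)"
      "(\<integral>\<^sup>+z. ennreal ((norm (fst z - snd z))\<^sup>2) \<partial>\<pi>') \<le> ennreal ((sqrt k * c)\<^sup>2)"
      using couplings_map[OF \<pi>(1,3) R_bound k] unfolding lawF lawG by blast
    have "W2 M F G \<le> ennreal (sqrt k * c)"
      unfolding W2_def using k \<pi>(2) by (intro wasserstein2_le[OF \<pi>']) simp
    also have "\<dots> \<le> ennreal (a2 K * a + b2 K * s)"
    proof (rule ennreal_leI)
      have "sqrt k * c \<le> sqrt k * (sqrt 2 * (a / l) + sqrt (96 + 66 * (real CARD('n))\<^sup>2) * (s / l\<^sup>2))"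
        using e M4 k by (intro mult_left_mono order_trans[OF c] add_mono) auto
      also have "\<dots> = sqrt k * (sqrt 2 / l) * a + sqrt k * (sqrt (96 + 66 * (real CARD('n))\<^sup>2) / l\<^sup>2) * s"
        by (simp add: algebra_simps)
      also have "\<dots> \<le> a2 K * a + b2 K * s"
        using a2_ge[OF K] b2_ge[OF K] a0 s0 by (intro add_mono mult_right_mono) (auto simp: l_def k_def)
      finally show "sqrt k * c \<le> a2 K * a + b2 K * s" .
    qed
    finally show ?thesis .
  qed
  have "a1 K * a + b1 K * s \<le> C3 K * a + C4 K * s" "a2 K * a + b2 K * s \<le> C3 K * a + C4 K * s"
    unfolding C3_def C4_def using a0 s0 by (auto intro!: add_mono mult_right_mono)
  then have "max (ennreal (d_TV M F G)) (W2 M F G) \<le> ennreal (C3 K * a + C4 K * s)"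
    using TV W by (intro max.boundedI) (auto intro: ennreal_leI order_trans)
  with TV W show ?thesis unfolding a_def s_def by blast
qed

end
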